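(* Let $V:\mathbb{R}^3\to\mathbb{R}$ be a potential that is a relatively compact perturbation of $H_{\mathbf A}$ (i.e. $V(H_{\mathbf A}+1)^{-1}$ is compact) and such that $$V(x,y,z)\le\langle(x,y)\rangle^{-\alpha}\,v_\perp(z),\qquad (x,y,z)\in\mathbb{R}^3,$$ with $\alpha>1$ and $v_\perp\in L^p(\mathbb{R})$ a non-negative function, for some $p\in[1,2]$. Then $H_{\mathbf A}-V$ has at most a finite number of negative eigenvalues (counted with multiplicity).
   Context: $\langle x\rangle:=(1+|x|^2)^{1/2}$. With $r=\sqrt{x^2+y^2}$ and $D_j=-i\partial_j$, the operator $$H_{\mathbf A}=(-i\nabla-\mathbf A)^2=D_x^2+D_y^2+(D_z-\log r)^2,\qquad \mathbf A(x,y,z)=(0,0,\log r),$$ is initially defined on $C_0^\infty(\mathbb{R}^3)$ and then self-adjoint in $L^2(\mathbb{R}^3)$; its spectrum is $[0,+\infty)$. $V$ denotes both the real-valued function and the corresponding multiplication operator; when $V(H_{\mathbf A}+1)^{-1}$ is compact, $H_{\mathbf A}-V$ is self-adjoint with essential spectrum $[0,+\infty)$. *)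

theory Defs
  imports "HOL-Analysis.Analysis"
begin

section \<open>The Hilbert space of square-integrable complex functions\<close>

definition square_integrable :: "('a::euclidean_space \<Rightarrow> complex) \<Rightarrow> bool" where
  "square_integrable f \<longleftrightarrow>
     f \<in> borel_measurable lebesgue \<and> integrable lebesgue (\<lambda>x. (norm (f x))\<^sup>2)"

lemma square_integrable_zero [simp]: "square_integrable (\<lambda>x. 0)"
  by (simp add: square_integrable_def)

lemma square_integrable_mult:
  assumes "square_integrable f"
  shows "square_integrable (\<lambda>x. c * f x)"
  using assms by (auto simp: square_integrable_def norm_mult power_mult_distrib)

lemma square_integrable_add:
  assumes "square_integrable f" "square_integrable g"
  shows "square_integrable (\<lambda>x. f x + g x)"
proof -
  have [measurable]: "f \<in> borel_measurable lebesgue" "g \<in> borel_measurable lebesgue"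
    using assms by (auto simp: square_integrable_def)
  have "integrable lebesgue (\<lambda>x. 2 * (norm (f x))\<^sup>2 + 2 * (norm (g x))\<^sup>2)"
    using assms by (auto simp: square_integrable_def)
  then have "integrable lebesgue (\<lambda>x. (norm (f x + g x))\<^sup>2)"
  proof (rule Bochner_Integration.integrable_bound)
    show "AE x in lebesgue. norm ((norm (f x + g x))\<^sup>2)
            \<le> norm (2 * (norm (f x))\<^sup>2 + 2 * (norm (g x))\<^sup>2)"
    proof (rule AE_I2)
      fix x
      have "(norm (f x + g x))\<^sup>2 \<le> (norm (f x) + norm (g x))\<^sup>2"
        by (intro power_mono norm_triangle_ineq) auto
      also have "\<dots> \<le> 2 * (norm (f x))\<^sup>2 + 2 * (norm (g x))\<^sup>2"
        using sum_squares_bound[of "norm (f x)" "norm (g x)"] by (simp add: power2_sum)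
      finally show "norm ((norm (f x + g x))\<^sup>2)
            \<le> norm (2 * (norm (f x))\<^sup>2 + 2 * (norm (g x))\<^sup>2)" by simp
    qed
  qed measurable
  then show ?thesis by (simp add: square_integrable_def)
qed

lemma square_integrable_diff:
  assumes "square_integrable f" "square_integrable g"
  shows "square_integrable (\<lambda>x. f x - g x)"
  using square_integrable_add[OF assms(1) square_integrable_mult[OF assms(2), of "-1"]] by simp

lemma square_integrable_inner:
  assumes "square_integrable f" "square_integrable g"
  shows "integrable lebesgue (\<lambda>x. f x \<bullet> g x)"
proof -
  have [measurable]: "f \<in> borel_measurable lebesgue" "g \<in> borel_measurable lebesgue"
    using assms by (auto simp: square_integrable_def)
  have "integrable lebesgue (\<lambda>x. (norm (f x))\<^sup>2 + (norm (g x))\<^sup>2)"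
    using assms by (auto simp: square_integrable_def)
  then show ?thesis
  proof (rule Bochner_Integration.integrable_bound)
    show "AE x in lebesgue. norm (f x \<bullet> g x) \<le> norm ((norm (f x))\<^sup>2 + (norm (g x))\<^sup>2)"
    proof (rule AE_I2)
      fix x
      have "\<bar>f x \<bullet> g x\<bar> \<le> norm (f x) * norm (g x)"
        by (rule Cauchy_Schwarz_ineq2)
      also have "\<dots> \<le> (norm (f x))\<^sup>2 + (norm (g x))\<^sup>2"
      proof -
        have "0 \<le> norm (f x) * norm (g x)" by simp
        then show ?thesis
          using sum_squares_bound[of "norm (f x)" "norm (g x)"] by linarith
      qed
      finally show "norm (f x \<bullet> g x) \<le> norm ((norm (f x))\<^sup>2 + (norm (g x))\<^sup>2)" by simp
    qed
  qed measurable
qed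

quotient_type (overloaded) 'a l2 = "'a::euclidean_space \<Rightarrow> complex" / partial:
  "\<lambda>f g. square_integrable f \<and> square_integrable g \<and> (AE x in lebesgue. f x = g x)"
  by (rule part_equivpI)
     (auto intro!: exI[of _ "\<lambda>x. 0"] sympI transpI elim: eventually_elim2 simp: eq_commute)

instantiation l2 :: (euclidean_space) real_inner
begin

lift_definition zero_l2 :: "'a l2" is "\<lambda>x. 0"
  by simp

lift_definition plus_l2 :: "'a l2 \<Rightarrow> 'a l2 \<Rightarrow> 'a l2" is "\<lambda>f g x. f x + g x"
  by (auto intro: square_integrable_add elim: eventually_elim2)

lift_definition uminus_l2 :: "'a l2 \<Rightarrow> 'a l2" is "\<lambda>f x. - f x"
  by (auto dest: square_integrable_mult[where c = "-1"])

lift_definition minus_l2 :: "'a l2 \<Rightarrow> 'a l2 \<Rightarrow> 'a l2" is "\<lambda>f g x. f x - g x"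
  by (auto intro: square_integrable_diff elim: eventually_elim2)

lift_definition scaleR_l2 :: "real \<Rightarrow> 'a l2 \<Rightarrow> 'a l2" is "\<lambda>c f x. complex_of_real c * f x"
  by (auto intro: square_integrable_mult)

lift_definition inner_l2 :: "'a l2 \<Rightarrow> 'a l2 \<Rightarrow> real" is "\<lambda>f g. \<integral>x. f x \<bullet> g x \<partial>lebesgue"
  \<comment> \<open>the real part of the usual complex inner product\<close>
proof -
  fix f f' g g' :: "'a \<Rightarrow> complex"
  assume a: "square_integrable f \<and> square_integrable f' \<and> (AE x in lebesgue. f x = f' x)"
    and b: "square_integrable g \<and> square_integrable g' \<and> (AE x in lebesgue. g x = g' x)"
  then have "AE x in lebesgue. f x \<bullet> g x = f' x \<bullet> g' x"
    by (auto elim: eventually_elim2)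
  with a b show "(\<integral>x. f x \<bullet> g x \<partial>lebesgue) = (\<integral>x. f' x \<bullet> g' x \<partial>lebesgue)"
    by (intro integral_cong_AE borel_measurable_integrable square_integrable_inner) auto
qed

definition norm_l2 :: "'a l2 \<Rightarrow> real" where
  "norm_l2 u = sqrt (u \<bullet> u)"

definition dist_l2 :: "'a l2 \<Rightarrow> 'a l2 \<Rightarrow> real" where
  "dist_l2 u v = norm (u - v)"

definition sgn_l2 :: "'a l2 \<Rightarrow> 'a l2" where
  "sgn_l2 u = inverse (norm u) *\<^sub>R u"

definition uniformity_l2 :: "('a l2 \<times> 'a l2) filter" where
  "uniformity_l2 = (INF e\<in>{0 <..}. principal {(u, v). dist u v < e})"

definition open_l2 :: "'a l2 set \<Rightarrow> bool" where
  "open_l2 U \<longleftrightarrow> (\<forall>u\<in>U. eventually (\<lambda>(u', v). u' = u \<longrightarrow> v \<in> U) uniformity)"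

instance
proof
  fix u v w :: "'a l2" and a b :: real and U :: "'a l2 set"
  show "u + v + w = u + (v + w)"
    by transfer (auto intro: square_integrable_add simp: add.assoc)
  show "u + v = v + u"
    by transfer (auto intro: square_integrable_add simp: add.commute)
  show "0 + u = u"
    by transfer auto
  show "- u + u = 0"
    by transfer auto
  show "u - v = u + - v"
    by transfer (auto intro: square_integrable_diff)
  show "a *\<^sub>R (u + v) = a *\<^sub>R u + a *\<^sub>R v"
    by transfer (auto intro: square_integrable_add square_integrable_mult simp: distrib_left)
  show "(a + b) *\<^sub>R u = a *\<^sub>R u + b *\<^sub>R u"
    by transfer
      (auto intro: square_integrable_add square_integrable_mult simp flip: of_real_add distrib_right)
  show "a *\<^sub>R b *\<^sub>R u = (a * b) *\<^sub>R u"
    by transfer (auto intro: square_integrable_mult simp: mult.assoc)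
  show "1 *\<^sub>R u = u"
    by transfer auto
  show "dist u v = norm (u - v)"
    by (rule dist_l2_def)
  show "sgn u = inverse (norm u) *\<^sub>R u"
    by (rule sgn_l2_def)
  show "uniformity = (INF e\<in>{0 <..}. principal {(u, v :: 'a l2). dist u v < e})"
    by (rule uniformity_l2_def)
  show "open U \<longleftrightarrow> (\<forall>u\<in>U. eventually (\<lambda>(u', v). u' = u \<longrightarrow> v \<in> U) uniformity)"
    by (rule open_l2_def)
  show "u \<bullet> v = v \<bullet> u"
    by transfer (simp add: inner_commute)
  show "(u + v) \<bullet> w = u \<bullet> w + v \<bullet> w"
    by transfer (simp add: inner_add_left square_integrable_inner)
  show "(a *\<^sub>R u) \<bullet> v = a * (u \<bullet> v)"
    by transfer (simp add: inner_scaleR_left flip: scaleR_conv_of_real)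
  show "0 \<le> u \<bullet> u"
    by transfer simp
  show "u \<bullet> u = 0 \<longleftrightarrow> u = 0"
    by transfer (subst integral_nonneg_eq_0_iff_AE; simp add: square_integrable_inner)
  show "norm u = sqrt (u \<bullet> u)"
    by (rule norm_l2_def)
qed

end

lift_definition scaleC :: "complex \<Rightarrow> 'a::euclidean_space l2 \<Rightarrow> 'a l2" (infixr "*\<^sub>C" 75)
  is "\<lambda>c f x. c * f x"
  by (auto intro: square_integrable_mult)

global_interpretation l2: vector_space "scaleC :: complex \<Rightarrow> 'a::euclidean_space l2 \<Rightarrow> 'a l2"
  defines cspan = l2.span
proof
  fix a b :: complex and u v :: "'a l2"
  show "a *\<^sub>C (u + v) = a *\<^sub>C u + a *\<^sub>C v"
    by transfer (auto intro: square_integrable_add square_integrable_mult simp: distrib_left)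
  show "(a + b) *\<^sub>C u = a *\<^sub>C u + b *\<^sub>C u"
    by transfer
      (auto intro: square_integrable_add square_integrable_mult simp flip: distrib_right)
  show "a *\<^sub>C b *\<^sub>C u = (a * b) *\<^sub>C u"
    by transfer (auto intro: square_integrable_mult simp: mult.assoc)
  show "1 *\<^sub>C u = u"
    by transfer auto
qed

text \<open>Lebesgue measure is complete, so a function representing a class is automatically
  measurable and square integrable.\<close>

definition represents :: "('a::euclidean_space \<Rightarrow> complex) \<Rightarrow> 'a l2 \<Rightarrow> bool" where
  "represents f u \<longleftrightarrow> (AE x in lebesgue. f x = rep_l2 u x)"

definition in_Lp :: "real \<Rightarrow> ('a::euclidean_space \<Rightarrow> real) \<Rightarrow> bool" where
  "in_Lp p f \<longleftrightarrow> f \<in> borel_measurable lebesgue \<and> integrable lebesgue (\<lambda>x. \<bar>f x\<bar> powr p)"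

section \<open>Unbounded operators\<close>

text \<open>Operators are identified with their graphs: \<^term>\<open>(u, w) \<in> T\<close> means that \<^term>\<open>u\<close> is in the
  domain of \<^term>\<open>T\<close> and is mapped to \<^term>\<open>w\<close>. Sums and differences are defined on the
  intersection of the domains.\<close>

type_synonym 'a operator = "('a l2 \<times> 'a l2) set"

definition op_plus :: "'a::euclidean_space operator \<Rightarrow> 'a operator \<Rightarrow> 'a operator" where
  "op_plus S T = {(u, w + w') | u w w'. (u, w) \<in> S \<and> (u, w') \<in> T}"

definition op_minus :: "'a::euclidean_space operator \<Rightarrow> 'a operator \<Rightarrow> 'a operator" where
  "op_minus S T = {(u, w - w') | u w w'. (u, w) \<in> S \<and> (u, w') \<in> T}"

definition mult_op :: "('a::euclidean_space \<Rightarrow> real) \<Rightarrow> 'a operator" where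
  "mult_op V = {(u, w). represents (\<lambda>x. complex_of_real (V x) * rep_l2 u x) w}"

definition compact_op :: "'a::euclidean_space operator \<Rightarrow> bool" where
  "compact_op T \<longleftrightarrow> single_valued T \<and> Domain T = UNIV \<and>
     (\<forall>S. bounded S \<longrightarrow> compact (closure (T `` S)))"

definition eigenspace :: "'a::euclidean_space operator \<Rightarrow> complex \<Rightarrow> 'a l2 set" where
  "eigenspace T z = {u. (u, z *\<^sub>C u) \<in> T}"

definition eigenvalue :: "'a::euclidean_space operator \<Rightarrow> complex \<Rightarrow> bool" where
  "eigenvalue T z \<longleftrightarrow> (\<exists>u\<in>eigenspace T z. u \<noteq> 0)"

definition finite_multiplicity :: "'a::euclidean_space operator \<Rightarrow> complex \<Rightarrow> bool" where
  "finite_multiplicity T z \<longleftrightarrow> (\<exists>B. finite B \<and> eigenspace T z \<subseteq> cspan B)"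

section \<open>The magnetic Schroedinger operator\<close>

definition partial_deriv :: "'n \<Rightarrow> (real^'n::finite \<Rightarrow> complex) \<Rightarrow> real^'n \<Rightarrow> complex" where
  "partial_deriv j f x = vector_derivative (\<lambda>t. f (x + t *\<^sub>R axis j 1)) (at 0)"

primrec C_k :: "nat \<Rightarrow> (real^'n::finite \<Rightarrow> complex) \<Rightarrow> bool" where
  "C_k 0 f \<longleftrightarrow> continuous_on UNIV f"
| "C_k (Suc k) f \<longleftrightarrow> continuous_on UNIV f \<and>
     (\<forall>j. (\<forall>x. (\<lambda>t. f (x + t *\<^sub>R axis j 1)) differentiable (at (0::real)))
          \<and> C_k k (partial_deriv j f))"

definition test_function :: "(real^'n::finite \<Rightarrow> complex) \<Rightarrow> bool" where
  "test_function \<phi> \<longleftrightarrow> (\<forall>k. C_k k \<phi>) \<and> compact (closure {x. \<phi> x \<noteq> 0})"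

definition magnetic_deriv ::
  "(real^'n \<Rightarrow> real^'n) \<Rightarrow> 'n \<Rightarrow> (real^'n::finite \<Rightarrow> complex) \<Rightarrow> real^'n \<Rightarrow> complex" where
  "magnetic_deriv A j f x = - \<i> * partial_deriv j f x - complex_of_real (A x $ j) * f x"

definition magnetic_laplacian ::
  "(real^'n \<Rightarrow> real^'n) \<Rightarrow> (real^'n::finite \<Rightarrow> complex) \<Rightarrow> real^'n \<Rightarrow> complex" where
  "magnetic_laplacian A f x = (\<Sum>j\<in>UNIV. magnetic_deriv A j (magnetic_deriv A j f) x)"

text \<open>On the axis $r = 0$, a null set, \<^term>\<open>ln 0 = (0::real)\<close> makes the potential vanish.\<close>

definition A_log :: "real^3 \<Rightarrow> real^3" where
  "A_log x = vector [0, 0, ln (sqrt ((x $ 1)\<^sup>2 + (x $ 2)\<^sup>2))]"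

text \<open>The operator on test functions is essentially self-adjoint; its self-adjoint extension is
  the closure of its graph in the product topology.\<close>

definition H_A :: "(real^3) operator" where
  "H_A = closure {(u, w). \<exists>\<phi>. test_function \<phi> \<and> represents \<phi> u
                                  \<and> represents (magnetic_laplacian A_log \<phi>) w}"

definition japanese_bracket :: "'a::real_normed_vector \<Rightarrow> real" where
  "japanese_bracket x = sqrt (1 + (norm x)\<^sup>2)"

end

theory Submission
  imports Defs
begin

text \<open>
  Negative eigenvalues of \<open>H - V\<close> are controlled by the quadratic form
  \<open>q(u) = \<integral> |\<partial>\<^sub>1u|\<^sup>2 + |\<partial>\<^sub>2u|\<^sup>2 + |(\<partial>\<^sub>3 - \<i> log r)u|\<^sup>2\<close> of \<open>H\<close>: if the form of \<open>V\<close> is at most \<open>q/2\<close> on the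
  orthogonal complement of a finite set, then eigenvectors for distinct negative eigenvalues,
  being orthogonal, cannot outnumber that set. Write \<open>\<langle>r\<rangle> = (1 + r\<^sup>2)\<^sup>1\<^sup>/\<^sup>2\<close>. The commutator of the radial
  derivative with \<open>\<partial>\<^sub>3 - \<i> log r\<close> is \<open>-\<i>/r\<close>, which yields the Hardy inequality
  \<open>\<integral> |u|\<^sup>2/\<langle>r\<rangle> \<le> 6 q(u)\<close>. Together with \<open>\<partial>\<^sub>3|u|\<^sup>2 = 2 Re (u\<^sup>* (\<partial>\<^sub>3 - \<i> log r)u)\<close> it bounds the form of
  \<open>\<langle>r\<rangle>\<^sup>-\<^sup>\<alpha> v(z)\<close> by a multiple of \<open>(\<parallel>v\<parallel>\<^sub>1 + \<epsilon>) q(u)\<close> whenever \<open>v\<close> differs from an integrable function by at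
  most \<open>\<epsilon>\<close>. Since \<open>v\<close> is in \<open>L\<^sup>p\<close>, it is at most \<open>\<epsilon>\<close> plus a function of small \<open>L\<^sup>1\<close> norm plus
  a multiple of the indicator of an interval; for the last part the Hardy inequality and
  \<open>\<alpha> > 1\<close> dispose of large \<open>r\<close>, a divergence identity disposes of small \<open>r\<close>, and on the remaining
  bounded region a Poincare inequality on a fine grid of cubes leaves only finitely many linear
  functionals of \<open>u\<close>.
\<close>

section \<open>Symmetric relations nonnegative on a finite-codimensional subspace\<close>

text \<open>The Hardy weight comes from pairing the commutator with the field F = (x,y)/<r>: F is
  bounded, its divergence is at most 2/<r>, and F applied to log r is exactly 1/<r>. Since log r is
  singular on the axis, the identity is first used with ln(r^2 + \<epsilon>)/2 and \<epsilon> is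
  sent to 0 by dominated convergence. The second obstacle is that the energy controls the magnetic
  gradient, whereas a Poincare inequality needs the plain one; the two differ by the unbounded term
  log r u. The factor r^2/(1 + r^2)^2 repairs this: its product with log r has square at most 1/<r>,
  and it is bounded below where \<delta> < r and <r> < \<rho>. All estimates are made for test
  functions. Only the final inequality is carried to the domain of the closure: Fatou handles the
  potential, which is not continuous in L2, while the finitely many functionals are inner products
  with fixed L2 functions and so pass to the limit. The inner product is the real part of the
  complex one, so each complex functional counts as two real ones. The factor 1/2 in front of q is
  assembled from four contributions of 1/8, which fixes all parameters.\<close>

lemma card_le_of_orthogonal_complement_trivial:
  fixes B :: "'a::real_inner set"
  assumes "finite B" "subspace E" "\<And>u. u \<in> E \<Longrightarrow> (\<forall>b\<in>B. u \<bullet> b = 0) \<Longrightarrow> u = 0"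
    and "independent S" "S \<subseteq> E"
  shows "finite S \<and> card S \<le> card B"
proof -
  define f where "f u = (\<Sum>b\<in>B. (u \<bullet> b) *\<^sub>R b)" for u :: 'a
  have lin: "linear f"
    unfolding f_def by (intro linearI)
      (simp_all add: inner_add_left scaleR_add_left sum.distrib scaleR_sum_right)
  have inj: "inj_on f E"
  proof (rule inj_onI)
    fix x y assume xy: "x \<in> E" "y \<in> E" "f x = f y"
    have "0 = (x - y) \<bullet> f (x - y)"
      using xy lin by (simp add: linear_diff)
    also have "\<dots> = (\<Sum>b\<in>B. ((x - y) \<bullet> b)\<^sup>2)"
      by (simp add: f_def inner_sum_right power2_eq_square)
    finally have "\<forall>b\<in>B. (x - y) \<bullet> b = 0"
      using assms(1) by (simp add: sum_nonneg_eq_0_iff)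
    then show "x = y"
      using assms(3)[of "x - y"] xy assms(2) by (simp add: subspace_diff)
  qed
  have "span S \<subseteq> E"
    using assms(2,5) by (rule span_minimal[rotated])
  then have "independent (f ` S)"
    using linear_independent_injective_image[OF lin assms(4)] inj inj_on_subset by blast
  moreover have "f ` S \<subseteq> span B"
    unfolding f_def by (intro image_subsetI span_sum span_scale span_base)
  ultimately have "finite (f ` S) \<and> card (f ` S) \<le> card B"
    using assms(1) independent_span_bound by blast
  moreover have "inj_on f S"
    using inj assms(5) inj_on_subset by blast
  ultimately show ?thesis
    by (simp add: finite_image_iff card_image)
qed

lemma scaleC_of_real [simp]: "complex_of_real c *\<^sub>C u = c *\<^sub>R u"
  by transfer (auto intro: square_integrable_mult)

text \<open>Dimensions are counted over the reals, whereas \<open>finite_multiplicity\<close> speaks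
  of complex spans.\<close>

lemma span_subset_cspan: "span B \<subseteq> cspan B"
proof (rule span_minimal)
  show "subspace (cspan B)"
  proof (rule subspaceI)
    fix c x assume "x \<in> cspan B"
    then show "c *\<^sub>R x \<in> cspan B"
      using l2.span_scale[of x B "complex_of_real c"] by simp
  qed (auto simp: l2.span_zero l2.span_add)
qed (auto simp: l2.span_base)

text \<open>On the span of eigenvectors with negative eigenvalues \<open>w \<bullet> u\<close> is
  negative unless \<open>u = 0\<close>, so this span meets the orthogonal complement of
  \<open>B\<close> only in zero. Comparison with \<open>card B\<close> then bounds the number of
  eigenvalues, and likewise the dimension of each eigenspace.\<close>

lemma finite_negative_spectrum:
  fixes T :: "'a::euclidean_space operator"
  assumes T: "subspace T"
    and sym: "\<And>u w u' w'. (u, w) \<in> T \<Longrightarrow> (u', w') \<in> T \<Longrightarrow> w \<bullet> u' = u \<bullet> w'"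
    and B: "finite B"
    and pos: "\<And>u w. (u, w) \<in> T \<Longrightarrow> (\<forall>b\<in>B. u \<bullet> b = 0) \<Longrightarrow> 0 \<le> w \<bullet> u"
  shows "finite {\<mu>::real. \<mu> < 0 \<and> eigenvalue T (complex_of_real \<mu>)} \<and>
    (\<forall>\<mu><0. finite_multiplicity T (complex_of_real \<mu>))"
proof (intro conjI allI impI)
  let ?N = "{\<mu>::real. \<mu> < 0 \<and> eigenvalue T (complex_of_real \<mu>)}"
  have "\<exists>e. \<mu> \<in> ?N \<longrightarrow> (e, \<mu> *\<^sub>R e) \<in> T \<and> e \<noteq> 0" for \<mu>
    by (auto simp: eigenvalue_def eigenspace_def)
  then obtain e where e: "\<And>\<mu>. \<mu> \<in> ?N \<Longrightarrow> (e \<mu>, \<mu> *\<^sub>R e \<mu>) \<in> T" "\<And>\<mu>. \<mu> \<in> ?N \<Longrightarrow> e \<mu> \<noteq> 0"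
    by metis
  have orth: "e \<mu> \<bullet> e \<nu> = 0" if "\<mu> \<in> ?N" "\<nu> \<in> ?N" "\<mu> \<noteq> \<nu>" for \<mu> \<nu>
    using sym[OF e(1)[OF that(1)] e(1)[OF that(2)]] that(3) by simp
  have inj: "inj_on e ?N"
  proof (rule inj_onI, rule ccontr)
    fix \<mu> \<nu> assume "\<mu> \<in> ?N" "\<nu> \<in> ?N" "e \<mu> = e \<nu>" "\<mu> \<noteq> \<nu>"
    then show False
      using orth[of \<mu> \<nu>] e(2)[of \<mu>] by simp
  qed
  have bound: "card M \<le> card B" if M: "finite M" "M \<subseteq> ?N" for M
  proof -
    have "independent (e ` M)"
    proof (rule pairwise_orthogonal_independent)
      show "pairwise orthogonal (e ` M)"
        unfolding pairwise_def orthogonal_def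
      proof clarify
        fix \<mu> \<nu> assume "\<mu> \<in> M" "\<nu> \<in> M" "e \<mu> \<noteq> e \<nu>"
        then show "e \<mu> \<bullet> e \<nu> = 0"
          using M(2) by (intro orth) auto
      qed
      show "0 \<notin> e ` M"
        using e(2) M(2) by (metis (no_types, lifting) imageE subsetD)
    qed
    moreover have "u = 0" if u: "u \<in> span (e ` M)" "\<forall>b\<in>B. u \<bullet> b = 0" for u
    proof -
      obtain k where k: "u = (\<Sum>v\<in>e ` M. k v *\<^sub>R v)"
        using u(1) M(1) by (auto simp: span_finite)
      define c where "c \<mu> = k (e \<mu>)" for \<mu>
      have inj': "inj_on e M"
        using inj M(2) inj_on_subset by blast
      have u_eq: "u = (\<Sum>\<mu>\<in>M. c \<mu> *\<^sub>R e \<mu>)"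
        unfolding k c_def by (subst sum.reindex[OF inj']) simp
      \<comment> \<open>The value of \<open>T\<close> at \<open>u\<close>: the graph is a subspace,
        so it contains the combination of the points
        \<open>(e \<mu>, \<mu> *\<^sub>R e \<mu>)\<close>. Orthogonality then makes
        \<open>w \<bullet> u\<close> a diagonal sum with nonpositive terms.\<close>
      define w where "w = (\<Sum>\<mu>\<in>M. (c \<mu> * \<mu>) *\<^sub>R e \<mu>)"
      have "(\<Sum>\<mu>\<in>M. c \<mu> *\<^sub>R (e \<mu>, \<mu> *\<^sub>R e \<mu>)) \<in> T"
        using T M(2) e(1) by (intro subspace_sum subspace_scale) auto
      moreover have "(\<Sum>\<mu>\<in>M. c \<mu> *\<^sub>R (e \<mu>, \<mu> *\<^sub>R e \<mu>)) = (u, w)"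
        by (simp add: u_eq w_def prod_eq_iff fst_sum snd_sum)
      ultimately have "0 \<le> w \<bullet> u"
        using pos u(2) by auto
      also have "w \<bullet> u = (\<Sum>\<mu>\<in>M. \<mu> * (c \<mu>)\<^sup>2 * (e \<mu> \<bullet> e \<mu>))"
      proof -
        have "w \<bullet> u = (\<Sum>\<mu>\<in>M. \<Sum>\<nu>\<in>M. (c \<mu> * \<mu>) * (c \<nu> * (e \<mu> \<bullet> e \<nu>)))"
          unfolding w_def inner_sum_left
          by (intro sum.cong refl) (simp add: u_eq inner_sum_right sum_distrib_left mult_ac)
        also have "\<dots> = (\<Sum>\<mu>\<in>M. \<Sum>\<nu>\<in>M. if \<nu> = \<mu> then \<mu> * (c \<mu>)\<^sup>2 * (e \<mu> \<bullet> e \<mu>) else 0)"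
          using orth M(2) by (intro sum.cong refl) (auto simp: power2_eq_square subset_iff)
        finally show ?thesis using M(1) by simp
      qed
      finally have "(\<Sum>\<mu>\<in>M. - (\<mu> * (c \<mu>)\<^sup>2 * (e \<mu> \<bullet> e \<mu>))) \<le> 0"
        by (simp add: sum_negf)
      moreover have nonneg: "0 \<le> - (\<mu> * (c \<mu>)\<^sup>2 * (e \<mu> \<bullet> e \<mu>))" if "\<mu> \<in> M" for \<mu>
        using that M(2) by (auto simp: mult_nonpos_nonneg subset_iff intro!: mult_nonpos_nonneg)
      ultimately have "(\<Sum>\<mu>\<in>M. - (\<mu> * (c \<mu>)\<^sup>2 * (e \<mu> \<bullet> e \<mu>))) = 0"
        by (intro antisym sum_nonneg)
      then have "\<forall>\<mu>\<in>M. - (\<mu> * (c \<mu>)\<^sup>2 * (e \<mu> \<bullet> e \<mu>)) = 0"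
        using nonneg M(1) by (subst (asm) sum_nonneg_eq_0_iff) auto
      then have "\<forall>\<mu>\<in>M. c \<mu> = 0"
        using M(2) e(2) by (fastforce simp: subset_iff)
      then show "u = 0"
        by (simp add: u_eq)
    qed
    ultimately have "card (e ` M) \<le> card B"
      using card_le_of_orthogonal_complement_trivial[OF B subspace_span, of "e ` M" "e ` M"]
      by (simp add: span_superset)
    then show ?thesis
      using inj M(2) by (simp add: card_image inj_on_subset)
  qed
  show "finite ?N"
  proof (rule ccontr)
    assume "infinite ?N"
    then obtain M where "M \<subseteq> ?N" "finite M" "card M = Suc (card B)"
      using infinite_arbitrarily_large by blast
    then show False
      using bound[of M] by simp
  qed
next
  fix \<mu> :: real assume \<mu>: "\<mu> < 0"
  let ?E = "eigenspace T (complex_of_real \<mu>)"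
  have E: "subspace ?E"
  proof (rule subspaceI)
    show "0 \<in> ?E"
      using subspace_0[OF T] by (simp add: eigenspace_def zero_prod_def)
  next
    fix x y assume "x \<in> ?E" "y \<in> ?E"
    then show "x + y \<in> ?E"
      using subspace_add[OF T, of "(x, \<mu> *\<^sub>R x)" "(y, \<mu> *\<^sub>R y)"]
      by (simp add: eigenspace_def scaleR_add_right)
  next
    fix c x assume "x \<in> ?E"
    then show "c *\<^sub>R x \<in> ?E"
      using subspace_scale[OF T, of "(x, \<mu> *\<^sub>R x)" c]
      by (simp add: eigenspace_def mult.commute)
  qed
  have trivial: "u = 0" if "u \<in> ?E" "\<forall>b\<in>B. u \<bullet> b = 0" for u
  proof -
    have "0 \<le> \<mu> * (u \<bullet> u)"
      using pos[of u "\<mu> *\<^sub>R u"] that by (simp add: eigenspace_def)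
    then show ?thesis
      using \<mu> inner_ge_zero[of u] by (simp add: zero_le_mult_iff del: inner_ge_zero)
  qed
  obtain C where C: "C \<subseteq> ?E" "independent C" "?E \<subseteq> span C"
    using maximal_independent_subset by blast
  have "finite C"
    using card_le_of_orthogonal_complement_trivial[OF B E trivial C(2,1)] by simp
  then show "finite_multiplicity T (complex_of_real \<mu>)"
    unfolding finite_multiplicity_def using C(3) span_subset_cspan by blast
qed

section \<open>Partial derivatives\<close>

text \<open>A relation instead of the function \<open>partial_deriv\<close>, so that product and
  chain rules carry differentiability and the value of the derivative together. Only increments
  along one axis enter, as in \<open>C_k\<close>.\<close>

definition has_partial :: "(real^'n::finite \<Rightarrow> 'b::real_normed_vector) \<Rightarrow> (real^'n \<Rightarrow> 'b) \<Rightarrow> 'n \<Rightarrow> bool" where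
  "has_partial f f' j \<longleftrightarrow>
     (\<forall>x. ((\<lambda>t. f (x + t *\<^sub>R axis j 1)) has_vector_derivative f' x) (at 0))"

lemma has_partialD:
  assumes "has_partial f f' j"
  shows "((\<lambda>t. f (x + t *\<^sub>R axis j 1)) has_vector_derivative f' (x + t *\<^sub>R axis j 1)) (at t)"
proof -
  have "((\<lambda>s. f ((x + t *\<^sub>R axis j 1) + s *\<^sub>R axis j 1)) \<circ> (\<lambda>s. s - t) has_vector_derivative
      1 *\<^sub>R f' (x + t *\<^sub>R axis j 1)) (at t)"
  proof (rule vector_diff_chain_at)
    show "((\<lambda>s. s - t) has_vector_derivative 1) (at t)"
      by (auto intro!: derivative_eq_intros)
    show "((\<lambda>s. f ((x + t *\<^sub>R axis j 1) + s *\<^sub>R axis j 1)) has_vector_derivative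
        f' (x + t *\<^sub>R axis j 1)) (at (t - t))"
      using assms by (simp add: has_partial_def)
  qed
  then show ?thesis
    by (simp add: o_def algebra_simps)
qed

lemma has_partial_imp_partial_deriv:
  "has_partial f f' j \<Longrightarrow> partial_deriv j f = f'"
  unfolding has_partial_def partial_deriv_def fun_eq_iff by (metis vector_derivative_at)

lemma has_partial_const: "has_partial (\<lambda>x. c) (\<lambda>x. 0) j"
  by (simp add: has_partial_def)

lemma has_partial_bilinear:
  assumes "bounded_bilinear p" "has_partial f f' j" "has_partial g g' j"
  shows "has_partial (\<lambda>x. p (f x) (g x)) (\<lambda>x. p (f x) (g' x) + p (f' x) (g x)) j"
  using assms bounded_bilinear.has_vector_derivative[OF assms(1)]
  unfolding has_partial_def by fastforce

lemmas has_partial_mult = has_partial_bilinear[OF bounded_bilinear_mult]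
lemmas has_partial_inner = has_partial_bilinear[OF bounded_bilinear_inner]
lemmas has_partial_scaleR = has_partial_bilinear[OF bounded_bilinear_scaleR]

lemma has_partial_linear:
  assumes "bounded_linear p" "has_partial f f' j"
  shows "has_partial (\<lambda>x. p (f x)) (\<lambda>x. p (f' x)) j"
  using assms bounded_linear.has_vector_derivative unfolding has_partial_def by blast

lemma has_partial_add:
  "has_partial f f' j \<Longrightarrow> has_partial g g' j \<Longrightarrow> has_partial (\<lambda>x. f x + g x) (\<lambda>x. f' x + g' x) j"
  unfolding has_partial_def by (auto intro!: derivative_intros)

lemma has_partial_diff:
  "has_partial f f' j \<Longrightarrow> has_partial g g' j \<Longrightarrow> has_partial (\<lambda>x. f x - g x) (\<lambda>x. f' x - g' x) j"
  unfolding has_partial_def by (auto intro!: derivative_intros)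

text \<open>Lets a weight such as log r, which is singular in the other variables, be differentiated
  along the axis on which it is constant.\<close>

lemma has_partial_invariant:
  assumes "\<And>x t. w (x + t *\<^sub>R axis j 1) = w x"
  shows "has_partial w (\<lambda>x. 0) j"
  using assms by (simp add: has_partial_def)

text \<open>Linearization at 0 costs \<open>2 * B\<close>, since \<open>g' t\<close> and
  \<open>g' 0\<close> both lie within \<open>B\<close> of \<open>d\<close>; replacing
  \<open>g' 0\<close> by \<open>d\<close> costs one more \<open>B\<close>.\<close>

lemma mean_value_increment:
  fixes g :: "real \<Rightarrow> 'b::real_normed_vector"
  assumes "0 \<le> h" "\<And>t. t \<in> {0..h} \<Longrightarrow> (g has_vector_derivative g' t) (at t)"
    and "\<And>t. t \<in> {0..h} \<Longrightarrow> norm (g' t - d) \<le> B"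
  shows "norm (g h - g 0 - h *\<^sub>R d) \<le> 3 * h * B"
proof -
  have "norm (g h - g 0 - (h - 0) *\<^sub>R g' 0) \<le> norm (h - 0) * (2 * B)"
  proof (rule vector_differentiable_bound_linearization[where S = "{0..h}"])
    fix t assume "t \<in> {0..h}"
    then show "norm (g' t - g' 0) \<le> 2 * B"
      using assms(1) assms(3)[of t] assms(3)[of 0] norm_triangle_ineq4[of "g' t - d" "g' 0 - d"] by simp
  qed (use assms in \<open>auto intro: has_vector_derivative_at_within simp: closed_segment_eq_real_ivl\<close>)
  moreover have "norm (h *\<^sub>R (g' 0 - d)) \<le> h * B"
    using assms(1) assms(3)[of 0] by (simp add: mult_left_mono)
  moreover have "g h - g 0 - h *\<^sub>R d = (g h - g 0 - (h - 0) *\<^sub>R g' 0) + h *\<^sub>R (g' 0 - d)"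
    by (simp add: algebra_simps)
  ultimately show ?thesis
    using norm_triangle_ineq[of "g h - g 0 - (h - 0) *\<^sub>R g' 0" "h *\<^sub>R (g' 0 - d)"] assms(1)
    by (simp add: algebra_simps)
qed

text \<open>The mean value estimate is applied twice: to \<open>fi\<close> along axis
  \<open>j\<close>, and then along axis \<open>i\<close> to the difference of \<open>f\<close>
  between two parallel lines.\<close>

lemma second_difference_bound:
  fixes f :: "real^'n::finite \<Rightarrow> 'b::real_normed_vector"
  assumes fi: "has_partial f fi i" and fij: "has_partial fi fij j"
    and "continuous_on UNIV fij" "0 < e"
  shows "\<exists>\<delta>>0. \<forall>h. 0 < h \<and> h < \<delta> \<longrightarrow>
    norm (f (x + h *\<^sub>R axis i 1 + h *\<^sub>R axis j 1) - f (x + h *\<^sub>R axis i 1)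
      - f (x + h *\<^sub>R axis j 1) + f x - h\<^sup>2 *\<^sub>R fij x) \<le> h\<^sup>2 * e"
proof -
  have "isCont fij x"
    using assms(3) by (simp add: continuous_on_eq_continuous_at)
  \<comment> \<open>Each of the two mean value estimates loses a factor 3, hence
    \<open>e / 9\<close>. The points involved move by at most \<open>2 * h\<close>, hence the choice
    \<open>d / 2\<close> below.\<close>
  then obtain d where d: "d > 0" "\<And>y. norm (y - x) < d \<Longrightarrow> norm (fij y - fij x) < e / 9"
    using assms(4) unfolding continuous_at_eps_delta dist_norm
    by (metis divide_pos_pos zero_less_numeral)
  show ?thesis
  proof (intro exI[of _ "d / 2"] conjI allI impI)
    fix h assume h: "0 < h \<and> h < d / 2"
    have near: "norm (fij (x + s *\<^sub>R axis i 1 + t *\<^sub>R axis j 1) - fij x) \<le> e / 9"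
      if "s \<in> {0..h}" "t \<in> {0..h}" for s t
    proof -
      have "norm (s *\<^sub>R axis i (1::real) + t *\<^sub>R axis j 1) \<le> s + t"
        using that norm_triangle_ineq[of "s *\<^sub>R axis i (1::real)" "t *\<^sub>R axis j (1::real)"]
        by simp
      then show ?thesis
        using d(2)[of "x + s *\<^sub>R axis i 1 + t *\<^sub>R axis j 1"] that h by (simp add: add.assoc)
    qed
    define g where "g s = f (x + h *\<^sub>R axis j 1 + s *\<^sub>R axis i 1) - f (x + s *\<^sub>R axis i 1)" for s
    define g' where "g' s = fi (x + h *\<^sub>R axis j 1 + s *\<^sub>R axis i 1) - fi (x + s *\<^sub>R axis i 1)" for s
    have g: "(g has_vector_derivative g' s) (at s)" for s
      unfolding g_def g'_def by (intro has_vector_derivative_diff has_partialD[OF fi])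
    have "norm (g' s - h *\<^sub>R fij x) \<le> 3 * h * (e / 9)" if s: "s \<in> {0..h}" for s
    proof -
      have "norm (fi (x + s *\<^sub>R axis i 1 + h *\<^sub>R axis j 1) - fi (x + s *\<^sub>R axis i 1 + 0 *\<^sub>R axis j 1)
          - h *\<^sub>R fij x) \<le> 3 * h * (e / 9)"
        by (rule mean_value_increment[OF _ has_partialD[OF fij]]) (use h near[OF s] in auto)
      then show ?thesis by (simp add: g'_def algebra_simps)
    qed
    then have "norm (g h - g 0 - h *\<^sub>R (h *\<^sub>R fij x)) \<le> 3 * h * (3 * h * (e / 9))"
      using h g by (intro mean_value_increment) auto
    then show "norm (f (x + h *\<^sub>R axis i 1 + h *\<^sub>R axis j 1) - f (x + h *\<^sub>R axis i 1)
      - f (x + h *\<^sub>R axis j 1) + f x - h\<^sup>2 *\<^sub>R fij x) \<le> h\<^sup>2 * e"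
      by (simp add: g_def algebra_simps power2_eq_square)
  qed (use d in auto)
qed

text \<open>Schwarz's theorem: the second difference is symmetric in \<open>i\<close> and
  \<open>j\<close>, and divided by the square of \<open>h\<close> it tends to both mixed
  derivatives.\<close>

lemma partial_derivs_commute:
  fixes f :: "real^'n::finite \<Rightarrow> 'b::real_normed_vector"
  assumes "has_partial f fi i" "has_partial f fj j" "has_partial fi fij j" "has_partial fj fji i"
    and "continuous_on UNIV fij" "continuous_on UNIV fji"
  shows "fij = fji"
proof
  fix x
  \<comment> \<open>The leading 0 gives the bound the shape that \<open>field_le_epsilon\<close>
    expects, with \<open>2 * e\<close> as its epsilon.\<close>
  have "norm (fij x - fji x) \<le> 0 + 2 * e" if e: "0 < e" for e
  proof -
    define D where "D h = f (x + h *\<^sub>R axis i 1 + h *\<^sub>R axis j 1) - f (x + h *\<^sub>R axis i 1)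
      - f (x + h *\<^sub>R axis j 1) + f x" for h
    obtain d where d: "d > 0" "\<And>h. 0 < h \<Longrightarrow> h < d \<Longrightarrow> norm (D h - h\<^sup>2 *\<^sub>R fij x) \<le> h\<^sup>2 * e"
      using second_difference_bound[OF assms(1,3,5) e, of x] unfolding D_def by blast
    obtain d' where d': "d' > 0" "\<And>h. 0 < h \<Longrightarrow> h < d' \<Longrightarrow> norm (D h - h\<^sup>2 *\<^sub>R fji x) \<le> h\<^sup>2 * e"
      using second_difference_bound[OF assms(2,4,6) e, of x] unfolding D_def
      by (auto simp: algebra_simps)
    define h where "h = min d d' / 2"
    have h: "0 < h" "h < d" "h < d'"
      using d d' by (auto simp: h_def)
    have "norm (h\<^sup>2 *\<^sub>R (fij x - fji x)) = norm ((D h - h\<^sup>2 *\<^sub>R fji x) - (D h - h\<^sup>2 *\<^sub>R fij x))"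
      by (simp add: algebra_simps)
    also have "\<dots> \<le> h\<^sup>2 * e + h\<^sup>2 * e"
      using norm_triangle_ineq4 d(2)[OF h(1,2)] d'(2)[OF h(1,3)] by (meson add_mono order_trans)
    finally have "h\<^sup>2 * norm (fij x - fji x) \<le> h\<^sup>2 * (2 * e)"
      by (simp add: mult.commute)
    then show ?thesis
      using h by (simp add: mult_le_cancel_left)
  qed
  then have "norm (fij x - fji x) \<le> 0"
    by (metis (no_types) add_0 field_le_epsilon field_sum_of_halves mult_2 half_gt_zero)
  then show "fij x = fji x" by simp
qed

section \<open>Test functions\<close>

text \<open>One explicit radius serves a function, its derivatives and its products, and is easier
  to propagate than compactness of the closed support.\<close>

definition supported_in :: "real \<Rightarrow> ('a::real_normed_vector \<Rightarrow> 'b::zero) \<Rightarrow> bool" where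
  "supported_in R f \<longleftrightarrow> (\<forall>x. R < norm x \<longrightarrow> f x = 0)"

lemma supported_in_partial:
  assumes "has_partial f f' j" "supported_in R f"
  shows "supported_in R f'"
  unfolding supported_in_def
proof (intro allI impI)
  fix x :: "real^'a" assume x: "R < norm x"
  have "((\<lambda>t. 0) has_vector_derivative f' x) (at 0)"
  proof (rule has_vector_derivative_transform_within_open)
    show "((\<lambda>t. f (x + t *\<^sub>R axis j 1)) has_vector_derivative f' x) (at 0)"
      using assms(1) by (simp add: has_partial_def)
    show "open {t. R < norm (x + t *\<^sub>R axis j 1)}"
      by (intro open_Collect_less continuous_intros)
  qed (use x assms(2) in \<open>auto simp: supported_in_def\<close>)
  then show "f' x = 0"
    using vector_derivative_unique_at has_vector_derivative_const by blast
qed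

lemma test_function_continuous: "test_function \<phi> \<Longrightarrow> continuous_on UNIV \<phi>"
  unfolding test_function_def by (metis C_k.simps(1))

lemma test_function_has_partial:
  assumes "test_function \<phi>"
  shows "has_partial \<phi> (partial_deriv j \<phi>) j"
proof -
  have "C_k (Suc 0) \<phi>"
    using assms by (simp only: test_function_def)
  then show ?thesis
    by (simp add: has_partial_def partial_deriv_def vector_derivative_works[symmetric])
qed

lemma test_function_supported:
  assumes "test_function \<phi>"
  obtains R where "0 < R" "supported_in R \<phi>"
proof -
  have "bounded {x. \<phi> x \<noteq> 0}"
    using assms compact_imp_bounded bounded_subset closure_subset by (metis test_function_def)
  then obtain R where "R > 0" "\<forall>x\<in>{x. \<phi> x \<noteq> 0}. norm x \<le> R"
    using bounded_pos by blast
  then show ?thesis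
    using that by (fastforce simp: supported_in_def)
qed

lemma test_function_partial_deriv:
  assumes "test_function \<phi>"
  shows "test_function (partial_deriv j \<phi>)"
proof -
  have "C_k k (partial_deriv j \<phi>)" for k
  proof -
    have "C_k (Suc k) \<phi>"
      using assms by (simp only: test_function_def)
    then show ?thesis by simp
  qed
  moreover have "compact (closure {x. partial_deriv j \<phi> x \<noteq> 0})"
  proof -
    obtain R where "supported_in R \<phi>"
      using assms by (rule test_function_supported)
    then have "supported_in R (partial_deriv j \<phi>)"
      using supported_in_partial test_function_has_partial[OF assms] by blast
    then have "{x. partial_deriv j \<phi> x \<noteq> 0} \<subseteq> cball 0 R"
      by (auto simp: supported_in_def not_less[symmetric])
    then show ?thesis
      using bounded_subset[OF bounded_cball] by (simp add: compact_closure)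
  qed
  ultimately show ?thesis by (simp add: test_function_def)
qed

lemma test_function_partials_commute:
  assumes "test_function \<phi>"
  shows "partial_deriv i (partial_deriv j \<phi>) = partial_deriv j (partial_deriv i \<phi>)"
  using assms
  by (intro partial_derivs_commute[of \<phi> "partial_deriv j \<phi>" j "partial_deriv i \<phi>" i]
      test_function_has_partial test_function_continuous test_function_partial_deriv)

section \<open>Integration by parts\<close>

lemma nn_integral_lborel_shift:
  fixes c :: "'a::euclidean_space"
  assumes [measurable]: "f \<in> borel_measurable borel"
  shows "(\<integral>\<^sup>+x. f (x + c) \<partial>lborel) = (\<integral>\<^sup>+x. f x \<partial>lborel)"
proof -
  have "(\<integral>\<^sup>+x. f x \<partial>distr lborel borel ((+) c)) = (\<integral>\<^sup>+x. f (c + x) \<partial>lborel)"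
    by (rule nn_integral_distr) simp_all
  then show ?thesis
    by (simp add: lborel_distr_plus add.commute)
qed

lemma integral_lborel_shift:
  fixes c :: "'a::euclidean_space" and f :: "'a \<Rightarrow> 'b::{banach, second_countable_topology}"
  assumes [measurable]: "f \<in> borel_measurable borel"
  shows "(\<integral>x. f (x + c) \<partial>lborel) = (\<integral>x. f x \<partial>lborel)"
proof -
  have "(\<integral>x. f x \<partial>distr lborel borel ((+) c)) = (\<integral>x. f (c + x) \<partial>lborel)"
    by (rule integral_distr) simp_all
  then show ?thesis
    by (simp add: lborel_distr_plus add.commute)
qed

lemma integrable_lborel_shift:
  fixes c :: "'a::euclidean_space" and f :: "'a \<Rightarrow> 'b::{banach, second_countable_topology}"
  assumes "integrable lborel f"
  shows "integrable lborel (\<lambda>x. f (x + c))"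
proof -
  have "integrable (distr lborel borel ((+) c)) f"
    using assms by (simp add: lborel_distr_plus)
  then show ?thesis
    by (subst (asm) integrable_distr_eq) (use assms in \<open>auto simp: add.commute\<close>)
qed

lemma continuous_supported_bounded:
  fixes f :: "'a::euclidean_space \<Rightarrow> 'b::real_normed_vector"
  assumes "continuous_on UNIV f" "supported_in R f"
  obtains C where "0 < C" "\<And>x. norm (f x) \<le> C"
proof -
  have "bounded (f ` cball 0 R)"
    using assms(1) by (intro compact_imp_bounded compact_continuous_image)
      (auto intro: continuous_on_subset)
  then obtain C where C: "C > 0" "\<forall>y\<in>f ` cball 0 R. norm y \<le> C"
    using bounded_pos by blast
  have "norm (f x) \<le> C" for x
    using C assms(2) by (cases "norm x \<le> R") (auto simp: supported_in_def not_le)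
  with C(1) show ?thesis using that by blast
qed

text \<open>The class of weights that contains log r and its square, both unbounded near the axis;
  multiplied by a continuous function vanishing outside a ball they become integrable.\<close>

definition locally_integrable :: "('a::euclidean_space \<Rightarrow> real) \<Rightarrow> bool" where
  "locally_integrable w \<longleftrightarrow> w \<in> borel_measurable borel \<and>
     (\<forall>R. integrable lborel (\<lambda>x. indicator (cball 0 R) x * w x))"

lemma locally_integrableI_continuous:
  assumes "continuous_on UNIV w"
  shows "locally_integrable w"
  unfolding locally_integrable_def
proof (intro conjI allI)
  show [measurable]: "w \<in> borel_measurable borel"
    using assms by (rule borel_measurable_continuous_onI)
  fix R
  have "integrable lborel (\<lambda>x. indicator (cball 0 R) x *\<^sub>R w x)"
    using borel_integrable_compact[OF compact_cball continuous_on_subset[OF assms subset_UNIV]]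
    by (simp add: indicator_scaleR_eq_if)
  then show "integrable lborel (\<lambda>x. indicator (cball 0 R) x * w x)"
    by simp
qed

lemma integrable_locally_integrable_mult:
  fixes f :: "'a::euclidean_space \<Rightarrow> real"
  assumes w: "locally_integrable w" and "continuous_on UNIV f" "supported_in R f"
  shows "integrable lborel (\<lambda>x. w x * f x)"
proof -
  have [measurable]: "w \<in> borel_measurable borel" "f \<in> borel_measurable borel"
    using assms by (auto simp: locally_integrable_def intro: borel_measurable_continuous_onI)
  obtain C where C: "\<And>x. norm (f x) \<le> C"
    using continuous_supported_bounded[OF assms(2,3)] by metis
  have "integrable lborel (\<lambda>x. C * (indicator (cball 0 R) x * w x))"
    using w by (simp add: locally_integrable_def)
  then show ?thesis
  proof (rule Bochner_Integration.integrable_bound)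
    have "\<bar>w x * f x\<bar> \<le> \<bar>C * (indicator (cball 0 R) x * w x)\<bar>" for x
      using C[of x] assms(3)
      by (cases "norm x \<le> R")
        (auto simp: abs_mult supported_in_def not_le indicator_def mult.commute intro: mult_right_mono order_trans)
    then show "AE x in lborel. norm (w x * f x) \<le> norm (C * (indicator (cball 0 R) x * w x))"
      by simp
  qed measurable
qed

lemma integrable_continuous_supported:
  fixes f :: "'a::euclidean_space \<Rightarrow> real"
  assumes "continuous_on UNIV f" "supported_in R f"
  shows "integrable lborel f"
  using integrable_locally_integrable_mult[of "\<lambda>_. 1", OF _ assms]
  by (simp add: locally_integrableI_continuous)

text \<open>Translation invariance of Lebesgue measure makes every difference quotient of \<open>w * f\<close>
  integrate to zero.\<close>

lemma integral_weighted_partial_eq_0: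
  fixes f :: "real^'n::finite \<Rightarrow> real"
  assumes f: "has_partial f f' j" "continuous_on UNIV f" "continuous_on UNIV f'" "supported_in R f"
    and w: "locally_integrable w" "\<And>x t. w (x + t *\<^sub>R axis j 1) = w x"
  shows "(\<integral>x. w x * f' x \<partial>lborel) = 0"
proof -
  have [measurable]: "w \<in> borel_measurable borel" "f \<in> borel_measurable borel" "f' \<in> borel_measurable borel"
    using assms by (auto simp: locally_integrable_def intro: borel_measurable_continuous_onI)
  have f'R: "supported_in R f'"
    using f(1,4) by (rule supported_in_partial)
  obtain C where C: "0 < C" "\<And>x. norm (f' x) \<le> C"
    using continuous_supported_bounded[OF f(3) f'R] by metis
  define h where "h n = 1 / real (Suc n)" for n
  have h: "0 < h n" "h n \<le> 1" for n by (auto simp: h_def)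
  define d where "d n x = w x * ((f (x + h n *\<^sub>R axis j 1) - f x) / h n)" for n x
  have [measurable]: "d n \<in> borel_measurable borel" for n
    unfolding d_def by measurable
  have wf: "integrable lborel (\<lambda>x. w x * f x)"
    using w(1) f(2,4) by (rule integrable_locally_integrable_mult)
  \<comment> \<open>Because \<open>w\<close> is constant along axis \<open>j\<close>, the product
    \<open>w x * f (x + h n *\<^sub>R axis j 1)\<close> is the translate of \<open>w * f\<close>, so
    the two integrals agree.\<close>
  have shift: "integrable lborel (\<lambda>x. w x * f (x + h n *\<^sub>R axis j 1))"
    "(\<integral>x. w x * f (x + h n *\<^sub>R axis j 1) \<partial>lborel) = (\<integral>x. w x * f x \<partial>lborel)" for n
    using integrable_lborel_shift[OF wf, of "h n *\<^sub>R axis j 1"]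
      integral_lborel_shift[of "\<lambda>x. w x * f x" "h n *\<^sub>R axis j 1"] w(2) by simp_all
  have d0: "(\<integral>x. d n x \<partial>lborel) = 0" for n
  proof -
    have "d n = (\<lambda>x. (w x * f (x + h n *\<^sub>R axis j 1) - w x * f x) / h n)"
      by (simp add: d_def fun_eq_iff algebra_simps)
    then show ?thesis using shift wf by simp
  qed
  have "(\<lambda>n. \<integral>x. d n x \<partial>lborel) \<longlonglongrightarrow> (\<integral>x. w x * f' x \<partial>lborel)"
  proof (rule integral_dominated_convergence)
    \<comment> \<open>\<open>3 * C\<close> bounds the difference quotients by
      \<open>mean_value_increment\<close> with \<open>d = 0\<close>; the radius \<open>R + 1\<close>
      accounts for increments of length at most 1.\<close>
    show "integrable lborel (\<lambda>x. 3 * C * \<bar>indicator (cball 0 (R + 1)) x * w x\<bar>)"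
      using w(1) by (auto simp: locally_integrable_def)
    show "AE x in lborel. (\<lambda>n. d n x) \<longlonglongrightarrow> w x * f' x"
    proof (rule AE_I2)
      fix x
      have "((\<lambda>t. f (x + t *\<^sub>R axis j 1)) has_real_derivative f' x) (at 0)"
        using f(1) by (simp add: has_partial_def has_real_derivative_iff_has_vector_derivative)
      then have "((\<lambda>t. (f (x + t *\<^sub>R axis j 1) - f x) / t) \<longlongrightarrow> f' x) (at 0)"
        by (simp add: DERIV_def)
      moreover have "filterlim h (at 0) sequentially"
        unfolding h_def filterlim_at
        using LIMSEQ_inverse_real_of_nat by (auto simp: inverse_eq_divide)
      ultimately show "(\<lambda>n. d n x) \<longlonglongrightarrow> w x * f' x"
        unfolding d_def by (intro tendsto_mult tendsto_const) (rule filterlim_compose)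
    qed
    show "AE x in lborel. norm (d n x) \<le> 3 * C * \<bar>indicator (cball 0 (R + 1)) x * w x\<bar>" for n
    proof (rule AE_I2)
      fix x
      show "norm (d n x) \<le> 3 * C * \<bar>indicator (cball 0 (R + 1)) x * w x\<bar>"
      proof (cases "norm x \<le> R + 1")
        case True
        have "norm (f (x + h n *\<^sub>R axis j 1) - f (x + 0 *\<^sub>R axis j 1) - h n *\<^sub>R 0) \<le> 3 * h n * C"
          by (rule mean_value_increment[OF _ has_partialD[OF f(1)]]) (use h[of n] C in auto)
        then have "\<bar>(f (x + h n *\<^sub>R axis j 1) - f x) / h n\<bar> \<le> 3 * C"
          using h[of n] by (simp add: field_simps)
        then have "\<bar>w x\<bar> * \<bar>(f (x + h n *\<^sub>R axis j 1) - f x) / h n\<bar> \<le> \<bar>w x\<bar> * (3 * C)"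
          by (rule mult_left_mono) simp
        then show ?thesis
          using True by (simp add: d_def abs_mult mult_ac)
      next
        case False
        have "norm x \<le> norm (x + h n *\<^sub>R axis j 1) + h n"
          using norm_triangle_ineq4[of "x + h n *\<^sub>R axis j (1::real)" "h n *\<^sub>R axis j 1"] h[of n] by simp
        then have "f (x + h n *\<^sub>R axis j 1) = 0" "f x = 0"
          using False h[of n] f(4) unfolding supported_in_def by (smt (verit))+
        then show ?thesis using C by (simp add: d_def)
      qed
    qed
  qed measurable
  then show ?thesis
    using d0 LIMSEQ_unique by (simp add: LIMSEQ_const_iff)
qed

lemma integral_partial_eq_0:
  fixes f :: "real^'n::finite \<Rightarrow> real"
  assumes "has_partial f f' j" "continuous_on UNIV f" "continuous_on UNIV f'" "supported_in R f"
  shows "(\<integral>x. f' x \<partial>lborel) = 0"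
  using integral_weighted_partial_eq_0[OF assms, of "\<lambda>_. 1"]
  by (simp add: locally_integrableI_continuous)

section \<open>The quadratic form\<close>

text \<open>The square of the distance r to the axis. It is a polynomial, so radial functions are
  written as smooth functions of it, whereas r itself is not differentiable on the axis.\<close>

definition rad2 :: "real^3 \<Rightarrow> real" where
  "rad2 x = (x $ 1)\<^sup>2 + (x $ 2)\<^sup>2"

definition ln_rad :: "real^3 \<Rightarrow> real" where
  "ln_rad x = ln (sqrt (rad2 x))"

lemma rad2_nonneg [simp]: "0 \<le> rad2 x"
  by (simp add: rad2_def)

lemma continuous_on_rad2 [continuous_intros]: "continuous_on S rad2"
  unfolding rad2_def by (intro continuous_intros)

lemma borel_measurable_rad2 [measurable]: "rad2 \<in> borel_measurable borel"
  by (intro borel_measurable_continuous_onI continuous_intros)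

lemma borel_measurable_ln_rad [measurable]: "ln_rad \<in> borel_measurable borel"
  unfolding ln_rad_def by measurable

lemma A_log_nth: "A_log x $ j = (if j = 3 then ln_rad x else 0)"
  using exhaust_3[of j] by (auto simp: A_log_def ln_rad_def rad2_def)

lemma rad2_le_norm: "rad2 x \<le> (norm x)\<^sup>2"
  by (simp add: rad2_def norm_vec_def L2_set_def sum_3)

lemma rad2_invariant: "rad2 (x + t *\<^sub>R axis 3 1) = rad2 x"
  by (simp add: rad2_def axis_def)

lemma ln_rad_invariant: "ln_rad (x + t *\<^sub>R axis 3 1) = ln_rad x"
  by (simp add: ln_rad_def rad2_invariant)

section \<open>Local square integrability of log r\<close>

lemma emeasure_thin_cylinder:
  assumes "0 < R" "0 \<le> s"
  shows "emeasure lborel {x \<in> cball 0 R. sqrt (rad2 x) \<le> s} \<le> ennreal (8 * R * s\<^sup>2)"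
proof -
  let ?b = "vector [s, s, R] :: real^3"
  have "{x \<in> cball 0 R. sqrt (rad2 x) \<le> s} \<subseteq> cbox (- ?b) ?b"
  proof
    fix x :: "real^3" assume "x \<in> {x \<in> cball 0 R. sqrt (rad2 x) \<le> s}"
    then have x: "norm x \<le> R" "sqrt (rad2 x) \<le> s" by auto
    have "\<bar>x $ 1\<bar> \<le> sqrt (rad2 x)" "\<bar>x $ 2\<bar> \<le> sqrt (rad2 x)"
      by (auto simp: rad2_def intro!: real_le_rsqrt)
    moreover have "\<bar>x $ 3\<bar> \<le> norm x"
      by (rule component_le_norm_cart)
    ultimately show "x \<in> cbox (- ?b) ?b"
      using x by (auto simp: mem_box_cart forall_3)
  qed
  then have "emeasure lborel {x \<in> cball 0 R. sqrt (rad2 x) \<le> s} \<le> emeasure lborel (cbox (- ?b) ?b)"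
    by (rule emeasure_mono) simp
  also have "\<dots> = ennreal (measure lborel (cbox (- ?b) ?b))"
    by (rule emeasure_eq_ennreal_measure) (simp add: emeasure_lborel_cbox_eq)
  also have "measure lborel (cbox (- ?b) ?b) = 8 * R * s\<^sup>2"
  proof -
    have "(\<Prod>i\<in>UNIV. ?b $ i - (- ?b) $ i) = 8 * R * s\<^sup>2"
      unfolding UNIV_3 by (simp add: power2_eq_square)
    then show ?thesis
      using assms by (subst content_cbox_cart)
        (auto simp: interval_eq_empty_cart not_less forall_3)
  qed
  finally show ?thesis .
qed

lemma sets_cball [measurable]: "cball (c::'a::euclidean_space) r \<in> sets borel"
  by simp

lemma integrable_indicator_cball:
  "integrable lborel (indicat_real (cball (c::'a::euclidean_space) r))"
  by (rule integrable_real_indicator) (use emeasure_lborel_cball_finite[of c r] in auto)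

text \<open>A dyadic decomposition takes the place of polar coordinates: near the axis 1/r is at
  most the sum of \<open>2 ^ (n + 1)\<close> over those n with r at most \<open>(1/2) ^ n\<close>,
  and the volumes of these cylinders shrink like \<open>(1/4) ^ n\<close>. On the axis the integrand
  is 0, as \<open>1 / 0 = 0\<close>.\<close>

lemma nn_integral_inverse_rad_finite:
  assumes "0 < R"
  shows "(\<integral>\<^sup>+x. indicator (cball 0 R) x * ennreal (1 / sqrt (rad2 x)) \<partial>lborel) < \<infinity>"
proof -
  define S where "S n = {x \<in> cball 0 R. sqrt (rad2 x) \<le> (1/2) ^ n}" for n :: nat
  have [measurable]: "S n \<in> sets borel" for n
  proof -
    have "S n = cball 0 R \<inter> {x. sqrt (rad2 x) \<le> (1/2) ^ n}"
      by (auto simp: S_def)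
    then show ?thesis by (auto intro!: borel_closed closed_Int closed_Collect_le continuous_intros)
  qed
  have pointwise: "indicator (cball 0 R) x * ennreal (1 / sqrt (rad2 x))
      \<le> (\<Sum>n. ennreal (2 ^ (n + 1)) * indicator (S n) x)" if "x \<in> cball 0 R" "sqrt (rad2 x) < 1/2" for x
  proof (cases "rad2 x = 0")
    case False
    define r where "r = sqrt (rad2 x)"
    have r: "0 < r" "r < 1/2"
      using that False rad2_nonneg[of x] by (auto simp: r_def less_le)
    have ex: "\<exists>n. (1/2) ^ n < r"
      using r real_arch_pow_inv[of r "1/2"] by auto
    \<comment> \<open>The first dyadic scale below r is not the scale 0, since r < 1/2. Its
      predecessor \<open>m\<close> satisfies r at most \<open>(1/2) ^ m\<close> and 1/r at most
      \<open>2 ^ (m + 1)\<close>, so a single term of the series already dominates.\<close>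
    define n where "n = (LEAST n. (1/2) ^ n < r)"
    have n: "(1/2) ^ n < r"
      unfolding n_def using ex by (rule LeastI_ex)
    have "n \<noteq> 0" using n r by (intro notI) auto
    then obtain m where m: "n = Suc m" by (cases n) auto
    have "\<not> (1/2) ^ m < r"
      using not_less_Least[of m "\<lambda>n. (1/2) ^ n < r"] m by (simp add: n_def)
    then have S: "x \<in> S m" using that by (simp add: S_def r_def)
    have "1 / r \<le> 2 ^ (m + 1)"
      using n r by (simp add: m field_simps power_one_over)
    then have "indicator (cball 0 R) x * ennreal (1 / sqrt (rad2 x)) \<le> ennreal (2 ^ (m + 1)) * indicator (S m) x"
      using that S by (simp add: r_def ennreal_leI)
    also have "\<dots> \<le> (\<Sum>n. ennreal (2 ^ (n + 1)) * indicator (S n) x)"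
    proof -
      have "F m \<le> (\<Sum>n. F n)" for F :: "nat \<Rightarrow> ennreal"
        using sum_le_suminf[of F "{m}"] by simp
      then show ?thesis .
    qed
    finally show ?thesis .
  qed simp
  have "(\<integral>\<^sup>+x. indicator (cball 0 R) x * ennreal (1 / sqrt (rad2 x)) \<partial>lborel)
    \<le> (\<integral>\<^sup>+x. 2 * indicator (cball 0 R) x + (\<Sum>n. ennreal (2 ^ (n + 1)) * indicator (S n) x) \<partial>lborel)"
  proof (rule nn_integral_mono)
    fix x :: "real^3"
    show "indicator (cball 0 R) x * ennreal (1 / sqrt (rad2 x))
      \<le> 2 * indicator (cball 0 R) x + (\<Sum>n. ennreal (2 ^ (n + 1)) * indicator (S n) x)"
    proof (cases "x \<in> cball 0 R \<and> sqrt (rad2 x) < 1/2")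
      case True
      then show ?thesis using pointwise[of x] by (meson add_increasing zero_le)
    next
      case False
      have "1 / sqrt (rad2 x) \<le> 2" if "x \<in> cball 0 R"
      proof -
        have "1 / 2 \<le> sqrt (rad2 x)" using False that by simp
        moreover from this have "0 < sqrt (rad2 x)" by linarith
        ultimately show ?thesis by (simp add: divide_le_eq)
      qed
      then have "ennreal (1 / sqrt (rad2 x)) \<le> 2" if "x \<in> cball 0 R"
        using that ennreal_leI[of "1 / sqrt (rad2 x)" 2] by simp
      then have "indicator (cball 0 R) x * ennreal (1 / sqrt (rad2 x)) \<le> 2 * indicator (cball 0 R) x"
        by (auto simp: indicator_def)
      then show ?thesis by (meson add_increasing2 zero_le)
    qed
  qed
  also have "\<dots> = 2 * emeasure lborel (cball 0 R :: (real^3) set) + (\<Sum>n. ennreal (2 ^ (n + 1)) * emeasure lborel (S n))"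
  proof (subst nn_integral_add)
    show "(\<integral>\<^sup>+x. 2 * indicator (cball 0 R :: (real^3) set) x \<partial>lborel) + (\<integral>\<^sup>+x. (\<Sum>n. ennreal (2 ^ (n + 1)) * indicator (S n) x) \<partial>lborel)
      = 2 * emeasure lborel (cball 0 R :: (real^3) set) + (\<Sum>n. ennreal (2 ^ (n + 1)) * emeasure lborel (S n))"
      by (subst nn_integral_suminf) (simp_all add: nn_integral_cmult_indicator)
  qed measurable
  also have "(\<Sum>n. ennreal (2 ^ (n + 1)) * emeasure lborel (S n)) \<le> (\<Sum>n. ennreal (16 * R * (1/2) ^ n))"
  proof (rule suminf_le)
    fix n
    have "ennreal (2 ^ (n + 1)) * emeasure lborel (S n) \<le> ennreal (2 ^ (n + 1)) * ennreal (8 * R * ((1/2) ^ n)\<^sup>2)"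
      unfolding S_def by (intro mult_left_mono emeasure_thin_cylinder assms) auto
    also have "\<dots> = ennreal (16 * R * (1/2) ^ n)"
      by (simp add: ennreal_mult'[symmetric] power2_eq_square power_one_over field_simps)
    finally show "ennreal (2 ^ (n + 1)) * emeasure lborel (S n) \<le> ennreal (16 * R * (1/2) ^ n)" .
  qed auto
  finally have le: "(\<integral>\<^sup>+x. indicator (cball 0 R) x * ennreal (1 / sqrt (rad2 x)) \<partial>lborel)
    \<le> 2 * emeasure lborel (cball 0 R :: (real^3) set) + (\<Sum>n. ennreal (16 * R * (1/2) ^ n))"
    by (simp add: add_left_mono)
  have "(\<Sum>n. ennreal (16 * R * (1/2) ^ n)) < \<infinity>"
  proof -
    have "summable (\<lambda>n. 16 * R * (1/2) ^ n)"
      by (intro summable_mult summable_geometric) simp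
    then show ?thesis using assms by (subst suminf_ennreal2) auto
  qed
  then have "2 * emeasure lborel (cball 0 R :: (real^3) set) + (\<Sum>n. ennreal (16 * R * (1/2) ^ n)) < \<infinity>"
    using emeasure_lborel_cball_finite[of "0::real^3" R] by (simp add: ennreal_mult_less_top)
  with le show ?thesis
    by (rule le_less_trans)
qed

text \<open>Applying the elementary bounds for the logarithm to \<open>sqrt r\<close> instead of
  \<open>r\<close> gives a singularity 1/r, which is integrable across an axis in space; the bound
  in terms of \<open>r\<close> itself would give the square of 1/r, which is not.\<close>

lemma ln_squared_le:
  assumes "0 < (r::real)"
  shows "(ln r)\<^sup>2 \<le> 4 * (r + 1 / r)"
proof -
  define s where "s = sqrt r"
  have s: "0 < s" "r = s\<^sup>2" using assms by (auto simp: s_def)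
  have "ln r = 2 * ln s" using s by (simp add: ln_realpow)
  moreover have "(ln s)\<^sup>2 \<le> s\<^sup>2 + 1 / s\<^sup>2"
  proof (cases "1 \<le> s")
    case True
    then have "0 \<le> ln s" "ln s \<le> s" using s ln_le_minus_one[of s] by auto
    then have "(ln s)\<^sup>2 \<le> s\<^sup>2" by (intro power_mono) auto
    then show ?thesis using s by (simp add: add_increasing2)
  next
    case False
    then have "0 \<le> - ln s" "- ln s \<le> 1 / s" using s ln_le_minus_one[of "1 / s"] by (auto simp: ln_div)
    then have "(- ln s)\<^sup>2 \<le> (1 / s)\<^sup>2" by (intro power_mono) auto
    then show ?thesis using s by (simp add: add_increasing power_divide)
  qed
  ultimately show ?thesis using s by (simp add: power_mult_distrib)
qed

text \<open>The square of the vector potential is a zeroth-order coefficient of the operator; this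
  makes all the weighted integrals in the integration by parts finite.\<close>

lemma locally_integrable_ln_rad_power2: "locally_integrable (\<lambda>x. (ln_rad x)\<^sup>2)"
  unfolding locally_integrable_def
proof (intro conjI allI)
  show [measurable]: "(\<lambda>x. (ln_rad x)\<^sup>2) \<in> borel_measurable borel" by measurable
  fix R :: real
  \<comment> \<open>An enlarged radius that is positive for every \<open>R\<close>, as the bounds
    for 1/r require.\<close>
  define R' where "R' = max R 1"
  have R': "0 < R'" "cball 0 R \<subseteq> (cball 0 R' :: (real^3) set)" by (auto simp: R'_def)
  have i1: "integrable lborel (\<lambda>x. indicator (cball 0 R') x * (1 / sqrt (rad2 x)))"
  proof (rule integrableI_nonneg)
    have "(\<integral>\<^sup>+x. ennreal (indicator (cball 0 R') x * (1 / sqrt (rad2 x))) \<partial>lborel)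
      = (\<integral>\<^sup>+x. indicator (cball 0 R') x * ennreal (1 / sqrt (rad2 x)) \<partial>lborel)"
      by (intro nn_integral_cong) (auto simp: indicator_def)
    then show "(\<integral>\<^sup>+x. ennreal (indicator (cball 0 R') x * (1 / sqrt (rad2 x))) \<partial>lborel) < \<infinity>"
      using nn_integral_inverse_rad_finite[OF R'(1)] by simp
    show "(\<lambda>x. indicator (cball 0 R') x * (1 / sqrt (rad2 x))) \<in> borel_measurable lborel"
      by (intro borel_measurable_times borel_measurable_indicator borel_measurable_divide) simp_all
  qed simp
  have i2: "integrable lborel (\<lambda>x::real^3. indicator (cball 0 R') x * R')"
    by (intro integrable_mult_left integrable_indicator_cball)
  have "integrable lborel (\<lambda>x. 4 * (indicator (cball 0 R') x * R' + indicator (cball 0 R') x * (1 / sqrt (rad2 x))))"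
    by (intro integrable_mult_right Bochner_Integration.integrable_add i1 i2)
  then show "integrable lborel (\<lambda>x. indicator (cball 0 R) x * (ln_rad x)\<^sup>2)"
  proof (rule Bochner_Integration.integrable_bound)
    have "\<bar>indicator (cball 0 R) x * (ln_rad x)\<^sup>2\<bar>
      \<le> \<bar>4 * (indicator (cball 0 R') x * R' + indicator (cball 0 R') x * (1 / sqrt (rad2 x)))\<bar>" for x :: "real^3"
    proof (cases "x \<in> cball 0 R \<and> rad2 x \<noteq> 0")
      case True
      then have "0 < sqrt (rad2 x)" using rad2_nonneg[of x] by (simp add: less_le)
      then have "(ln_rad x)\<^sup>2 \<le> 4 * (sqrt (rad2 x) + 1 / sqrt (rad2 x))"
        unfolding ln_rad_def by (rule ln_squared_le)
      moreover have "sqrt (rad2 x) \<le> norm x"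
        using rad2_le_norm[of x] by (simp add: real_le_lsqrt)
      ultimately show ?thesis using True R' by (auto simp: indicator_def)
    next
      case False
      then show ?thesis using R'(1) by (auto simp: ln_rad_def indicator_def)
    qed
    then show "AE x in lborel. norm (indicator (cball 0 R) x * (ln_rad x)\<^sup>2)
      \<le> norm (4 * (indicator (cball 0 R') x * R' + indicator (cball 0 R') x * (1 / sqrt (rad2 x))))"
      by simp
  qed measurable
qed

lemma locally_integrable_of_power2:
  assumes "locally_integrable (\<lambda>x. (w x)\<^sup>2)" "w \<in> borel_measurable borel"
  shows "locally_integrable w"
  unfolding locally_integrable_def
proof (intro conjI allI assms(2))
  note [measurable] = assms(2)
  fix R
  have "integrable lborel (indicat_real (cball (0::'a) R))"
    by (rule integrable_real_indicator) (use emeasure_lborel_cball_finite[of 0 R] in auto)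
  then have "integrable lborel (\<lambda>x::'a. indicator (cball 0 R) x + indicator (cball 0 R) x * (w x)\<^sup>2)"
    using assms(1) by (auto simp: locally_integrable_def)
  then show "integrable lborel (\<lambda>x. indicator (cball 0 R) x * w x)"
  proof (rule Bochner_Integration.integrable_bound)
    have "\<bar>y\<bar> \<le> 1 + y\<^sup>2" for y :: real
      using zero_le_power2[of "\<bar>y\<bar> - 1"] by (simp add: power2_diff)
    then show "AE x in lborel. norm (indicator (cball 0 R) x * w x)
      \<le> norm (indicator (cball 0 R) x + indicator (cball 0 R) x * (w x)\<^sup>2)"
      by (auto simp: indicator_def)
  qed measurable
qed

lemmas locally_integrable_ln_rad =
  locally_integrable_of_power2[OF locally_integrable_ln_rad_power2 borel_measurable_ln_rad]

section \<open>Integration by parts for the magnetic derivatives\<close>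

lemma integrable_inner_weighted:
  fixes f g :: "'a::euclidean_space \<Rightarrow> complex"
  assumes "locally_integrable w" "continuous_on UNIV f" "continuous_on UNIV g" "supported_in R f"
  shows "integrable lborel (\<lambda>x. w x * (f x \<bullet> g x))"
  using assms
  by (intro integrable_locally_integrable_mult[where R = R] continuous_intros) (auto simp: supported_in_def)

text \<open>As \<open>a\<close> is constant along axis \<open>j\<close>, it commutes with the
  derivative in that direction, and the square expands like that of a commuting binomial.\<close>

lemma magnetic_deriv_twice:
  fixes A :: "real^'n::finite \<Rightarrow> real^'n"
  assumes \<phi>: "test_function \<phi>" and a: "\<And>x. A x $ j = a x" "\<And>x t. a (x + t *\<^sub>R axis j 1) = a x"
  shows "magnetic_deriv A j (magnetic_deriv A j \<phi>) x
      = - partial_deriv j (partial_deriv j \<phi>) x + (2 * a x) *\<^sub>R (\<i> * partial_deriv j \<phi> x) + (a x)\<^sup>2 *\<^sub>R \<phi> x"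
proof -
  define \<phi>1 where "\<phi>1 = partial_deriv j \<phi>"
  define \<phi>2 where "\<phi>2 = partial_deriv j \<phi>1"
  have part: "has_partial \<phi> \<phi>1 j" "has_partial \<phi>1 \<phi>2 j"
    unfolding \<phi>2_def \<phi>1_def by (intro test_function_has_partial test_function_partial_deriv \<phi>)+
  have m: "magnetic_deriv A j \<phi> = (\<lambda>x. - \<i> * \<phi>1 x - a x *\<^sub>R \<phi> x)"
    by (simp add: magnetic_deriv_def \<phi>1_def a(1) scaleR_conv_of_real fun_eq_iff)
  have "has_partial (\<lambda>x. - \<i> * \<phi>1 x - a x *\<^sub>R \<phi> x)
      (\<lambda>x. - \<i> * \<phi>2 x - (a x *\<^sub>R \<phi>1 x + 0 *\<^sub>R \<phi> x)) j"
    by (intro has_partial_diff has_partial_linear[OF bounded_linear_mult_right] has_partial_scaleR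
        has_partial_invariant part a)
  from has_partial_imp_partial_deriv[OF this]
  have pm: "partial_deriv j (magnetic_deriv A j \<phi>) = (\<lambda>x. - \<i> * \<phi>2 x - a x *\<^sub>R \<phi>1 x)"
    unfolding m by simp
  show ?thesis
    unfolding magnetic_deriv_def[of A j "magnetic_deriv A j \<phi>"] pm unfolding m a(1) \<phi>2_def \<phi>1_def
    by (simp add: scaleR_conv_of_real algebra_simps power2_eq_square)
qed

text \<open>The terms with the square of \<open>a\<close> cancel pointwise. What remains of the
  difference of the two integrands is the derivative of \<open>\<phi>1 \<bullet> \<psi>\<close>
  minus \<open>a\<close> times the derivative of \<open>(\<i> * \<phi>) \<bullet> \<psi>\<close>,
  and both integrate to zero because the weights 1 and \<open>a\<close> are constant along axis
  \<open>j\<close>.\<close>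

lemma magnetic_deriv_by_parts:
  fixes A :: "real^'n::finite \<Rightarrow> real^'n"
  assumes \<phi>: "test_function \<phi>" and \<psi>: "test_function \<psi>"
    and a: "\<And>x. A x $ j = a x" "locally_integrable a" "locally_integrable (\<lambda>x. (a x)\<^sup>2)"
      "\<And>x t. a (x + t *\<^sub>R axis j 1) = a x"
  shows "integrable lborel (\<lambda>x. magnetic_deriv A j (magnetic_deriv A j \<phi>) x \<bullet> \<psi> x)"
    and "integrable lborel (\<lambda>x. magnetic_deriv A j \<phi> x \<bullet> magnetic_deriv A j \<psi> x)"
    and "(\<integral>x. magnetic_deriv A j (magnetic_deriv A j \<phi>) x \<bullet> \<psi> x \<partial>lborel)
       = (\<integral>x. magnetic_deriv A j \<phi> x \<bullet> magnetic_deriv A j \<psi> x \<partial>lborel)"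
proof -
  define \<phi>1 where "\<phi>1 = partial_deriv j \<phi>"
  define \<phi>2 where "\<phi>2 = partial_deriv j \<phi>1"
  define \<psi>1 where "\<psi>1 = partial_deriv j \<psi>"
  have test: "test_function \<phi>1" "test_function \<phi>2" "test_function \<psi>1"
    unfolding \<phi>1_def \<phi>2_def \<psi>1_def by (intro test_function_partial_deriv \<phi> \<psi>)+
  note cont = test[THEN test_function_continuous] \<phi>[THEN test_function_continuous]
    \<psi>[THEN test_function_continuous]
  have part: "has_partial \<phi> \<phi>1 j" "has_partial \<phi>1 \<phi>2 j" "has_partial \<psi> \<psi>1 j"
    unfolding \<phi>2_def using test \<phi> \<psi>
    by (auto intro: test_function_has_partial simp: \<phi>1_def \<psi>1_def)
  obtain R where R: "supported_in R \<phi>"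
    using test_function_supported[OF \<phi>] by metis
  have R1: "supported_in R \<phi>1" using part(1) R by (rule supported_in_partial)
  have R2: "supported_in R \<phi>2" using part(2) R1 by (rule supported_in_partial)
  have m: "magnetic_deriv A j \<phi> x = - \<i> * \<phi>1 x - a x *\<^sub>R \<phi> x"
    "magnetic_deriv A j \<psi> x = - \<i> * \<psi>1 x - a x *\<^sub>R \<psi> x" for x
    by (simp_all add: magnetic_deriv_def \<phi>1_def \<psi>1_def a(1) scaleR_conv_of_real)
  have mm: "magnetic_deriv A j (magnetic_deriv A j \<phi>) x
      = - \<phi>2 x + (2 * a x) *\<^sub>R (\<i> * \<phi>1 x) + (a x)\<^sup>2 *\<^sub>R \<phi> x" for x
    unfolding \<phi>2_def \<phi>1_def using \<phi> a(1,4) by (rule magnetic_deriv_twice)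
  \<comment> \<open>The weight 1 is written out in the terms below so that each has the shape of a
    weight times an inner product.\<close>
  have a0: "locally_integrable (\<lambda>x. 1)"
    by (simp add: locally_integrableI_continuous)
  have cont': "continuous_on UNIV (\<lambda>x. \<i> * \<phi>1 x)" "continuous_on UNIV (\<lambda>x. \<i> * \<psi>1 x)"
    by (intro continuous_intros cont)+
  have R1': "supported_in R (\<lambda>x. \<i> * \<phi>1 x)"
    using R1 by (simp add: supported_in_def)
  note int = integrable_inner_weighted[where R = R, OF _ _ _ R]
    integrable_inner_weighted[where R = R, OF _ _ _ R1]
    integrable_inner_weighted[where R = R, OF _ _ _ R2]
    integrable_inner_weighted[where R = R, OF _ _ _ R1']
  have i1: "integrable lborel (\<lambda>x. - (1 * (\<phi>2 x \<bullet> \<psi> x)) + 2 * (a x * ((\<i> * \<phi>1 x) \<bullet> \<psi> x)) + (a x)\<^sup>2 * (\<phi> x \<bullet> \<psi> x))"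
    by (intro Bochner_Integration.integrable_add integrable_minus integrable_mult_right int a0 a cont cont')
  have e1: "magnetic_deriv A j (magnetic_deriv A j \<phi>) x \<bullet> \<psi> x
    = - (1 * (\<phi>2 x \<bullet> \<psi> x)) + 2 * (a x * ((\<i> * \<phi>1 x) \<bullet> \<psi> x)) + (a x)\<^sup>2 * (\<phi> x \<bullet> \<psi> x)" for x
    by (simp add: mm inner_add_left inner_diff_left)
  have i2: "integrable lborel (\<lambda>x. 1 * (\<phi>1 x \<bullet> \<psi>1 x) + a x * (\<phi> x \<bullet> (\<i> * \<psi>1 x))
      + a x * ((\<i> * \<phi>1 x) \<bullet> \<psi> x) + (a x)\<^sup>2 * (\<phi> x \<bullet> \<psi> x))"
    by (intro Bochner_Integration.integrable_add int a0 a cont cont')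
  have e2: "magnetic_deriv A j \<phi> x \<bullet> magnetic_deriv A j \<psi> x
    = 1 * (\<phi>1 x \<bullet> \<psi>1 x) + a x * (\<phi> x \<bullet> (\<i> * \<psi>1 x)) + a x * ((\<i> * \<phi>1 x) \<bullet> \<psi> x) + (a x)\<^sup>2 * (\<phi> x \<bullet> \<psi> x)" for x
    by (simp add: m inner_complex_def algebra_simps power2_eq_square)
  show I1: "integrable lborel (\<lambda>x. magnetic_deriv A j (magnetic_deriv A j \<phi>) x \<bullet> \<psi> x)"
    unfolding e1 by (rule i1)
  show I2: "integrable lborel (\<lambda>x. magnetic_deriv A j \<phi> x \<bullet> magnetic_deriv A j \<psi> x)"
    unfolding e2 by (rule i2)
  have z1: "(\<integral>x. 1 * (\<phi>1 x \<bullet> \<psi>1 x + \<phi>2 x \<bullet> \<psi> x) \<partial>lborel) = 0"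
    by (rule integral_weighted_partial_eq_0[OF has_partial_inner[OF part(2,3)], where R = R])
      (use cont R1 in \<open>auto intro!: continuous_intros a0 simp: supported_in_def\<close>)
  have z2: "(\<integral>x. a x * ((\<i> * \<phi> x) \<bullet> \<psi>1 x + (\<i> * \<phi>1 x) \<bullet> \<psi> x) \<partial>lborel) = 0"
    by (rule integral_weighted_partial_eq_0[OF has_partial_inner[OF has_partial_linear[OF bounded_linear_mult_right part(1)] part(3)], where R = R])
      (use cont R a in \<open>auto intro!: continuous_intros simp: supported_in_def\<close>)
  have j1: "integrable lborel (\<lambda>x. 1 * (\<phi>1 x \<bullet> \<psi>1 x) + 1 * (\<phi>2 x \<bullet> \<psi> x))"
    by (intro Bochner_Integration.integrable_add int a0 a cont cont')
  have j2: "integrable lborel (\<lambda>x. a x * ((\<i> * \<phi>1 x) \<bullet> \<psi> x) - a x * (\<phi> x \<bullet> (\<i> * \<psi>1 x)))"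
    by (intro Bochner_Integration.integrable_diff int a0 a cont cont')
  have "(\<integral>x. magnetic_deriv A j \<phi> x \<bullet> magnetic_deriv A j \<psi> x
      - magnetic_deriv A j (magnetic_deriv A j \<phi>) x \<bullet> \<psi> x \<partial>lborel)
    = (\<integral>x. (1 * (\<phi>1 x \<bullet> \<psi>1 x) + 1 * (\<phi>2 x \<bullet> \<psi> x))
       - (a x * ((\<i> * \<phi>1 x) \<bullet> \<psi> x) - a x * (\<phi> x \<bullet> (\<i> * \<psi>1 x))) \<partial>lborel)"
    unfolding e1 e2 by (intro Bochner_Integration.integral_cong refl) simp
  also have "\<dots> = (\<integral>x. 1 * (\<phi>1 x \<bullet> \<psi>1 x + \<phi>2 x \<bullet> \<psi> x) \<partial>lborel)
      - (\<integral>x. a x * ((\<i> * \<phi> x) \<bullet> \<psi>1 x + (\<i> * \<phi>1 x) \<bullet> \<psi> x) \<partial>lborel)"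
    unfolding Bochner_Integration.integral_diff[OF j1 j2]
    by (intro arg_cong2[where f = "(-)"] Bochner_Integration.integral_cong refl)
      (simp_all add: inner_complex_def algebra_simps)
  also have "\<dots> = 0" using z1 z2 by simp
  finally show "(\<integral>x. magnetic_deriv A j (magnetic_deriv A j \<phi>) x \<bullet> \<psi> x \<partial>lborel)
       = (\<integral>x. magnetic_deriv A j \<phi> x \<bullet> magnetic_deriv A j \<psi> x \<partial>lborel)"
    using I1 I2 by simp
qed

text \<open>The right-hand side is symmetric in \<phi> and \<psi> and, for \<phi> = \<psi>,
  nonnegative; symmetry and positivity of the operator rest on this.\<close>

lemma magnetic_laplacian_form:
  assumes \<phi>: "test_function \<phi>" and \<psi>: "test_function \<psi>"
  shows "integrable lborel (\<lambda>x. \<Sum>j\<in>UNIV. magnetic_deriv A_log j \<phi> x \<bullet> magnetic_deriv A_log j \<psi> x)"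
    and "(\<integral>x. magnetic_laplacian A_log \<phi> x \<bullet> \<psi> x \<partial>lborel)
       = (\<integral>x. (\<Sum>j\<in>UNIV. magnetic_deriv A_log j \<phi> x \<bullet> magnetic_deriv A_log j \<psi> x) \<partial>lborel)"
proof -
  define a where "a j x = (if j = 3 then ln_rad x else 0)" for j :: 3 and x :: "real^3"
  have a1: "A_log x $ j = a j x" for j x
    by (simp add: a_def A_log_nth)
  have a2: "locally_integrable (a j)" for j
    using locally_integrable_ln_rad
    by (cases "j = 3") (simp_all add: a_def[abs_def] locally_integrableI_continuous)
  have a3: "locally_integrable (\<lambda>x. (a j x)\<^sup>2)" for j
    using locally_integrable_ln_rad_power2
    by (cases "j = 3") (simp_all add: a_def[abs_def] locally_integrableI_continuous)
  have a4: "a j (x + t *\<^sub>R axis j 1) = a j x" for j x t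
    by (simp add: a_def ln_rad_invariant)
  note parts = magnetic_deriv_by_parts[OF \<phi> \<psi> a1 a2 a3 a4]
  show "integrable lborel (\<lambda>x. \<Sum>j\<in>UNIV. magnetic_deriv A_log j \<phi> x \<bullet> magnetic_deriv A_log j \<psi> x)"
    by (intro Bochner_Integration.integrable_sum parts)
  show "(\<integral>x. magnetic_laplacian A_log \<phi> x \<bullet> \<psi> x \<partial>lborel)
       = (\<integral>x. (\<Sum>j\<in>UNIV. magnetic_deriv A_log j \<phi> x \<bullet> magnetic_deriv A_log j \<psi> x) \<partial>lborel)"
    by (simp add: magnetic_laplacian_def inner_sum_left Bochner_Integration.integral_sum parts)
qed

section \<open>Radial vector fields\<close>

lemma has_partial_chain:
  assumes "has_partial f f' j" "\<And>x. (g has_real_derivative g' (f x)) (at (f x))"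
  shows "has_partial (\<lambda>x. g (f x)) (\<lambda>x. f' x * g' (f x)) j"
  unfolding has_partial_def
proof
  fix x
  have "(g \<circ> (\<lambda>t. f (x + t *\<^sub>R axis j 1)) has_vector_derivative f' x * g' (f x)) (at 0)"
    by (rule field_vector_diff_chain_at) (use assms in \<open>simp_all add: has_partial_def\<close>)
  then show "((\<lambda>t. g (f (x + t *\<^sub>R axis j 1))) has_vector_derivative f' x * g' (f x)) (at 0)"
    by (simp add: o_def)
qed

lemma has_partial_component: "has_partial (\<lambda>x. x $ i) (\<lambda>x. if i = j then 1 else 0) j"
  unfolding has_partial_def by (auto intro!: derivative_eq_intros simp: axis_def)

lemma has_partial_rad2:
  assumes "j \<noteq> 3"
  shows "has_partial rad2 (\<lambda>x. 2 * x $ j) j"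
proof -
  have "has_partial (\<lambda>x. (x $ 1) * (x $ 1) + (x $ 2) * (x $ 2))
      (\<lambda>x. (x $ 1 * (if 1 = j then 1 else 0) + (if 1 = j then 1 else 0) * x $ 1)
         + (x $ 2 * (if 2 = j then 1 else 0) + (if 2 = j then 1 else 0) * x $ 2)) j"
    by (intro has_partial_add has_partial_mult has_partial_component)
  moreover have "rad2 = (\<lambda>x. (x $ 1) * (x $ 1) + (x $ 2) * (x $ 2))"
    by (simp add: rad2_def power2_eq_square fun_eq_iff)
  moreover have "(\<lambda>x::real^3. (x $ 1 * (if 1 = j then 1 else 0) + (if 1 = j then 1 else 0) * x $ 1)
         + (x $ 2 * (if 2 = j then 1 else 0) + (if 2 = j then 1 else 0) * x $ 2)) = (\<lambda>x. 2 * x $ j)"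
    using assms exhaust_3[of j] by (auto simp: fun_eq_iff)
  ultimately show ?thesis by simp
qed

lemma has_partial_radial:
  assumes "j \<noteq> 3" "\<And>s. 0 \<le> s \<Longrightarrow> (h has_real_derivative h' s) (at s)"
  shows "has_partial (\<lambda>x. h (rad2 x)) (\<lambda>x. 2 * x $ j * h' (rad2 x)) j"
  using has_partial_chain[OF has_partial_rad2[OF assms(1)], of h h'] assms(2) by simp

lemma has_partial_radial_field:
  assumes "j \<noteq> 3" "\<And>s. 0 \<le> s \<Longrightarrow> (h has_real_derivative h' s) (at s)"
  shows "has_partial (\<lambda>x. x $ j * h (rad2 x)) (\<lambda>x. x $ j * (2 * x $ j * h' (rad2 x)) + 1 * h (rad2 x)) j"
  using has_partial_mult[OF has_partial_component[of j j] has_partial_radial[OF assms]] by simp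

lemma continuous_on_radial:
  assumes "continuous_on {0..} h"
  shows "continuous_on S (\<lambda>x. h (rad2 x))"
  by (rule continuous_on_compose2[OF assms]) (auto intro: continuous_intros)

lemma continuous_on_derivative_nonneg:
  assumes "\<And>s. 0 \<le> s \<Longrightarrow> (h has_real_derivative h' s) (at s)"
  shows "continuous_on {0..} h"
  using assms DERIV_isCont by (auto intro!: continuous_at_imp_continuous_on)

lemma integrable_cs:
  fixes f :: "'a::euclidean_space \<Rightarrow> real"
  assumes "continuous_on UNIV f" "\<And>x. R < norm x \<Longrightarrow> f x = 0"
  shows "integrable lborel f"
  using assms by (intro integrable_continuous_supported[where R = R]) (auto simp: supported_in_def)

text \<open>The commutator of the radial derivative \<open>F \<bullet> \<nabla>\<close> with \<open>\<partial>\<^sub>3 - \<i>a\<close> is \<open>-\<i>(F \<bullet> \<nabla>a)\<close>; here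
  \<open>F = h(r\<^sup>2)(x, y)\<close> and \<open>a = k(r\<^sup>2)\<close>.\<close>

lemma radial_commutator_identity:
  assumes u: "test_function u"
    and h: "\<And>s. 0 \<le> s \<Longrightarrow> (h has_real_derivative h' s) (at s)" "continuous_on {0..} h'"
    and k: "\<And>s. 0 \<le> s \<Longrightarrow> (k has_real_derivative k' s) (at s)" "continuous_on {0..} k'"
  defines "b \<equiv> \<lambda>x. partial_deriv 3 u x - \<i> * (k (rad2 x) *\<^sub>R u x)"
    and "c \<equiv> \<lambda>x. h (rad2 x) *\<^sub>R (x $ 1 *\<^sub>R partial_deriv 1 u x + x $ 2 *\<^sub>R partial_deriv 2 u x)"
  shows "integrable lborel (\<lambda>x. 2 * rad2 x * h (rad2 x) * k' (rad2 x) * (norm (u x))\<^sup>2)"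
    and "integrable lborel (\<lambda>x. (2 * h (rad2 x) + 2 * rad2 x * h' (rad2 x)) * ((\<i> * u x) \<bullet> b x)
        + 2 * ((\<i> * c x) \<bullet> b x))"
    and "(\<integral>x. 2 * rad2 x * h (rad2 x) * k' (rad2 x) * (norm (u x))\<^sup>2 \<partial>lborel)
      = (\<integral>x. (2 * h (rad2 x) + 2 * rad2 x * h' (rad2 x)) * ((\<i> * u x) \<bullet> b x)
        + 2 * ((\<i> * c x) \<bullet> b x) \<partial>lborel)"
proof -
  define u1 u2 u3 where "u1 = partial_deriv 1 u" and "u2 = partial_deriv 2 u" and "u3 = partial_deriv 3 u"
  define u31 u32 where "u31 = partial_deriv 1 u3" and "u32 = partial_deriv 2 u3"
  have t1: "test_function u1" "test_function u2" "test_function u3"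
    unfolding u1_def u2_def u3_def by (intro test_function_partial_deriv u)+
  have t2: "test_function u31" "test_function u32"
    unfolding u31_def u32_def by (intro test_function_partial_deriv t1)+
  note ucont = u[THEN test_function_continuous] t1[THEN test_function_continuous]
    t2[THEN test_function_continuous]
  note pu = test_function_has_partial[OF u, of 1, folded u1_def]
    test_function_has_partial[OF u, of 2, folded u2_def]
    test_function_has_partial[OF u, of 3, folded u3_def]
    test_function_has_partial[OF t1(3), of 1, folded u31_def]
    test_function_has_partial[OF t1(3), of 2, folded u32_def]
  \<comment> \<open>The mixed derivatives must agree here: those from differentiating
    \<open>b\<close> along axes 1 and 2 have to cancel those from differentiating \<open>c\<close>
    along axis 3.\<close>
  have pu13: "has_partial u1 u31 3" "has_partial u2 u32 3"
    using test_function_has_partial[OF t1(1), of 3] test_function_has_partial[OF t1(2), of 3]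
    unfolding u1_def u2_def u31_def u32_def u3_def
    by (simp_all add: test_function_partials_commute[OF u, of 3])
  obtain R where R: "supported_in R u" using test_function_supported[OF u] by metis
  have R1: "supported_in R u1" "supported_in R u2" "supported_in R u3"
    using supported_in_partial[OF pu(1) R] supported_in_partial[OF pu(2) R] supported_in_partial[OF pu(3) R] .
  have R2: "supported_in R u31" "supported_in R u32"
    using supported_in_partial[OF pu(4) R1(3)] supported_in_partial[OF pu(5) R1(3)] .
  note Rall = R R1 R2
  have hcont: "continuous_on UNIV (\<lambda>x. h (rad2 x))" "continuous_on UNIV (\<lambda>x. h' (rad2 x))"
    "continuous_on UNIV (\<lambda>x. k (rad2 x))" "continuous_on UNIV (\<lambda>x. k' (rad2 x))"
    using continuous_on_derivative_nonneg[OF h(1)] continuous_on_derivative_nonneg[OF k(1)] h(2) k(2)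
    by (auto intro: continuous_on_radial)
  note cont = ucont hcont continuous_on_rad2
  define F where "F j x = x $ j * h (rad2 x)" for j :: 3 and x
  define F' where "F' j x = x $ j * (2 * x $ j * h' (rad2 x)) + 1 * h (rad2 x)" for j :: 3 and x
  have pF: "has_partial (F j) (F' j) j" if "j \<noteq> 3" for j
    unfolding F_def[abs_def] F'_def[abs_def] using that h(1) by (rule has_partial_radial_field)
  define a where "a x = k (rad2 x)" for x
  define a' where "a' j x = 2 * x $ j * k' (rad2 x)" for j :: 3 and x
  have pa: "has_partial a (a' j) j" if "j \<noteq> 3" for j
    unfolding a_def[abs_def] a'_def[abs_def] using that k(1) by (rule has_partial_radial)
  have cF: "continuous_on UNIV (F j)" "continuous_on UNIV (F' j)" "continuous_on UNIV a" "continuous_on UNIV (a' j)" for j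
    unfolding F_def[abs_def] F'_def[abs_def] a_def[abs_def] a'_def[abs_def]
    by (intro continuous_intros cont)+
  note cont = cont cF
  have b_eq: "b = (\<lambda>x. u3 x - \<i> * (a x *\<^sub>R u x))"
    by (simp add: b_def u3_def a_def)
  have c_eq: "c = (\<lambda>x. F 1 x *\<^sub>R u1 x + F 2 x *\<^sub>R u2 x)"
    by (simp add: c_def u1_def u2_def F_def fun_eq_iff algebra_simps)
  note mult_i = has_partial_linear[OF bounded_linear_mult_right[of \<i>]]
  have pb: "has_partial b (\<lambda>x. u31 x - \<i> * (a x *\<^sub>R u1 x + a' 1 x *\<^sub>R u x)) 1"
    "has_partial b (\<lambda>x. u32 x - \<i> * (a x *\<^sub>R u2 x + a' 2 x *\<^sub>R u x)) 2"
    unfolding b_eq by (intro has_partial_diff mult_i has_partial_scaleR pu pa; simp)+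
  have F_inv: "has_partial (F 1) (\<lambda>x. 0) 3" "has_partial (F 2) (\<lambda>x. 0) 3"
    by (rule has_partial_invariant, simp add: F_def rad2_invariant, simp add: axis_def)+
  have pc: "has_partial c (\<lambda>x. (F 1 x *\<^sub>R u31 x + 0 *\<^sub>R u1 x) + (F 2 x *\<^sub>R u32 x + 0 *\<^sub>R u2 x)) 3"
    unfolding c_eq by (intro has_partial_add has_partial_scaleR pu13 F_inv)
  \<comment> \<open>\<open>f1'\<close> and \<open>f2'\<close> are the derivatives of
    \<open>F j x * ((\<i> * u x) \<bullet> b x)\<close> along axes 1 and 2, and \<open>f3'\<close>
    is that of \<open>(\<i> * u x) \<bullet> c x\<close> along axis 3. Each integrates to zero, and
    in \<open>f1' + f2' - f3'\<close> the second derivatives of \<open>u\<close> disappear.\<close>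
  define f1' where "f1' x = F 1 x * ((\<i> * u x) \<bullet> (u31 x - \<i> * (a x *\<^sub>R u1 x + a' 1 x *\<^sub>R u x)) + (\<i> * u1 x) \<bullet> b x)
     + F' 1 x * ((\<i> * u x) \<bullet> b x)" for x
  define f2' where "f2' x = F 2 x * ((\<i> * u x) \<bullet> (u32 x - \<i> * (a x *\<^sub>R u2 x + a' 2 x *\<^sub>R u x)) + (\<i> * u2 x) \<bullet> b x)
     + F' 2 x * ((\<i> * u x) \<bullet> b x)" for x
  define f3' where "f3' x = (\<i> * u x) \<bullet> ((F 1 x *\<^sub>R u31 x + 0 *\<^sub>R u1 x) + (F 2 x *\<^sub>R u32 x + 0 *\<^sub>R u2 x)) + (\<i> * u3 x) \<bullet> c x" for x
  have pf1: "has_partial (\<lambda>x. F 1 x * ((\<i> * u x) \<bullet> b x)) f1' 1"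
    unfolding f1'_def by (intro has_partial_mult has_partial_inner mult_i pu pb pF) simp
  have pf2: "has_partial (\<lambda>x. F 2 x * ((\<i> * u x) \<bullet> b x)) f2' 2"
    unfolding f2'_def by (intro has_partial_mult has_partial_inner mult_i pu pb pF) simp
  have pf3: "has_partial (\<lambda>x. (\<i> * u x) \<bullet> c x) f3' 3"
    unfolding f3'_def by (intro has_partial_inner mult_i pu pc)
  have bc: "continuous_on UNIV b" "continuous_on UNIV c"
    unfolding b_eq c_eq by (intro continuous_intros cont)+
  note cont = cont bc
  have cf: "continuous_on UNIV f1'" "continuous_on UNIV f2'" "continuous_on UNIV f3'"
    unfolding f1'_def f2'_def f3'_def by (intro continuous_intros cont)+
  have z: "b x = 0" "c x = 0" "u x = 0" "u1 x = 0" "u2 x = 0" "u3 x = 0" "u31 x = 0" "u32 x = 0" if "R < norm x" for x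
    using that Rall by (auto simp: supported_in_def b_eq c_eq)
  have i1: "(\<integral>x. f1' x \<partial>lborel) = 0"
    by (rule integral_partial_eq_0[OF pf1 _ cf(1), of R]) (auto intro!: continuous_intros cont simp: supported_in_def z)
  have i2: "(\<integral>x. f2' x \<partial>lborel) = 0"
    by (rule integral_partial_eq_0[OF pf2 _ cf(2), of R]) (auto intro!: continuous_intros cont simp: supported_in_def z)
  have i3: "(\<integral>x. f3' x \<partial>lborel) = 0"
    by (rule integral_partial_eq_0[OF pf3 _ cf(3), of R]) (auto intro!: continuous_intros cont simp: supported_in_def z)
  have int: "integrable lborel f1'" "integrable lborel f2'" "integrable lborel f3'"
    by (rule integrable_cs[where R = R], rule cf, simp add: f1'_def f2'_def f3'_def z)+
  show I1: "integrable lborel (\<lambda>x. 2 * rad2 x * h (rad2 x) * k' (rad2 x) * (norm (u x))\<^sup>2)"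
    by (rule integrable_cs[where R = R]) (auto intro!: continuous_intros cont simp: z)
  show I2: "integrable lborel (\<lambda>x. (2 * h (rad2 x) + 2 * rad2 x * h' (rad2 x)) * ((\<i> * u x) \<bullet> b x)
        + 2 * ((\<i> * c x) \<bullet> b x))"
    by (rule integrable_cs[where R = R]) (auto intro!: continuous_intros cont simp: z)
  have pointwise: "(2 * h (rad2 x) + 2 * rad2 x * h' (rad2 x)) * ((\<i> * u x) \<bullet> b x) + 2 * ((\<i> * c x) \<bullet> b x)
     - 2 * rad2 x * h (rad2 x) * k' (rad2 x) * (norm (u x))\<^sup>2 = f1' x + f2' x - f3' x" for x
  proof -
    \<comment> \<open>Fact \<open>1\<close> is the divergence of the field F, fact \<open>2\<close>
      below is F applied to \<open>a\<close>.\<close>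
    have 1: "2 * h (rad2 x) + 2 * rad2 x * h' (rad2 x) = F' 1 x + F' 2 x"
      by (simp add: F'_def rad2_def power2_eq_square algebra_simps)
    have 2: "2 * rad2 x * h (rad2 x) * k' (rad2 x) = F 1 x * a' 1 x + F 2 x * a' 2 x"
      by (simp add: F_def a'_def rad2_def power2_eq_square algebra_simps)
    show ?thesis
      unfolding 1 2 f1'_def f2'_def f3'_def b_eq c_eq cmod_power2
      by (simp add: inner_complex_def power2_eq_square algebra_simps)
  qed
  have "(\<integral>x. (2 * h (rad2 x) + 2 * rad2 x * h' (rad2 x)) * ((\<i> * u x) \<bullet> b x) + 2 * ((\<i> * c x) \<bullet> b x)
     - 2 * rad2 x * h (rad2 x) * k' (rad2 x) * (norm (u x))\<^sup>2 \<partial>lborel) = 0"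
    unfolding pointwise using i1 i2 i3 int by simp
  then show "(\<integral>x. 2 * rad2 x * h (rad2 x) * k' (rad2 x) * (norm (u x))\<^sup>2 \<partial>lborel)
      = (\<integral>x. (2 * h (rad2 x) + 2 * rad2 x * h' (rad2 x)) * ((\<i> * u x) \<bullet> b x)
        + 2 * ((\<i> * c x) \<bullet> b x) \<partial>lborel)"
    using Bochner_Integration.integral_diff[OF I2 I1] by simp
qed

text \<open>The divergence of the field \<open>F\<close> times the squared modulus of
  \<open>u\<close> integrates to zero; here F = h(r^2)(x, y), and \<open>c\<close> is F applied to
  \<open>u\<close>.\<close>

lemma radial_divergence_identity:
  assumes u: "test_function u"
    and h: "\<And>s. 0 \<le> s \<Longrightarrow> (h has_real_derivative h' s) (at s)" "continuous_on {0..} h'"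
  defines "c \<equiv> \<lambda>x. h (rad2 x) *\<^sub>R (x $ 1 *\<^sub>R partial_deriv 1 u x + x $ 2 *\<^sub>R partial_deriv 2 u x)"
  shows "integrable lborel (\<lambda>x. (2 * h (rad2 x) + 2 * rad2 x * h' (rad2 x)) * (norm (u x))\<^sup>2)"
    and "integrable lborel (\<lambda>x. u x \<bullet> c x)"
    and "(\<integral>x. (2 * h (rad2 x) + 2 * rad2 x * h' (rad2 x)) * (norm (u x))\<^sup>2 \<partial>lborel)
      = - 2 * (\<integral>x. u x \<bullet> c x \<partial>lborel)"
proof -
  define u1 u2 where "u1 = partial_deriv 1 u" and "u2 = partial_deriv 2 u"
  have t1: "test_function u1" "test_function u2"
    unfolding u1_def u2_def by (intro test_function_partial_deriv u)+
  note pu = test_function_has_partial[OF u, of 1, folded u1_def]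
    test_function_has_partial[OF u, of 2, folded u2_def]
  obtain R where R: "supported_in R u" using test_function_supported[OF u] by metis
  define F where "F j x = x $ j * h (rad2 x)" for j :: 3 and x
  define F' where "F' j x = x $ j * (2 * x $ j * h' (rad2 x)) + 1 * h (rad2 x)" for j :: 3 and x
  have pF: "has_partial (F j) (F' j) j" if "j \<noteq> 3" for j
    unfolding F_def[abs_def] F'_def[abs_def] using that h(1) by (rule has_partial_radial_field)
  have hcont: "continuous_on UNIV (\<lambda>x. h (rad2 x))" "continuous_on UNIV (\<lambda>x. h' (rad2 x))"
    using continuous_on_derivative_nonneg[OF h(1)] h(2) by (auto intro: continuous_on_radial)
  have cF: "continuous_on UNIV (F j)" "continuous_on UNIV (F' j)" for j
    unfolding F_def[abs_def] F'_def[abs_def] by (intro continuous_intros hcont)+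
  note cont = u[THEN test_function_continuous] t1[THEN test_function_continuous] hcont cF continuous_on_rad2
  have c_eq: "c = (\<lambda>x. F 1 x *\<^sub>R u1 x + F 2 x *\<^sub>R u2 x)"
    by (simp add: c_def u1_def u2_def F_def fun_eq_iff algebra_simps)
  have cc: "continuous_on UNIV c"
    unfolding c_eq by (intro continuous_intros cont)
  have z: "u x = 0" if "R < norm x" for x
    using that R by (simp add: supported_in_def)
  define f' where "f' j v x = F j x * (u x \<bullet> v x + v x \<bullet> u x) + F' j x * (u x \<bullet> u x)" for j and v :: "real^3 \<Rightarrow> complex" and x
  have pf: "has_partial (\<lambda>x. F 1 x * (u x \<bullet> u x)) (f' 1 u1) 1" "has_partial (\<lambda>x. F 2 x * (u x \<bullet> u x)) (f' 2 u2) 2"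
    unfolding f'_def by (intro has_partial_mult has_partial_inner pu pF; simp)+
  have cf: "continuous_on UNIV (f' 1 u1)" "continuous_on UNIV (f' 2 u2)"
    unfolding f'_def by (intro continuous_intros cont)+
  have i: "(\<integral>x. f' 1 u1 x \<partial>lborel) = 0" "(\<integral>x. f' 2 u2 x \<partial>lborel) = 0"
    by (rule integral_partial_eq_0[OF pf(1) _ cf(1), of R] integral_partial_eq_0[OF pf(2) _ cf(2), of R];
      auto intro!: continuous_intros cont simp: supported_in_def z)+
  have int: "integrable lborel (f' 1 u1)" "integrable lborel (f' 2 u2)"
    by (rule integrable_cs[where R = R], rule cf, simp add: f'_def z)+
  show I1: "integrable lborel (\<lambda>x. (2 * h (rad2 x) + 2 * rad2 x * h' (rad2 x)) * (norm (u x))\<^sup>2)"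
    by (rule integrable_cs[where R = R]) (auto intro!: continuous_intros cont simp: z)
  show I2: "integrable lborel (\<lambda>x. u x \<bullet> c x)"
    by (rule integrable_cs[where R = R]) (auto intro!: continuous_intros cont cc simp: z)
  have pointwise: "(2 * h (rad2 x) + 2 * rad2 x * h' (rad2 x)) * (norm (u x))\<^sup>2 + 2 * (u x \<bullet> c x)
      = f' 1 u1 x + f' 2 u2 x" for x
  proof -
    have 1: "2 * h (rad2 x) + 2 * rad2 x * h' (rad2 x) = F' 1 x + F' 2 x"
      by (simp add: F'_def rad2_def power2_eq_square algebra_simps)
    show ?thesis
      unfolding 1 f'_def c_eq
      by (simp add: power2_norm_eq_inner inner_add_right inner_commute algebra_simps)
  qed
  have "(\<integral>x. (2 * h (rad2 x) + 2 * rad2 x * h' (rad2 x)) * (norm (u x))\<^sup>2 + 2 * (u x \<bullet> c x) \<partial>lborel) = 0"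
    unfolding pointwise using i int by simp
  then show "(\<integral>x. (2 * h (rad2 x) + 2 * rad2 x * h' (rad2 x)) * (norm (u x))\<^sup>2 \<partial>lborel)
      = - 2 * (\<integral>x. u x \<bullet> c x \<partial>lborel)"
    using I1 I2 by simp
qed

section \<open>A Hardy inequality\<close>

definition bracket :: "real^3 \<Rightarrow> real" where
  "bracket x = sqrt (1 + rad2 x)"

definition energy :: "(real^3 \<Rightarrow> complex) \<Rightarrow> real^3 \<Rightarrow> real" where
  "energy u x = (norm (partial_deriv 1 u x))\<^sup>2 + (norm (partial_deriv 2 u x))\<^sup>2
     + (norm (partial_deriv 3 u x - \<i> * (ln_rad x *\<^sub>R u x)))\<^sup>2"

abbreviation total_energy :: "(real^3 \<Rightarrow> complex) \<Rightarrow> real" where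
  "total_energy u \<equiv> \<integral>x. energy u x \<partial>lborel"

lemma bracket_ge_1: "1 \<le> bracket x"
  by (simp add: bracket_def)

lemma continuous_on_bracket [continuous_intros]: "continuous_on S bracket"
  unfolding bracket_def by (intro continuous_intros)

lemma borel_measurable_bracket [measurable]: "bracket \<in> borel_measurable borel"
  by (intro borel_measurable_continuous_onI continuous_intros)

lemma energy_nonneg: "0 \<le> energy u x"
  by (simp add: energy_def)

text \<open>The third component in \<open>energy\<close> is the magnetic derivative divided by -i, a
  factor of modulus one.\<close>

lemma energy_eq: "(\<Sum>j\<in>UNIV. magnetic_deriv A_log j u x \<bullet> magnetic_deriv A_log j u x) = energy u x"
proof -
  have "norm (magnetic_deriv A_log 3 u x) = norm (- \<i> * (partial_deriv 3 u x - \<i> * (ln_rad x *\<^sub>R u x)))"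
    by (simp add: magnetic_deriv_def A_log_nth scaleR_conv_of_real algebra_simps)
  also have "\<dots> = norm (partial_deriv 3 u x - \<i> * (ln_rad x *\<^sub>R u x))"
    by (simp only: norm_mult) simp
  finally show ?thesis
    by (simp add: sum_3 energy_def dot_square_norm magnetic_deriv_def[of _ 1] magnetic_deriv_def[of _ 2]
        A_log_nth norm_mult)
qed

lemma integrable_energy: "test_function u \<Longrightarrow> integrable lborel (energy u)"
  using magnetic_laplacian_form(1)[of u u] by (simp add: energy_eq)

lemma integral_magnetic_laplacian:
  "test_function u \<Longrightarrow> (\<integral>x. magnetic_laplacian A_log u x \<bullet> u x \<partial>lborel) = total_energy u"
  using magnetic_laplacian_form(2)[of u u] by (simp add: energy_eq)

lemma AE_off_axis: "AE x in lborel. rad2 x \<noteq> 0"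
proof -
  have "{x::real^3. x $ 1 = 0} \<in> null_sets lebesgue"
    using negligible_standard_hyperplane_cart[of 1] by (simp add: negligible_iff_null_sets)
  moreover have "closed {x::real^3. x $ 1 = 0}"
    by (intro closed_Collect_eq continuous_intros)
  ultimately have "{x::real^3. x $ 1 = 0} \<in> null_sets lborel"
    by (simp add: null_sets_def borel_closed)
  then show ?thesis
    by (rule AE_I') (auto simp: rad2_def sum_power2_eq_zero_iff add_nonneg_eq_0_iff)
qed

lemma radial_deriv_norm:
  "(norm (x $ 1 *\<^sub>R v + x $ 2 *\<^sub>R w))\<^sup>2 \<le> rad2 x * ((norm v)\<^sup>2 + (norm w)\<^sup>2)"
  for v w :: complex and x :: "real^3"
proof -
  have "norm (x $ 1 *\<^sub>R v + x $ 2 *\<^sub>R w) \<le> \<bar>x $ 1\<bar> * norm v + \<bar>x $ 2\<bar> * norm w"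
    by (rule order_trans[OF norm_triangle_ineq]) simp
  then have "(norm (x $ 1 *\<^sub>R v + x $ 2 *\<^sub>R w))\<^sup>2 \<le> (\<bar>x $ 1\<bar> * norm v + \<bar>x $ 2\<bar> * norm w)\<^sup>2"
    by (intro power_mono) auto
  also have "\<dots> \<le> rad2 x * ((norm v)\<^sup>2 + (norm w)\<^sup>2)"
    using zero_le_power2[of "\<bar>x $ 1\<bar> * norm w - \<bar>x $ 2\<bar> * norm v"]
    by (simp add: rad2_def power2_eq_square algebra_simps)
  finally show ?thesis .
qed

lemma inner_le_squares:
  fixes v w :: complex
  assumes "0 < t"
  shows "2 * (v \<bullet> w) \<le> t * (norm v)\<^sup>2 + (norm w)\<^sup>2 / t"
proof -
  have "v \<bullet> w \<le> norm v * norm w"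
    by (rule norm_cauchy_schwarz)
  moreover have "2 * (norm v * norm w) \<le> t * (norm v)\<^sup>2 + (norm w)\<^sup>2 / t"
  proof -
    have "0 \<le> (t * norm v - norm w)\<^sup>2 / t"
      using assms by simp
    also have "\<dots> = t * (norm v)\<^sup>2 + (norm w)\<^sup>2 / t - 2 * (norm v * norm w)"
      using assms by (simp add: power2_eq_square field_simps)
    finally show ?thesis by simp
  qed
  ultimately show ?thesis by linarith
qed

lemma integrable_inverse_bracket:
  assumes "test_function u"
  shows "integrable lborel (\<lambda>x. (norm (u x))\<^sup>2 / bracket x)"
proof -
  obtain R where "supported_in R u" using test_function_supported[OF assms] by metis
  moreover have "bracket x \<noteq> 0" for x using bracket_ge_1[of x] by linarith
  ultimately show ?thesis
    using test_function_continuous[OF assms]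
    by (intro integrable_cs[where R = R] continuous_intros) (auto simp: supported_in_def)
qed

lemma integrable_partial_norm2:
  assumes "test_function u"
  shows "integrable lborel (\<lambda>x. (norm (u x))\<^sup>2)"
proof -
  obtain R where "supported_in R u" using test_function_supported[OF assms] by metis
  then show ?thesis
    using test_function_continuous[OF assms]
    by (intro integrable_cs[where R = R] continuous_intros) (auto simp: supported_in_def)
qed

text \<open>The commutator identity for the smooth potential ln(r^2 + \<epsilon>)/2, whose radial
  derivative produces the factor r^2/(r^2 + \<epsilon>). Half of the Hardy weight stays on the right
  and is absorbed once \<epsilon> has gone to 0. The 3 in front of \<open>b\<close> is 2 from the
  divergence term plus 1 from the term with \<open>c\<close>.\<close>

lemma regularized_hardy:
  assumes u: "test_function u" and \<epsilon>: "0 < \<epsilon>"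
  defines "b \<equiv> \<lambda>x. partial_deriv 3 u x - \<i> * ((ln (rad2 x + \<epsilon>) / 2) *\<^sub>R u x)"
  shows "(\<integral>x. rad2 x / (rad2 x + \<epsilon>) * ((norm (u x))\<^sup>2 / bracket x) \<partial>lborel)
    \<le> (\<integral>x. (norm (u x))\<^sup>2 / bracket x / 2 + (norm (partial_deriv 1 u x))\<^sup>2
        + (norm (partial_deriv 2 u x))\<^sup>2 + 3 * (norm (b x))\<^sup>2 \<partial>lborel)"
proof -
  \<comment> \<open>This is 1/<r> in terms of the square of r: the field F has length at most 1 and
    divergence between 0 and 2/<r>.\<close>
  define h where "h s = 1 / sqrt (1 + s)" for s :: real
  define h' where "h' s = - 1 / (2 * (1 + s) * sqrt (1 + s))" for s :: real
  define k where "k s = ln (s + \<epsilon>) / 2" for s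
  define k' where "k' s = 1 / (2 * (s + \<epsilon>))" for s
  have h: "(h has_real_derivative h' s) (at s)" if "0 \<le> s" for s
    unfolding h_def[abs_def] h'_def using that
    by (auto intro!: derivative_eq_intros simp: field_simps)
  have k: "(k has_real_derivative k' s) (at s)" if "0 \<le> s" for s
    unfolding k_def[abs_def] k'_def using that \<epsilon>
    by (auto intro!: derivative_eq_intros simp: field_simps)
  have h'c: "continuous_on {0..} h'"
    unfolding h'_def[abs_def] by (intro continuous_intros) (auto simp: add_nonneg_eq_0_iff)
  have k'c: "continuous_on {0..} k'"
    unfolding k'_def[abs_def] using \<epsilon> by (intro continuous_intros) (auto simp: add_nonneg_eq_0_iff)
  define c where "c x = h (rad2 x) *\<^sub>R (x $ 1 *\<^sub>R partial_deriv 1 u x + x $ 2 *\<^sub>R partial_deriv 2 u x)" for x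
  have b_eq: "b = (\<lambda>x. partial_deriv 3 u x - \<i> * (k (rad2 x) *\<^sub>R u x))"
    by (simp add: b_def k_def)
  have b_pt: "b x = partial_deriv 3 u x - \<i> * (k (rad2 x) *\<^sub>R u x)" for x
    by (simp add: b_eq)
  note id = radial_commutator_identity[OF u h h'c k k'c, folded b_pt c_def]
  obtain R where R: "supported_in R u" using test_function_supported[OF u] by metis
  have bc: "continuous_on UNIV b" and bR: "supported_in R b"
  proof -
    have "continuous_on UNIV (\<lambda>x. k (rad2 x))"
      using continuous_on_derivative_nonneg[OF k] by (intro continuous_on_radial) auto
    then show "continuous_on UNIV b"
      unfolding b_eq using test_function_continuous[OF test_function_partial_deriv[OF u]] test_function_continuous[OF u]
      by (intro continuous_intros)
    show "supported_in R b"
      using R supported_in_partial[OF test_function_has_partial[OF u] R, of 3]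
      by (auto simp: supported_in_def b_eq)
  qed
  have ib: "integrable lborel (\<lambda>x. (norm (b x))\<^sup>2)"
    using bc bR by (intro integrable_cs[where R = R] continuous_intros) (auto simp: supported_in_def)
  have "(\<integral>x. rad2 x / (rad2 x + \<epsilon>) * ((norm (u x))\<^sup>2 / bracket x) \<partial>lborel)
      = (\<integral>x. 2 * rad2 x * h (rad2 x) * k' (rad2 x) * (norm (u x))\<^sup>2 \<partial>lborel)"
  proof (intro Bochner_Integration.integral_cong refl)
    fix x
    have "2 * s * (1 / q) * (1 / (2 * d)) * n = s / d * (n / q)" for s q d n :: real
      by (simp add: divide_simps)
    then show "rad2 x / (rad2 x + \<epsilon>) * ((norm (u x))\<^sup>2 / bracket x)
      = 2 * rad2 x * h (rad2 x) * k' (rad2 x) * (norm (u x))\<^sup>2"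
      unfolding h_def k'_def bracket_def by (rule sym)
  qed
  also have "\<dots> = (\<integral>x. (2 * h (rad2 x) + 2 * rad2 x * h' (rad2 x)) * ((\<i> * u x) \<bullet> b x) + 2 * ((\<i> * c x) \<bullet> b x) \<partial>lborel)"
    by (rule id(3))
  also have "\<dots> \<le> (\<integral>x. (norm (u x))\<^sup>2 / bracket x / 2 + (norm (partial_deriv 1 u x))\<^sup>2
        + (norm (partial_deriv 2 u x))\<^sup>2 + 3 * (norm (b x))\<^sup>2 \<partial>lborel)"
  proof (rule integral_mono)
    show "integrable lborel (\<lambda>x. (2 * h (rad2 x) + 2 * rad2 x * h' (rad2 x)) * ((\<i> * u x) \<bullet> b x) + 2 * ((\<i> * c x) \<bullet> b x))"
      by (rule id(2))
    show "integrable lborel (\<lambda>x. (norm (u x))\<^sup>2 / bracket x / 2 + (norm (partial_deriv 1 u x))\<^sup>2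
        + (norm (partial_deriv 2 u x))\<^sup>2 + 3 * (norm (b x))\<^sup>2)"
      by (intro Bochner_Integration.integrable_add integrable_mult_right integrable_divide ib integrable_inverse_bracket
          integrable_partial_norm2 test_function_partial_deriv u)
  next
    fix x
    define s where "s = rad2 x"
    define H where "H = h s"
    have s: "0 \<le> s" by (simp add: s_def)
    have H: "0 < H" "H \<le> 1" "H\<^sup>2 * s \<le> 1"
      using s by (auto simp: H_def h_def power_divide)
    have div_eq: "2 * h s + 2 * s * h' s = H * ((2 + s) / (1 + s))"
      using s by (simp add: H_def h_def h'_def divide_simps) (simp add: algebra_simps)
    have D: "0 \<le> H * ((2 + s) / (1 + s))" "H * ((2 + s) / (1 + s)) \<le> 2 * H"
      using s H by (auto simp: divide_simps)
    have "(2 * h s + 2 * s * h' s) * ((\<i> * u x) \<bullet> b x) \<le> (2 * H) * (norm (u x) * norm (b x))"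
    proof -
      have "(\<i> * u x) \<bullet> b x \<le> norm (\<i> * u x) * norm (b x)"
        by (rule norm_cauchy_schwarz)
      then have *: "(\<i> * u x) \<bullet> b x \<le> norm (u x) * norm (b x)"
        by (simp add: norm_mult)
      have "(2 * h s + 2 * s * h' s) * ((\<i> * u x) \<bullet> b x) \<le> (H * ((2 + s) / (1 + s))) * (norm (u x) * norm (b x))"
        unfolding div_eq by (rule mult_left_mono[OF * D(1)])
      also have "\<dots> \<le> (2 * H) * (norm (u x) * norm (b x))"
        by (rule mult_right_mono[OF D(2)]) simp
      finally show ?thesis .
    qed
    also have "\<dots> \<le> H * ((norm (u x))\<^sup>2 / 2 + 2 * (norm (b x))\<^sup>2)"
    proof -
      \<comment> \<open>The weights are unequal so that the squared modulus of \<open>u\<close>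
        receives a coefficient below 1.\<close>
      have "2 * (norm (u x) * norm (b x)) \<le> (norm (u x))\<^sup>2 / 2 + 2 * (norm (b x))\<^sup>2"
        using zero_le_power2[of "norm (u x) - 2 * norm (b x)"] by (simp add: power2_diff power_mult_distrib)
      then show ?thesis
        using H(1) mult_left_mono[of "2 * (norm (u x) * norm (b x))" "(norm (u x))\<^sup>2 / 2 + 2 * (norm (b x))\<^sup>2" H]
        by (simp add: mult_ac)
    qed
    also have "\<dots> \<le> (norm (u x))\<^sup>2 / bracket x / 2 + 2 * (norm (b x))\<^sup>2"
    proof -
      have "H * (2 * (norm (b x))\<^sup>2) \<le> 1 * (2 * (norm (b x))\<^sup>2)"
        by (rule mult_right_mono[OF H(2)]) simp
      moreover have "H * ((norm (u x))\<^sup>2 / 2) = (norm (u x))\<^sup>2 / bracket x / 2"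
        by (simp add: H_def h_def bracket_def s_def)
      ultimately show ?thesis by (simp add: distrib_left)
    qed
    finally have 1: "(2 * h s + 2 * s * h' s) * ((\<i> * u x) \<bullet> b x) \<le> (norm (u x))\<^sup>2 / bracket x / 2 + 2 * (norm (b x))\<^sup>2" .
    have "2 * ((\<i> * c x) \<bullet> b x) \<le> 1 * (norm (\<i> * c x))\<^sup>2 + (norm (b x))\<^sup>2 / 1"
      by (rule inner_le_squares) simp
    then have 2: "2 * ((\<i> * c x) \<bullet> b x) \<le> (norm (c x))\<^sup>2 + (norm (b x))\<^sup>2"
      by (simp add: norm_mult)
    have "(norm (c x))\<^sup>2 = H\<^sup>2 * (norm (x $ 1 *\<^sub>R partial_deriv 1 u x + x $ 2 *\<^sub>R partial_deriv 2 u x))\<^sup>2"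
      by (simp add: c_def H_def s_def power_mult_distrib)
    also have "\<dots> \<le> H\<^sup>2 * (s * ((norm (partial_deriv 1 u x))\<^sup>2 + (norm (partial_deriv 2 u x))\<^sup>2))"
      unfolding s_def by (intro mult_left_mono radial_deriv_norm) simp
    also have "\<dots> \<le> 1 * ((norm (partial_deriv 1 u x))\<^sup>2 + (norm (partial_deriv 2 u x))\<^sup>2)"
      unfolding mult.assoc[symmetric] by (intro mult_right_mono H) simp
    finally have 3: "(norm (c x))\<^sup>2 \<le> (norm (partial_deriv 1 u x))\<^sup>2 + (norm (partial_deriv 2 u x))\<^sup>2"
      by simp
    show "(2 * h (rad2 x) + 2 * rad2 x * h' (rad2 x)) * ((\<i> * u x) \<bullet> b x) + 2 * ((\<i> * c x) \<bullet> b x)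
      \<le> (norm (u x))\<^sup>2 / bracket x / 2 + (norm (partial_deriv 1 u x))\<^sup>2
        + (norm (partial_deriv 2 u x))\<^sup>2 + 3 * (norm (b x))\<^sup>2"
      using 1 2 3 by (simp add: s_def)
  qed
  finally show ?thesis .
qed

text \<open>The regularized logarithm lies between log r and its value for \<epsilon> = 1, so its
  square is at most the larger of their squares. This yields a dominating function independent of
  \<epsilon>.\<close>

lemma ln_regularized_power2_le:
  assumes "rad2 x \<noteq> 0" "0 < \<epsilon>" "\<epsilon> \<le> 1"
  shows "(ln (rad2 x + \<epsilon>) / 2)\<^sup>2 \<le> (ln_rad x)\<^sup>2 + (ln (rad2 x + 1) / 2)\<^sup>2"
proof -
  define s where "s = rad2 x"
  have s: "0 < s" using assms(1) rad2_nonneg[of x] by (simp add: s_def less_le)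
  have lr: "ln_rad x = ln s / 2" using s by (simp add: ln_rad_def s_def ln_sqrt)
  have "ln s \<le> ln (s + \<epsilon>)" "ln (s + \<epsilon>) \<le> ln (s + 1)"
    using s assms by auto
  then have "(ln (s + \<epsilon>) / 2)\<^sup>2 \<le> (ln s / 2)\<^sup>2 \<or> (ln (s + \<epsilon>) / 2)\<^sup>2 \<le> (ln (s + 1) / 2)\<^sup>2"
    by (simp add: abs_le_square_iff[symmetric]) linarith
  then show ?thesis
    unfolding lr s_def[symmetric] by (smt (verit) zero_le_power2)
qed

text \<open>The limit \<epsilon> to 0 of the regularized inequality, taken off the axis, a null
  set.\<close>

lemma hardy_inequality:
  assumes u: "test_function u"
  shows "(\<integral>x. (norm (u x))\<^sup>2 / bracket x \<partial>lborel) \<le> 6 * total_energy u"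
proof -
  define \<epsilon> where "\<epsilon> n = 1 / real (Suc n)" for n
  have \<epsilon>: "0 < \<epsilon> n" "\<epsilon> n \<le> 1" for n by (auto simp: \<epsilon>_def)
  have \<epsilon>0: "\<epsilon> \<longlonglongrightarrow> 0"
    unfolding \<epsilon>_def[abs_def] using LIMSEQ_inverse_real_of_nat by (simp add: inverse_eq_divide)
  define u1 u2 u3 where "u1 = partial_deriv 1 u" and "u2 = partial_deriv 2 u" and "u3 = partial_deriv 3 u"
  have t: "test_function u1" "test_function u2" "test_function u3"
    unfolding u1_def u2_def u3_def by (intro test_function_partial_deriv u)+
  note cont = u[THEN test_function_continuous] t[THEN test_function_continuous]
  have [measurable]: "u \<in> borel_measurable borel" "u1 \<in> borel_measurable borel"
    "u2 \<in> borel_measurable borel" "u3 \<in> borel_measurable borel"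
    by (intro borel_measurable_continuous_onI cont)+
  obtain R where R: "supported_in R u" using test_function_supported[OF u] by metis
  define b where "b n x = u3 x - \<i> * ((ln (rad2 x + \<epsilon> n) / 2) *\<^sub>R u x)" for n x
  define b0 where "b0 x = u3 x - \<i> * (ln_rad x *\<^sub>R u x)" for x
  define g where "g x = (norm (u x))\<^sup>2 / bracket x" for x
  have gi: "integrable lborel g"
    unfolding g_def[abs_def] using u by (rule integrable_inverse_bracket)
  have [measurable]: "g \<in> borel_measurable borel" "b n \<in> borel_measurable borel" "b0 \<in> borel_measurable borel" for n
    unfolding g_def[abs_def] b_def[abs_def] b0_def[abs_def] by measurable
  have b_le: "(norm (u3 x - \<i> * (l *\<^sub>R u x)))\<^sup>2 \<le> 2 * (norm (u3 x))\<^sup>2 + 2 * (l\<^sup>2 * (norm (u x))\<^sup>2)" for l x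
  proof -
    have "norm (u3 x - \<i> * (l *\<^sub>R u x)) \<le> norm (u3 x) + \<bar>l\<bar> * norm (u x)"
      by (rule order_trans[OF norm_triangle_ineq4]) (simp add: norm_mult)
    then have "(norm (u3 x - \<i> * (l *\<^sub>R u x)))\<^sup>2 \<le> (norm (u3 x) + \<bar>l\<bar> * norm (u x))\<^sup>2"
      by (intro power_mono) auto
    also have "\<dots> \<le> 2 * (norm (u3 x))\<^sup>2 + 2 * (l\<^sup>2 * (norm (u x))\<^sup>2)"
      using zero_le_power2[of "norm (u3 x) - \<bar>l\<bar> * norm (u x)"]
      by (simp add: power2_sum power2_diff power_mult_distrib)
    finally show ?thesis .
  qed
  \<comment> \<open>Integrable because the square of log r is locally integrable and
    \<open>u\<close> vanishes outside a ball.\<close>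
  define dom where "dom x = 2 * (norm (u3 x))\<^sup>2
    + 2 * ((ln_rad x)\<^sup>2 * (norm (u x))\<^sup>2 + (ln (rad2 x + 1) / 2)\<^sup>2 * (norm (u x))\<^sup>2)" for x
  have domi: "integrable lborel dom"
  proof -
    have "integrable lborel (\<lambda>x. (ln_rad x)\<^sup>2 * (norm (u x))\<^sup>2)"
      using locally_integrable_ln_rad_power2 cont R
      by (intro integrable_locally_integrable_mult[where R = R] continuous_intros) (auto simp: supported_in_def)
    moreover have "integrable lborel (\<lambda>x. (ln (rad2 x + 1) / 2)\<^sup>2 * (norm (u x))\<^sup>2)"
      using cont R
      by (intro integrable_cs[where R = R] continuous_intros) (auto simp: supported_in_def add_nonneg_eq_0_iff)
    ultimately show ?thesis
      unfolding dom_def[abs_def]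
      by (intro Bochner_Integration.integrable_add integrable_mult_right integrable_partial_norm2 t)
  qed
  have lim_b: "(\<lambda>n. \<integral>x. (norm (b n x))\<^sup>2 \<partial>lborel) \<longlonglongrightarrow> (\<integral>x. (norm (b0 x))\<^sup>2 \<partial>lborel)"
  proof (rule integral_dominated_convergence[OF _ _ domi])
    show "AE x in lborel. (\<lambda>n. (norm (b n x))\<^sup>2) \<longlonglongrightarrow> (norm (b0 x))\<^sup>2"
      using AE_off_axis
    proof eventually_elim
      fix x assume x: "rad2 x \<noteq> 0"
      then have s: "0 < rad2 x" using rad2_nonneg[of x] by (simp add: less_le)
      then have "(\<lambda>n. ln (rad2 x + \<epsilon> n) / 2) \<longlonglongrightarrow> ln (rad2 x + 0) / 2"
        by (intro tendsto_intros \<epsilon>0) auto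
      moreover have "ln (rad2 x + 0) / 2 = ln_rad x"
        using s by (simp add: ln_rad_def ln_sqrt)
      ultimately show "(\<lambda>n. (norm (b n x))\<^sup>2) \<longlonglongrightarrow> (norm (b0 x))\<^sup>2"
        unfolding b_def b0_def by (intro tendsto_intros) simp
    qed
    show "AE x in lborel. norm ((norm (b n x))\<^sup>2) \<le> dom x" for n
      using AE_off_axis
    proof eventually_elim
      fix x assume x: "rad2 x \<noteq> 0"
      have "(norm (b n x))\<^sup>2 \<le> 2 * (norm (u3 x))\<^sup>2 + 2 * ((ln (rad2 x + \<epsilon> n) / 2)\<^sup>2 * (norm (u x))\<^sup>2)"
        unfolding b_def by (rule b_le)
      also have "\<dots> \<le> dom x"
        using mult_right_mono[OF ln_regularized_power2_le[OF x \<epsilon>(1)[of n] \<epsilon>(2)[of n]], of "(norm (u x))\<^sup>2"]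
        by (simp add: dom_def distrib_right)
      finally show "norm ((norm (b n x))\<^sup>2) \<le> dom x" by simp
    qed
  qed measurable
  have lim_l: "(\<lambda>n. \<integral>x. rad2 x / (rad2 x + \<epsilon> n) * g x \<partial>lborel) \<longlonglongrightarrow> (\<integral>x. g x \<partial>lborel)"
  proof (rule integral_dominated_convergence[OF _ _ gi])
    show "AE x in lborel. (\<lambda>n. rad2 x / (rad2 x + \<epsilon> n) * g x) \<longlonglongrightarrow> g x"
      using AE_off_axis
    proof eventually_elim
      fix x assume "rad2 x \<noteq> 0"
      then have "(\<lambda>n. rad2 x / (rad2 x + \<epsilon> n) * g x) \<longlonglongrightarrow> rad2 x / (rad2 x + 0) * g x"
        by (intro tendsto_intros \<epsilon>0) auto
      then show "(\<lambda>n. rad2 x / (rad2 x + \<epsilon> n) * g x) \<longlonglongrightarrow> g x"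
        using \<open>rad2 x \<noteq> 0\<close> by simp
    qed
    show "AE x in lborel. norm (rad2 x / (rad2 x + \<epsilon> n) * g x) \<le> g x" for n
    proof (rule AE_I2)
      fix x
      have "0 \<le> g x" using bracket_ge_1[of x] by (simp add: g_def)
      moreover have "rad2 x / (rad2 x + \<epsilon> n) \<le> 1" "0 \<le> rad2 x / (rad2 x + \<epsilon> n)"
        using \<epsilon>(1)[of n] add_nonneg_pos[OF rad2_nonneg[of x] \<epsilon>(1)[of n]] by (auto simp: divide_le_eq_1)
      ultimately show "norm (rad2 x / (rad2 x + \<epsilon> n) * g x) \<le> g x"
        by (simp only: real_norm_def abs_mult abs_of_nonneg mult_left_le_one_le)
    qed
  qed measurable
  have b0i: "integrable lborel (\<lambda>x. (norm (b0 x))\<^sup>2)"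
  proof -
    have "integrable lborel (\<lambda>x. energy u x - (norm (u1 x))\<^sup>2 - (norm (u2 x))\<^sup>2)"
      by (intro Bochner_Integration.integrable_diff integrable_energy integrable_partial_norm2 u t)
    then show ?thesis
      by (simp add: energy_def b0_def u1_def u2_def u3_def)
  qed
  have bi: "integrable lborel (\<lambda>x. (norm (b n x))\<^sup>2)" for n
  proof (rule integrable_cs[where R = R])
    show "continuous_on UNIV (\<lambda>x. (norm (b n x))\<^sup>2)"
      unfolding b_def using \<epsilon>[of n]
      by (intro continuous_intros cont) (auto simp: add_nonneg_eq_0_iff less_imp_le)
    show "(norm (b n x))\<^sup>2 = 0" if "R < norm x" for x
      using that R supported_in_partial[OF test_function_has_partial[OF u] R, of 3]
      by (auto simp: supported_in_def b_def u3_def)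
  qed
  have "(\<integral>x. rad2 x / (rad2 x + \<epsilon> n) * g x \<partial>lborel)
    \<le> (\<integral>x. g x \<partial>lborel) / 2 + (\<integral>x. (norm (u1 x))\<^sup>2 \<partial>lborel) + (\<integral>x. (norm (u2 x))\<^sup>2 \<partial>lborel)
      + 3 * (\<integral>x. (norm (b n x))\<^sup>2 \<partial>lborel)" for n
  proof -
    have "(\<integral>x. rad2 x / (rad2 x + \<epsilon> n) * g x \<partial>lborel)
      \<le> (\<integral>x. g x / 2 + (norm (u1 x))\<^sup>2 + (norm (u2 x))\<^sup>2 + 3 * (norm (b n x))\<^sup>2 \<partial>lborel)"
      using regularized_hardy[OF u \<epsilon>(1)[of n]]
      unfolding g_def[symmetric] b_def u1_def u2_def u3_def .
    also have "\<dots> = (\<integral>x. g x \<partial>lborel) / 2 + (\<integral>x. (norm (u1 x))\<^sup>2 \<partial>lborel) + (\<integral>x. (norm (u2 x))\<^sup>2 \<partial>lborel)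
      + 3 * (\<integral>x. (norm (b n x))\<^sup>2 \<partial>lborel)"
      using gi bi[of n] integrable_partial_norm2[OF t(1)] integrable_partial_norm2[OF t(2)] by simp
    finally show ?thesis .
  qed
  \<comment> \<open>Subtracting the half from the left leaves half the weighted norm, bounded by 3
    times the energy; hence the 6.\<close>
  then have "(\<integral>x. g x \<partial>lborel) \<le> (\<integral>x. g x \<partial>lborel) / 2 + (\<integral>x. (norm (u1 x))\<^sup>2 \<partial>lborel) + (\<integral>x. (norm (u2 x))\<^sup>2 \<partial>lborel)
      + 3 * (\<integral>x. (norm (b0 x))\<^sup>2 \<partial>lborel)"
    by (intro LIMSEQ_le[OF lim_l tendsto_add[OF tendsto_const tendsto_mult[OF tendsto_const lim_b]]]) auto
  moreover have "total_energy u = (\<integral>x. (norm (u1 x))\<^sup>2 \<partial>lborel) + (\<integral>x. (norm (u2 x))\<^sup>2 \<partial>lborel)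
      + (\<integral>x. (norm (b0 x))\<^sup>2 \<partial>lborel)"
    using b0i integrable_partial_norm2[OF t(1)] integrable_partial_norm2[OF t(2)]
    unfolding energy_def b0_def[symmetric] u1_def[symmetric] u2_def[symmetric] u3_def[symmetric] by simp
  moreover have "0 \<le> (\<integral>x. (norm (u1 x))\<^sup>2 \<partial>lborel)" "0 \<le> (\<integral>x. (norm (u2 x))\<^sup>2 \<partial>lborel)"
    by simp_all
  ultimately show ?thesis
    unfolding g_def by argo
qed

text \<open>With the field F = (x,y)/(r^2 + \<delta>^2), the product of 2 \<delta>^2 and the
  divergence of F is the square of 2 \<delta>^2/(r^2 + \<delta>^2), which is at least 1 where r is
  at most \<delta>. The resulting term \<open>u \<bullet> c\<close> is split between the gradient
  and the Hardy weight: 49 = 1 + 8 * 6.\<close>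

lemma thin_cylinder_bound:
  assumes u: "test_function u" and \<delta>: "0 < \<delta>" "\<delta> \<le> 1"
  shows "(\<integral>x. indicator {x. rad2 x \<le> \<delta>\<^sup>2} x * (norm (u x))\<^sup>2 \<partial>lborel) \<le> 49 * \<delta> * total_energy u"
proof -
  define h where "h s = 1 / (s + \<delta>\<^sup>2)" for s
  define h' where "h' s = - 1 / (s + \<delta>\<^sup>2)\<^sup>2" for s
  have pos: "0 < s + \<delta>\<^sup>2" if "0 \<le> s" for s
    using that \<delta> by (simp add: add_nonneg_pos)
  have h: "(h has_real_derivative h' s) (at s)" if "0 \<le> s" for s
    unfolding h_def[abs_def] h'_def using pos[OF that]
    by (auto intro!: derivative_eq_intros simp: power2_eq_square field_simps)
  have h'c: "continuous_on {0..} h'"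
    unfolding h'_def[abs_def] using pos by (intro continuous_intros) (auto simp: less_imp_neq[THEN not_sym])
  define u1 u2 where "u1 = partial_deriv 1 u" and "u2 = partial_deriv 2 u"
  have t: "test_function u1" "test_function u2"
    unfolding u1_def u2_def by (intro test_function_partial_deriv u)+
  have [measurable]: "u \<in> borel_measurable borel"
    by (intro borel_measurable_continuous_onI test_function_continuous u)
  define c where "c x = h (rad2 x) *\<^sub>R (x $ 1 *\<^sub>R u1 x + x $ 2 *\<^sub>R u2 x)" for x
  note id = radial_divergence_identity[OF u h h'c, folded u1_def u2_def, folded c_def]
  have "(\<integral>x. indicator {x. rad2 x \<le> \<delta>\<^sup>2} x * (norm (u x))\<^sup>2 \<partial>lborel)
    \<le> (\<integral>x. 2 * \<delta>\<^sup>2 * ((2 * h (rad2 x) + 2 * rad2 x * h' (rad2 x)) * (norm (u x))\<^sup>2) \<partial>lborel)"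
  proof (rule integral_mono)
    have "{x. rad2 x \<le> \<delta>\<^sup>2} \<in> sets lborel" by measurable
    then have "integrable lborel (\<lambda>x. indicator {x. rad2 x \<le> \<delta>\<^sup>2} x *\<^sub>R (norm (u x))\<^sup>2)"
      by (intro integrable_mult_indicator integrable_partial_norm2 u)
    then show "integrable lborel (\<lambda>x. indicator {x. rad2 x \<le> \<delta>\<^sup>2} x * (norm (u x))\<^sup>2)"
      by simp
    show "integrable lborel (\<lambda>x. 2 * \<delta>\<^sup>2 * ((2 * h (rad2 x) + 2 * rad2 x * h' (rad2 x)) * (norm (u x))\<^sup>2))"
      by (intro integrable_mult_right id)
  next
    fix x
    define s where "s = rad2 x"
    have s: "0 \<le> s" by (simp add: s_def)
    have D: "2 * \<delta>\<^sup>2 * (2 * h s + 2 * s * h' s) = (2 * \<delta>\<^sup>2 / (s + \<delta>\<^sup>2))\<^sup>2"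
      using pos[OF s] by (simp add: h_def h'_def divide_simps power2_eq_square)
    have "indicator {x. rad2 x \<le> \<delta>\<^sup>2} x \<le> (2 * \<delta>\<^sup>2 / (s + \<delta>\<^sup>2))\<^sup>2"
    proof (cases "s \<le> \<delta>\<^sup>2")
      case True
      then have "1 \<le> 2 * \<delta>\<^sup>2 / (s + \<delta>\<^sup>2)"
        using pos[OF s] by simp
      then show ?thesis by (simp add: indicator_def one_le_power)
    next
      case False
      then show ?thesis by (simp add: s_def)
    qed
    then have "indicator {x. rad2 x \<le> \<delta>\<^sup>2} x * (norm (u x))\<^sup>2 \<le> (2 * \<delta>\<^sup>2 / (s + \<delta>\<^sup>2))\<^sup>2 * (norm (u x))\<^sup>2"
      by (rule mult_right_mono) simp
    then show "indicator {x. rad2 x \<le> \<delta>\<^sup>2} x * (norm (u x))\<^sup>2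
      \<le> 2 * \<delta>\<^sup>2 * ((2 * h (rad2 x) + 2 * rad2 x * h' (rad2 x)) * (norm (u x))\<^sup>2)"
      unfolding D[symmetric] unfolding s_def by (simp only: mult.assoc)
  qed
  also have "\<dots> = (\<integral>x. - (4 * \<delta>\<^sup>2) * (u x \<bullet> c x) \<partial>lborel)"
    using id by simp
  also have "\<dots> \<le> (\<integral>x. \<delta> * ((norm (u1 x))\<^sup>2 + (norm (u2 x))\<^sup>2) + 8 * \<delta> * ((norm (u x))\<^sup>2 / bracket x) \<partial>lborel)"
  proof (rule integral_mono)
    show "integrable lborel (\<lambda>x. - (4 * \<delta>\<^sup>2) * (u x \<bullet> c x))"
      by (intro integrable_mult_right id)
    show "integrable lborel (\<lambda>x. \<delta> * ((norm (u1 x))\<^sup>2 + (norm (u2 x))\<^sup>2) + 8 * \<delta> * ((norm (u x))\<^sup>2 / bracket x))"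
      by (intro Bochner_Integration.integrable_add integrable_mult_right integrable_partial_norm2
        integrable_inverse_bracket u t)
  next
    fix x
    define s where "s = rad2 x"
    define v where "v = x $ 1 *\<^sub>R u1 x + x $ 2 *\<^sub>R u2 x"
    have s: "0 \<le> s" by (simp add: s_def)
    have hs: "0 < h s" using pos[OF s] by (simp add: h_def)
    have v: "(norm v)\<^sup>2 \<le> s * ((norm (u1 x))\<^sup>2 + (norm (u2 x))\<^sup>2)"
      unfolding v_def s_def by (rule radial_deriv_norm)
    \<comment> \<open>Cauchy-Schwarz bounds \<open>norm v\<close> by \<open>r * n\<close>; the
      square of \<open>n - 2 * \<delta> * h s * r * norm (u x)\<close>, multiplied by \<delta>, then
      separates gradient and function.\<close>
    have main: "4 * \<delta>\<^sup>2 * h s * (norm (u x) * norm v)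
        \<le> \<delta> * ((norm (u1 x))\<^sup>2 + (norm (u2 x))\<^sup>2) + 4 * \<delta> * (\<delta>\<^sup>2 * (h s)\<^sup>2 * s) * (norm (u x))\<^sup>2"
    proof -
      define n where "n = sqrt ((norm (u1 x))\<^sup>2 + (norm (u2 x))\<^sup>2)"
      have n: "n\<^sup>2 = (norm (u1 x))\<^sup>2 + (norm (u2 x))\<^sup>2" "0 \<le> n" by (simp_all add: n_def)
      define r where "r = sqrt s"
      have r: "r\<^sup>2 = s" "0 \<le> r" using s by (simp_all add: r_def)
      have "norm v \<le> r * n"
        using v n r by (intro power2_le_imp_le[of "norm v"]) (simp_all add: power_mult_distrib)
      then have "4 * \<delta>\<^sup>2 * h s * (norm (u x) * norm v) \<le> 4 * \<delta>\<^sup>2 * h s * (norm (u x) * (r * n))"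
        using hs by (intro mult_left_mono) auto
      also have "\<dots> \<le> \<delta> * n\<^sup>2 + 4 * \<delta> * (\<delta>\<^sup>2 * (h s)\<^sup>2 * r\<^sup>2) * (norm (u x))\<^sup>2"
      proof -
        have "0 \<le> \<delta> * (n - 2 * \<delta> * h s * r * norm (u x))\<^sup>2"
          using \<delta> by simp
        then show ?thesis
          by (simp add: power2_eq_square algebra_simps)
      qed
      finally show ?thesis using n r by simp
    qed
    \<comment> \<open>The remaining coefficient must be dominated by the Hardy weight uniformly in
      \<delta>: for small r the expression is at most 1, for large r it is at most
      \<open>1 / s\<close>.\<close>
    have k: "\<delta>\<^sup>2 * (h s)\<^sup>2 * s \<le> 2 / bracket x"
    proof (cases "s \<le> 1")
      case True
      have "s * \<delta>\<^sup>2 \<le> (s + \<delta>\<^sup>2)\<^sup>2 * 1"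
        using s by (simp add: power2_sum add_increasing)
      then have "\<delta>\<^sup>2 * (h s)\<^sup>2 * s \<le> 1"
        using pos[OF s] by (simp add: h_def power_divide divide_le_eq mult.commute)
      moreover have "bracket x \<le> 2"
        using True unfolding bracket_def s_def[symmetric] by (intro real_le_lsqrt) auto
      then have "1 \<le> 2 / bracket x"
        using bracket_ge_1[of x] by (simp add: le_divide_eq)
      ultimately show ?thesis by linarith
    next
      case False
      have "h s \<le> 1 / s"
        using False by (simp add: h_def frac_le)
      then have "(h s)\<^sup>2 \<le> (1 / s)\<^sup>2"
        using hs by (intro power_mono) auto
      moreover have "\<delta>\<^sup>2 \<le> 1" using \<delta> by (simp add: power_le_one)
      ultimately have "\<delta>\<^sup>2 * (h s)\<^sup>2 * s \<le> 1 * (1 / s)\<^sup>2 * s"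
        using s by (intro mult_right_mono mult_mono) auto
      also have "\<dots> = 1 / s" using False by (simp add: power2_eq_square)
      also have "\<dots> \<le> 2 / bracket x"
      proof -
        have "bracket x \<le> 2 * s"
          unfolding bracket_def s_def[symmetric]
        proof (rule real_le_lsqrt)
          have "1 * 1 \<le> s * s" "1 * s \<le> s * s" using False by (intro mult_mono; simp)+
          then show "1 + s \<le> (2 * s)\<^sup>2" by (simp add: power2_eq_square)
        qed (use s in auto)
        then show ?thesis
          using False bracket_ge_1[of x] by (simp add: field_simps)
      qed
      finally show ?thesis .
    qed
    have "- (4 * \<delta>\<^sup>2) * (u x \<bullet> c x) = 4 * \<delta>\<^sup>2 * h s * (- u x \<bullet> v)"
      by (simp add: c_def v_def s_def)
    also have "\<dots> \<le> 4 * \<delta>\<^sup>2 * h s * (norm (u x) * norm v)"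
      using norm_cauchy_schwarz[of "- u x" v] hs by (intro mult_left_mono) auto
    also note main
    also have "4 * \<delta> * (\<delta>\<^sup>2 * (h s)\<^sup>2 * s) * (norm (u x))\<^sup>2 \<le> 4 * \<delta> * (2 / bracket x) * (norm (u x))\<^sup>2"
      using k \<delta> by (intro mult_right_mono mult_left_mono) auto
    finally show "- (4 * \<delta>\<^sup>2) * (u x \<bullet> c x) \<le> \<delta> * ((norm (u1 x))\<^sup>2 + (norm (u2 x))\<^sup>2) + 8 * \<delta> * ((norm (u x))\<^sup>2 / bracket x)"
      by simp
  qed
  also have "\<dots> = \<delta> * (\<integral>x. (norm (u1 x))\<^sup>2 + (norm (u2 x))\<^sup>2 \<partial>lborel) + 8 * \<delta> * (\<integral>x. (norm (u x))\<^sup>2 / bracket x \<partial>lborel)"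
  proof -
    have i: "integrable lborel (\<lambda>x. (norm (u1 x))\<^sup>2 + (norm (u2 x))\<^sup>2)"
      by (intro Bochner_Integration.integrable_add integrable_partial_norm2 t)
    show ?thesis
      unfolding Bochner_Integration.integral_add[OF integrable_mult_right[OF i]
        integrable_mult_right[OF integrable_inverse_bracket[OF u]]]
      by (simp only: integral_mult_right_zero)
  qed
  also have "\<dots> \<le> \<delta> * total_energy u + 8 * \<delta> * (6 * total_energy u)"
  proof (intro add_mono mult_left_mono hardy_inequality u integral_mono integrable_energy)
    show "integrable lborel (\<lambda>x. (norm (u1 x))\<^sup>2 + (norm (u2 x))\<^sup>2)"
      by (intro Bochner_Integration.integrable_add integrable_partial_norm2 t)
    show "(norm (u1 x))\<^sup>2 + (norm (u2 x))\<^sup>2 \<le> energy u x" for x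
      by (simp add: energy_def u1_def u2_def)
  qed (use \<delta> in auto)
  finally show ?thesis by simp
qed

section \<open>A trace inequality along lines\<close>

lemma bounded_by_line_integral:
  fixes f :: "real^'n::finite \<Rightarrow> real"
  assumes "has_partial f f' j" "continuous_on UNIV f'" "supported_in R f"
  shows "ennreal (f x) \<le> (\<integral>\<^sup>+t. ennreal \<bar>f' (x + t *\<^sub>R axis j 1)\<bar> \<partial>lborel)"
proof -
  \<comment> \<open>Far enough along the line to leave the ball of radius \<open>R\<close>, so that
    \<open>f\<close> vanishes at the end point.\<close>
  define T where "T = norm x + \<bar>R\<bar> + 1"
  have T: "0 \<le> T" by (simp add: T_def add_nonneg_nonneg)
  have "T \<le> norm (x + T *\<^sub>R axis j (1::real)) + norm x"
    using norm_triangle_ineq4[of "x + T *\<^sub>R axis j (1::real)" x] T by simp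
  then have "f (x + T *\<^sub>R axis j 1) = 0"
    using assms(3) by (auto simp: supported_in_def T_def)
  have cont: "continuous_on {0..T} (\<lambda>t. f' (x + t *\<^sub>R axis j 1))"
    by (rule continuous_on_compose2[OF assms(2)]) (auto intro!: continuous_intros)
  have "((\<lambda>t. f' (x + t *\<^sub>R axis j 1)) has_integral (f (x + T *\<^sub>R axis j 1) - f (x + 0 *\<^sub>R axis j 1))) {0..T}"
    using T by (intro fundamental_theorem_of_calculus has_vector_derivative_at_within[OF has_partialD[OF assms(1)]])
  then have "((\<lambda>t. f' (x + t *\<^sub>R axis j 1)) has_integral (- f x)) {0..T}"
    using \<open>f (x + T *\<^sub>R axis j 1) = 0\<close> by simp
  moreover have "(\<lambda>t. \<bar>f' (x + t *\<^sub>R axis j 1)\<bar>) integrable_on {0..T}"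
    by (intro integrable_continuous_real continuous_intros cont)
  ultimately have "\<bar>- f x\<bar> \<le> integral {0..T} (\<lambda>t. \<bar>f' (x + t *\<^sub>R axis j 1)\<bar>)"
    by (metis (no_types, lifting) has_integral_integrable has_integral_unique integral_unique
        integral_norm_bound_integral real_norm_def order_refl)
  moreover have "(\<integral>\<^sup>+t. ennreal (indicator {0..T} t * \<bar>f' (x + t *\<^sub>R axis j 1)\<bar>) \<partial>lborel)
      = ennreal (integral {0..T} (\<lambda>t. \<bar>f' (x + t *\<^sub>R axis j 1)\<bar>))"
  proof (rule nn_integral_has_integral_lborel)
    have "continuous_on UNIV (\<lambda>t. f' (x + t *\<^sub>R axis j 1))"
      by (rule continuous_on_compose2[OF assms(2)]) (auto intro!: continuous_intros)
    then have [measurable]: "(\<lambda>t. f' (x + t *\<^sub>R axis j 1)) \<in> borel_measurable borel"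
      by (rule borel_measurable_continuous_onI)
    show "(\<lambda>t. indicator {0..T} t * \<bar>f' (x + t *\<^sub>R axis j 1)\<bar>) \<in> borel_measurable borel"
      by measurable
    have "((\<lambda>t. \<bar>f' (x + t *\<^sub>R axis j 1)\<bar>) has_integral integral {0..T} (\<lambda>t. \<bar>f' (x + t *\<^sub>R axis j 1)\<bar>)) {0..T}"
      by (intro integrable_integral integrable_continuous_real continuous_intros cont)
    then have "((\<lambda>t. if t \<in> {0..T} then \<bar>f' (x + t *\<^sub>R axis j 1)\<bar> else 0) has_integral integral {0..T} (\<lambda>t. \<bar>f' (x + t *\<^sub>R axis j 1)\<bar>)) UNIV"
      by (simp only: has_integral_restrict_UNIV)
    then show "((\<lambda>t. indicator {0..T} t * \<bar>f' (x + t *\<^sub>R axis j 1)\<bar>) has_integral integral {0..T} (\<lambda>t. \<bar>f' (x + t *\<^sub>R axis j 1)\<bar>)) UNIV"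
      by (rule has_integral_eq[rotated]) (auto simp: indicator_def)
  qed (auto simp: indicator_def)
  ultimately have "ennreal (f x) \<le> (\<integral>\<^sup>+t. ennreal (indicator {0..T} t * \<bar>f' (x + t *\<^sub>R axis j 1)\<bar>) \<partial>lborel)"
    by (simp add: ennreal_leI)
  also have "\<dots> \<le> (\<integral>\<^sup>+t. ennreal \<bar>f' (x + t *\<^sub>R axis j 1)\<bar> \<partial>lborel)"
    by (intro nn_integral_mono ennreal_leI) (auto simp: indicator_def)
  finally show ?thesis .
qed

text \<open>The bound for \<open>f x\<close> by the integral of the derivative over its whole line
  does not depend on the position along the line. Hence the weight \<open>v\<close>, a function of
  that position alone, integrates out as a separate factor.\<close>

lemma trace_inequality:
  fixes f :: "real^'n::finite \<Rightarrow> real" and v :: "real \<Rightarrow> ennreal" and m :: "real^'n \<Rightarrow> ennreal"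
  assumes f: "has_partial f f' j" "continuous_on UNIV f'" "supported_in R f"
    and [measurable]: "v \<in> borel_measurable borel" "m \<in> borel_measurable borel"
    and m: "\<And>x t. m (x + t *\<^sub>R axis j 1) = m x"
  shows "(\<integral>\<^sup>+x. v (x $ j) * m x * ennreal (f x) \<partial>lborel)
    \<le> (\<integral>\<^sup>+t. v t \<partial>lborel) * (\<integral>\<^sup>+x. m x * ennreal \<bar>f' x\<bar> \<partial>lborel)"
proof -
  have [measurable]: "f' \<in> borel_measurable borel"
    using f(2) by (rule borel_measurable_continuous_onI)
  have [measurable]: "(\<lambda>x::real^'n. x $ j) \<in> borel_measurable borel"
    by (intro borel_measurable_continuous_onI continuous_intros)
  have [measurable]: "(\<lambda>(x::real^'n, t). x + t *\<^sub>R axis j 1) \<in> borel_measurable (lborel \<Otimes>\<^sub>M lborel)"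
    by measurable
  have "(\<integral>\<^sup>+x. v (x $ j) * m x * ennreal (f x) \<partial>lborel)
    \<le> (\<integral>\<^sup>+x. v (x $ j) * m x * (\<integral>\<^sup>+t. ennreal \<bar>f' (x + t *\<^sub>R axis j 1)\<bar> \<partial>lborel) \<partial>lborel)"
    by (intro nn_integral_mono mult_left_mono bounded_by_line_integral[OF f]) simp
  also have "\<dots> = (\<integral>\<^sup>+x. (\<integral>\<^sup>+t. v (x $ j) * m x * ennreal \<bar>f' (x + t *\<^sub>R axis j 1)\<bar> \<partial>lborel) \<partial>lborel)"
    by (intro nn_integral_cong nn_integral_cmult[symmetric]) measurable
  also have "\<dots> = (\<integral>\<^sup>+t. (\<integral>\<^sup>+x. v (x $ j) * m x * ennreal \<bar>f' (x + t *\<^sub>R axis j 1)\<bar> \<partial>lborel) \<partial>lborel)"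
    by (rule lborel_pair.Fubini'[symmetric]) measurable
  \<comment> \<open>Translating \<open>x\<close> by \<open>t\<close> along axis \<open>j\<close>
    moves the dependence on \<open>t\<close> from the derivative into \<open>v\<close>; the weight
    \<open>m\<close> is unaffected.\<close>
  also have "\<dots> = (\<integral>\<^sup>+t. (\<integral>\<^sup>+x. v (x $ j - t) * m x * ennreal \<bar>f' x\<bar> \<partial>lborel) \<partial>lborel)"
  proof (rule nn_integral_cong)
    fix t
    have "(\<integral>\<^sup>+x. (\<lambda>x. v (x $ j - t) * m x * ennreal \<bar>f' x\<bar>) (x + t *\<^sub>R axis j 1) \<partial>lborel)
      = (\<integral>\<^sup>+x. v (x $ j - t) * m x * ennreal \<bar>f' x\<bar> \<partial>lborel)"
      by (rule nn_integral_lborel_shift) measurable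
    then show "(\<integral>\<^sup>+x. v (x $ j) * m x * ennreal \<bar>f' (x + t *\<^sub>R axis j 1)\<bar> \<partial>lborel)
      = (\<integral>\<^sup>+x. v (x $ j - t) * m x * ennreal \<bar>f' x\<bar> \<partial>lborel)"
      by (simp add: m axis_nth)
  qed
  also have "\<dots> = (\<integral>\<^sup>+x. (\<integral>\<^sup>+t. v (x $ j - t) * m x * ennreal \<bar>f' x\<bar> \<partial>lborel) \<partial>lborel)"
    by (rule lborel_pair.Fubini') measurable
  also have "\<dots> = (\<integral>\<^sup>+x. (\<integral>\<^sup>+t. v (x $ j - t) \<partial>lborel) * (m x * ennreal \<bar>f' x\<bar>) \<partial>lborel)"
    by (intro nn_integral_cong) (simp add: nn_integral_multc mult.assoc)
  also have "\<dots> = (\<integral>\<^sup>+x. (\<integral>\<^sup>+t. v t \<partial>lborel) * (m x * ennreal \<bar>f' x\<bar>) \<partial>lborel)"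
  proof -
    have "(\<integral>\<^sup>+t. v (c - t) \<partial>lborel) = (\<integral>\<^sup>+t. v t \<partial>lborel)" for c
      using nn_integral_real_affine[of v "-1" c] by simp
    then show ?thesis by simp
  qed
  also have "\<dots> = (\<integral>\<^sup>+t. v t \<partial>lborel) * (\<integral>\<^sup>+x. m x * ennreal \<bar>f' x\<bar> \<partial>lborel)"
    by (intro nn_integral_cmult) measurable
  finally show ?thesis .
qed

section \<open>A Poincare inequality on a grid of cubes\<close>

lemma norm_increment_power2_le:
  fixes f :: "real^'n::finite \<Rightarrow> complex"
  assumes f: "has_partial f f' j" "continuous_on UNIV f'" and "0 \<le> t"
  shows "ennreal ((norm (f (x + t *\<^sub>R axis j 1) - f x))\<^sup>2)
    \<le> ennreal t * (\<integral>\<^sup>+s. indicator {0..t} s * ennreal ((norm (f' (x + s *\<^sub>R axis j 1)))\<^sup>2) \<partial>lborel)"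
proof -
  define g where "g s = norm (f' (x + s *\<^sub>R axis j 1))" for s
  have g: "continuous_on S g" for S
    unfolding g_def[abs_def]
    by (intro continuous_intros continuous_on_compose2[OF f(2)]) auto
  have [measurable]: "g \<in> borel_measurable borel"
    using g by (rule borel_measurable_continuous_onI)
  have f'c: "continuous_on {0..t} (\<lambda>s. f' (x + s *\<^sub>R axis j 1))"
    by (intro continuous_on_compose2[OF f(2)] continuous_intros) auto
  have hi: "((\<lambda>s. f' (x + s *\<^sub>R axis j 1)) has_integral (f (x + t *\<^sub>R axis j 1) - f (x + 0 *\<^sub>R axis j 1))) {0..t}"
    using assms(3) by (intro fundamental_theorem_of_calculus has_vector_derivative_at_within[OF has_partialD[OF f(1)]])
  have gi: "g integrable_on {0..t}"
    by (intro integrable_continuous_real g)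
  have "norm (f (x + t *\<^sub>R axis j 1) - f x) \<le> integral {0..t} g"
    using hi integral_norm_bound_integral[OF has_integral_integrable[OF hi] gi] integral_unique[OF hi]
    by (simp add: g_def)
  moreover have "(\<integral>\<^sup>+s. ennreal (indicator {0..t} s * g s) \<partial>lborel) = ennreal (integral {0..t} g)"
  proof (rule nn_integral_has_integral_lborel)
    have "((\<lambda>s. if s \<in> {0..t} then g s else 0) has_integral integral {0..t} g) UNIV"
      using integrable_integral[OF gi] by (simp only: has_integral_restrict_UNIV)
    then show "((\<lambda>s. indicator {0..t} s * g s) has_integral integral {0..t} g) UNIV"
      by (rule has_integral_eq[rotated]) (auto simp: indicator_def)
    show "(\<lambda>s. indicator {0..t} s * g s) \<in> borel_measurable borel" by measurable
  qed (simp add: g_def)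
  \<comment> \<open>The indicator is duplicated to serve as the second factor in Cauchy-Schwarz,
    whose squared norm is \<open>t\<close>.\<close>
  moreover have "ennreal (indicator {0..t} s * g s) = indicator {0..t} s * (indicator {0..t} s * ennreal (g s))" for s
    by (auto simp: indicator_def)
  ultimately have le: "ennreal (norm (f (x + t *\<^sub>R axis j 1) - f x))
      \<le> (\<integral>\<^sup>+s. indicator {0..t} s * (indicator {0..t} s * ennreal (g s)) \<partial>lborel)"
    by (simp add: ennreal_leI)
  have "ennreal ((norm (f (x + t *\<^sub>R axis j 1) - f x))\<^sup>2) = (ennreal (norm (f (x + t *\<^sub>R axis j 1) - f x)))\<^sup>2"
    by (simp add: ennreal_power)
  also have "\<dots> \<le> (\<integral>\<^sup>+s. indicator {0..t} s * (indicator {0..t} s * ennreal (g s)) \<partial>lborel)\<^sup>2"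
    using le by (intro power_mono) auto
  also have "\<dots> \<le> (\<integral>\<^sup>+s. (indicator {0..t} s)\<^sup>2 \<partial>lborel) * (\<integral>\<^sup>+s. (indicator {0..t} s * ennreal (g s))\<^sup>2 \<partial>lborel)"
    by (rule Cauchy_Schwarz_nn_integral) measurable
  also have "(\<integral>\<^sup>+s. (indicator {0..t} s)\<^sup>2 \<partial>lborel) = ennreal t"
  proof -
    have "(\<lambda>s. (indicator {0..t} s)\<^sup>2 :: ennreal) = indicator {0..t}"
      by (auto simp: indicator_def)
    then show ?thesis using assms(3) by simp
  qed
  also have "(\<integral>\<^sup>+s. (indicator {0..t} s * ennreal (g s))\<^sup>2 \<partial>lborel) = (\<integral>\<^sup>+s. indicator {0..t} s * ennreal ((g s)\<^sup>2) \<partial>lborel)"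
    by (intro nn_integral_cong) (auto simp: indicator_def ennreal_power g_def)
  finally show ?thesis by (simp add: g_def)
qed

text \<open>The increment is an integral over translates of \<open>f'\<close>, all of which have the
  same L2 norm.\<close>

lemma nn_integral_increment_le:
  fixes f :: "real^'n::finite \<Rightarrow> complex"
  assumes f: "has_partial f f' j" "continuous_on UNIV f'" "continuous_on UNIV f"
  shows "(\<integral>\<^sup>+x. ennreal ((norm (f (x + t *\<^sub>R axis j 1) - f x))\<^sup>2) \<partial>lborel)
    \<le> ennreal (t\<^sup>2) * (\<integral>\<^sup>+x. ennreal ((norm (f' x))\<^sup>2) \<partial>lborel)"
proof -
  have [measurable]: "f' \<in> borel_measurable borel" "f \<in> borel_measurable borel"
    using f by (auto intro: borel_measurable_continuous_onI)
  have nonneg: "(\<integral>\<^sup>+x. ennreal ((norm (f (x + t *\<^sub>R axis j 1) - f x))\<^sup>2) \<partial>lborel)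
    \<le> ennreal (t\<^sup>2) * (\<integral>\<^sup>+x. ennreal ((norm (f' x))\<^sup>2) \<partial>lborel)" if t: "0 \<le> t" for t
  proof -
    have [measurable]: "(\<lambda>(x::real^'n, s). x + s *\<^sub>R axis j 1) \<in> borel_measurable (lborel \<Otimes>\<^sub>M lborel)"
      by measurable
    have "(\<integral>\<^sup>+x. ennreal ((norm (f (x + t *\<^sub>R axis j 1) - f x))\<^sup>2) \<partial>lborel)
      \<le> (\<integral>\<^sup>+x. ennreal t * (\<integral>\<^sup>+s. indicator {0..t} s * ennreal ((norm (f' (x + s *\<^sub>R axis j 1)))\<^sup>2) \<partial>lborel) \<partial>lborel)"
      by (intro nn_integral_mono norm_increment_power2_le f t)
    also have "\<dots> = ennreal t * (\<integral>\<^sup>+x. (\<integral>\<^sup>+s. indicator {0..t} s * ennreal ((norm (f' (x + s *\<^sub>R axis j 1)))\<^sup>2) \<partial>lborel) \<partial>lborel)"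
      by (intro nn_integral_cmult) measurable
    also have "(\<integral>\<^sup>+x. (\<integral>\<^sup>+s. indicator {0..t} s * ennreal ((norm (f' (x + s *\<^sub>R axis j 1)))\<^sup>2) \<partial>lborel) \<partial>lborel)
      = (\<integral>\<^sup>+s. (\<integral>\<^sup>+x. indicator {0..t} s * ennreal ((norm (f' (x + s *\<^sub>R axis j 1)))\<^sup>2) \<partial>lborel) \<partial>lborel)"
      by (rule lborel_pair.Fubini'[symmetric]) measurable
    also have "\<dots> = (\<integral>\<^sup>+s. indicator {0..t} s * (\<integral>\<^sup>+x. ennreal ((norm (f' x))\<^sup>2) \<partial>lborel) \<partial>lborel)"
    proof (rule nn_integral_cong)
      fix s :: real
      have "(\<integral>\<^sup>+x. ennreal ((norm (f' (x + s *\<^sub>R axis j 1)))\<^sup>2) \<partial>lborel) = (\<integral>\<^sup>+x. ennreal ((norm (f' x))\<^sup>2) \<partial>lborel)"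
        by (rule nn_integral_lborel_shift[of "\<lambda>x. ennreal ((norm (f' x))\<^sup>2)"]) measurable
      then show "(\<integral>\<^sup>+x. indicator {0..t} s * ennreal ((norm (f' (x + s *\<^sub>R axis j 1)))\<^sup>2) \<partial>lborel)
        = indicator {0..t} s * (\<integral>\<^sup>+x. ennreal ((norm (f' x))\<^sup>2) \<partial>lborel)"
        by (subst nn_integral_cmult) simp_all
    qed
    also have "\<dots> = ennreal t * (\<integral>\<^sup>+x. ennreal ((norm (f' x))\<^sup>2) \<partial>lborel)"
      using t by (subst nn_integral_multc) simp_all
    finally show ?thesis
      using t by (simp add: mult.assoc[symmetric] ennreal_mult[symmetric] power2_eq_square)
  qed
  show ?thesis
  proof (cases "0 \<le> t")
    case False
    \<comment> \<open>A translation by \<open>- t\<close> along the axis turns a backward increment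
      into a forward one.\<close>
    have "(\<integral>\<^sup>+x. ennreal ((norm (f (x + t *\<^sub>R axis j 1) - f x))\<^sup>2) \<partial>lborel)
      = (\<integral>\<^sup>+x. ennreal ((norm (f (x + (- t) *\<^sub>R axis j 1 + t *\<^sub>R axis j 1) - f (x + (- t) *\<^sub>R axis j 1)))\<^sup>2) \<partial>lborel)"
      by (rule nn_integral_lborel_shift[of "\<lambda>x. ennreal ((norm (f (x + t *\<^sub>R axis j 1) - f x))\<^sup>2)" "(- t) *\<^sub>R axis j 1", symmetric])
        measurable
    also have "\<dots> = (\<integral>\<^sup>+x. ennreal ((norm (f (x + (- t) *\<^sub>R axis j 1) - f x))\<^sup>2) \<partial>lborel)"
      by (simp add: norm_minus_commute)
    finally show ?thesis using nonneg[of "- t"] False by simp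
  qed (rule nonneg)
qed

definition grad2 :: "(real^3 \<Rightarrow> complex) \<Rightarrow> (real^3 \<Rightarrow> complex) \<Rightarrow> (real^3 \<Rightarrow> complex) \<Rightarrow> ennreal" where
  "grad2 f1 f2 f3 = (\<integral>\<^sup>+x. ennreal ((norm (f1 x))\<^sup>2) \<partial>lborel) + (\<integral>\<^sup>+x. ennreal ((norm (f2 x))\<^sup>2) \<partial>lborel)
     + (\<integral>\<^sup>+x. ennreal ((norm (f3 x))\<^sup>2) \<partial>lborel)"

text \<open>The displacement is made in three moves parallel to the axes; the 3 is the cost of
  squaring a sum of three terms.\<close>

lemma nn_integral_translate_diff_le:
  fixes f :: "real^3 \<Rightarrow> complex"
  assumes f: "has_partial f f1 1" "has_partial f f2 2" "has_partial f f3 3"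
    and c: "continuous_on UNIV f" "continuous_on UNIV f1" "continuous_on UNIV f2" "continuous_on UNIV f3"
    and h: "\<And>i. \<bar>h $ i\<bar> \<le> s"
  shows "(\<integral>\<^sup>+x. ennreal ((norm (f x - f (x + h)))\<^sup>2) \<partial>lborel) \<le> ennreal (3 * s\<^sup>2) * grad2 f1 f2 f3"
proof -
  have [measurable]: "f \<in> borel_measurable borel"
    using c by (auto intro: borel_measurable_continuous_onI)
  define a b where "a = h $ 1 *\<^sub>R axis (1::3) (1::real)" and "b = h $ 2 *\<^sub>R axis (2::3) (1::real)"
  define d where "d = h $ 3 *\<^sub>R axis (3::3) (1::real)"
  have "h = a + b + d"
    by (simp add: vec_eq_iff forall_3 a_def b_def d_def axis_def)
  then have xh: "x + h = x + a + b + d" for x by (simp add: add.assoc)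
  have sq: "(norm (p + q + r))\<^sup>2 \<le> 3 * ((norm p)\<^sup>2 + (norm q)\<^sup>2 + (norm r)\<^sup>2)" for p q r :: complex
  proof -
    have "norm (p + q + r) \<le> norm p + norm q + norm r"
      using norm_triangle_ineq[of "p + q" r] norm_triangle_ineq[of p q] by linarith
    then have "(norm (p + q + r))\<^sup>2 \<le> (norm p + norm q + norm r)\<^sup>2"
      by (intro power_mono) auto
    also have "\<dots> \<le> 3 * ((norm p)\<^sup>2 + (norm q)\<^sup>2 + (norm r)\<^sup>2)"
      using sum_squares_ge_zero[of "norm p - norm q" "norm q - norm r"] zero_le_power2[of "norm p - norm r"]
      by (simp add: power2_eq_square algebra_simps)
    finally show ?thesis .
  qed
  have "(\<integral>\<^sup>+x. ennreal ((norm (f x - f (x + h)))\<^sup>2) \<partial>lborel)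
    \<le> (\<integral>\<^sup>+x. 3 * (ennreal ((norm (f (x + a) - f x))\<^sup>2) + ennreal ((norm (f (x + a + b) - f (x + a)))\<^sup>2)
      + ennreal ((norm (f (x + a + b + d) - f (x + a + b)))\<^sup>2)) \<partial>lborel)"
  proof (rule nn_integral_mono)
    fix x
    have e: "norm (f x - f (x + h)) = norm ((f (x + a) - f x) + (f (x + a + b) - f (x + a)) + (f (x + a + b + d) - f (x + a + b)))"
      by (simp add: xh norm_minus_commute)
    have "(norm (f x - f (x + h)))\<^sup>2 \<le> 3 * ((norm (f (x + a) - f x))\<^sup>2 + (norm (f (x + a + b) - f (x + a)))\<^sup>2
      + (norm (f (x + a + b + d) - f (x + a + b)))\<^sup>2)"
      unfolding e by (rule sq)
    then have "ennreal ((norm (f x - f (x + h)))\<^sup>2) \<le> ennreal (3 * ((norm (f (x + a) - f x))\<^sup>2 + (norm (f (x + a + b) - f (x + a)))\<^sup>2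
      + (norm (f (x + a + b + d) - f (x + a + b)))\<^sup>2))"
      by (rule ennreal_leI)
    then show "ennreal ((norm (f x - f (x + h)))\<^sup>2)
      \<le> 3 * (ennreal ((norm (f (x + a) - f x))\<^sup>2) + ennreal ((norm (f (x + a + b) - f (x + a)))\<^sup>2)
      + ennreal ((norm (f (x + a + b + d) - f (x + a + b)))\<^sup>2))"
      by (subst (asm) ennreal_mult) (auto simp: ennreal_plus)
  qed
  also have "\<dots> = 3 * ((\<integral>\<^sup>+x. ennreal ((norm (f (x + a) - f x))\<^sup>2) \<partial>lborel)
      + (\<integral>\<^sup>+x. ennreal ((norm (f (x + a + b) - f (x + a)))\<^sup>2) \<partial>lborel)
      + (\<integral>\<^sup>+x. ennreal ((norm (f (x + a + b + d) - f (x + a + b)))\<^sup>2) \<partial>lborel))"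
    by (simp add: nn_integral_cmult nn_integral_add)
  also have "(\<integral>\<^sup>+x. ennreal ((norm (f (x + a + b) - f (x + a)))\<^sup>2) \<partial>lborel)
    = (\<integral>\<^sup>+x. ennreal ((norm (f (x + b) - f x))\<^sup>2) \<partial>lborel)"
    by (rule nn_integral_lborel_shift[of "\<lambda>x. ennreal ((norm (f (x + b) - f x))\<^sup>2)"]) measurable
  also have "(\<integral>\<^sup>+x. ennreal ((norm (f (x + a + b + d) - f (x + a + b)))\<^sup>2) \<partial>lborel)
    = (\<integral>\<^sup>+x. ennreal ((norm (f (x + d) - f x))\<^sup>2) \<partial>lborel)"
    using nn_integral_lborel_shift[of "\<lambda>x. ennreal ((norm (f (x + d) - f x))\<^sup>2)" "a + b"]
    by (simp add: add.assoc)
  also have "3 * ((\<integral>\<^sup>+x. ennreal ((norm (f (x + a) - f x))\<^sup>2) \<partial>lborel)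
      + (\<integral>\<^sup>+x. ennreal ((norm (f (x + b) - f x))\<^sup>2) \<partial>lborel)
      + (\<integral>\<^sup>+x. ennreal ((norm (f (x + d) - f x))\<^sup>2) \<partial>lborel))
    \<le> 3 * (ennreal (s\<^sup>2) * (\<integral>\<^sup>+x. ennreal ((norm (f1 x))\<^sup>2) \<partial>lborel)
      + ennreal (s\<^sup>2) * (\<integral>\<^sup>+x. ennreal ((norm (f2 x))\<^sup>2) \<partial>lborel)
      + ennreal (s\<^sup>2) * (\<integral>\<^sup>+x. ennreal ((norm (f3 x))\<^sup>2) \<partial>lborel))"
  proof -
    have hs: "ennreal ((h $ i)\<^sup>2) \<le> ennreal (s\<^sup>2)" for i
      using h[of i] by (intro ennreal_leI) (simp add: abs_le_square_iff[symmetric])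
    show ?thesis
      unfolding a_def b_def d_def
      by (intro mult_left_mono add_mono order_trans[OF nn_integral_increment_le mult_right_mono] hs f c) auto
  qed
  also have "\<dots> = ennreal (3 * s\<^sup>2) * grad2 f1 f2 f3"
    by (simp add: grad2_def ennreal_mult distrib_left mult.assoc)
  finally show ?thesis .
qed

text \<open>The integer label of the half-open cube of side \<open>s\<close> containing
  \<open>x\<close>; rounding down makes these cubes a partition of space.\<close>

definition cell :: "real \<Rightarrow> real^3 \<Rightarrow> 3 \<Rightarrow> int" where
  "cell s x i = \<lfloor>x $ i / s\<rfloor>"

lemma cell_eq_iff:
  assumes "0 < s"
  shows "cell s x = k \<longleftrightarrow> (\<forall>i. s * k i \<le> x $ i \<and> x $ i < s * (k i + 1))"
  using assms by (auto simp: cell_def fun_eq_iff floor_eq_iff field_simps)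

lemma sets_cell [measurable]: "0 < s \<Longrightarrow> {x. cell s x = k} \<in> sets borel"
proof -
  assume s: "0 < s"
  have "{x. cell s x = k} = (\<Inter>i. {x. s * k i \<le> x $ i} \<inter> {x. x $ i < s * (k i + 1)})"
    using s by (auto simp: cell_eq_iff)
  also have "\<dots> \<in> sets borel"
    by (intro sets.finite_INT sets.Int borel_closed borel_open closed_Collect_le open_Collect_less continuous_intros) auto
  finally show ?thesis .
qed

lemma emeasure_cell:
  assumes s: "0 < s"
  shows "emeasure lborel {x. cell s x = k} = ennreal (s ^ 3)"
proof -
  define a b :: "real^3" where "a = (\<chi> i. s * k i)" and "b = (\<chi> i. s * (k i + 1))"
  have ab: "a $ i \<le> b $ i" for i using s by (simp add: a_def b_def)
  have "(\<Prod>i\<in>UNIV. b $ i - a $ i) = s ^ 3"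
    by (simp add: a_def b_def algebra_simps power3_eq_cube)
  moreover have "cbox a b \<noteq> {}"
    using ab by (auto simp: interval_eq_empty_cart not_less)
  ultimately have "measure lborel (cbox a b) = s ^ 3"
    by (subst content_cbox_cart) auto
  then have cb: "emeasure lborel (cbox a b) = ennreal (s ^ 3)"
    by (subst emeasure_eq_ennreal_measure) (simp_all add: emeasure_lborel_cbox_eq)
  have bb: "emeasure lborel (box a b) = emeasure lborel (cbox a b)"
    by (simp add: emeasure_lborel_cbox_eq emeasure_lborel_box_eq)
  have "emeasure lborel (box a b) \<le> emeasure lborel {x. cell s x = k}"
    using s by (intro emeasure_mono) (auto simp: cell_eq_iff mem_box_cart a_def b_def less_imp_le)
  moreover have "emeasure lborel {x. cell s x = k} \<le> emeasure lborel (cbox a b)"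
    using s by (intro emeasure_mono) (auto simp: cell_eq_iff mem_box_cart a_def b_def less_imp_le)
  ultimately show ?thesis using cb bb by simp
qed

lemma cube_volume_cancel:
  assumes "0 < (s::real)"
  shows "2 / s ^ 6 * s ^ 3 = 2 / s ^ 3"
proof -
  have cancel: "2 / (c * c) * c = 2 / c" if "c \<noteq> 0" for c :: real
    using that by simp
  have eq: "s ^ 6 = s ^ 3 * s ^ 3"
    by (simp flip: power_add)
  show ?thesis
    unfolding eq by (rule cancel) (use assms in simp)
qed

text \<open>Integrating \<open>f x = f y + (f x - f y)\<close> over \<open>y\<close> in the cube
  gives its volume times \<open>f x\<close> on the left. Squaring and dividing by the squared volume
  yields the first coefficient; Cauchy-Schwarz on the cube returns one factor of the volume in the
  second.\<close>

lemma cell_pointwise_bound: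
  fixes f :: "real^3 \<Rightarrow> complex" and x :: "real^3"
  assumes s: "0 < s" and f: "continuous_on UNIV f" "supported_in R f"
  defines "Q \<equiv> {y. cell s y = cell s x}"
  shows "ennreal ((norm (f x))\<^sup>2) \<le> ennreal (2 / s ^ 6 * (norm (\<integral>y. indicator Q y *\<^sub>R f y \<partial>lborel))\<^sup>2)
    + ennreal (2 / s ^ 3) * (\<integral>\<^sup>+y. indicator Q y * ennreal ((norm (f x - f y))\<^sup>2) \<partial>lborel)"
proof -
  have [measurable]: "f \<in> borel_measurable borel"
    using f(1) by (rule borel_measurable_continuous_onI)
  have Q[measurable]: "Q \<in> sets borel"
    unfolding Q_def using s by (rule sets_cell)
  have eQ: "emeasure lborel Q = ennreal (s ^ 3)"
    unfolding Q_def using s by (rule emeasure_cell)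
  have mQ: "measure lborel Q = s ^ 3"
    using eQ s by (simp add: measure_def)
  obtain C where C: "\<And>y. norm (f y) \<le> C"
    using continuous_supported_bounded[OF f] by metis
  have iQ: "integrable lborel (indicat_real Q)"
    using eQ by (intro integrable_real_indicator) auto
  have i1: "integrable lborel (\<lambda>y. indicator Q y *\<^sub>R g y)"
    if [measurable]: "g \<in> borel_measurable borel" and "\<And>y. norm (g y) \<le> D" for g :: "real^3 \<Rightarrow> complex" and D
  proof (rule Bochner_Integration.integrable_bound)
    show "integrable lborel (\<lambda>y. D * indicat_real Q y)"
      using iQ by simp
    show "AE y in lborel. norm (indicat_real Q y *\<^sub>R g y) \<le> norm (D * indicat_real Q y)"
      using that(2) by (intro AE_I2) (auto simp: indicator_def intro: order_trans abs_ge_self)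
  qed measurable
  have i2: "integrable lborel (\<lambda>y. indicator Q y *\<^sub>R (f x - f y))"
    by (rule i1[where D = "C + C"]) (measurable, rule order_trans[OF norm_triangle_ineq4 add_mono[OF C C]])
  define N where "N = norm (\<integral>y. indicator Q y *\<^sub>R f y \<partial>lborel)"
  define M where "M = (\<integral>y. norm (indicator Q y *\<^sub>R (f x - f y)) \<partial>lborel)"
  have M0: "0 \<le> M" by (simp add: M_def)
  have "(\<integral>y. indicator Q y *\<^sub>R f x \<partial>lborel) = s ^ 3 *\<^sub>R f x"
    using Q eQ by (simp add: mQ)
  moreover have "(\<integral>y. indicator Q y *\<^sub>R f x \<partial>lborel)
    = (\<integral>y. indicator Q y *\<^sub>R f y \<partial>lborel) + (\<integral>y. indicator Q y *\<^sub>R (f x - f y) \<partial>lborel)"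
    using i1[of f C] i2 C by (subst Bochner_Integration.integral_add[symmetric]) (auto simp: algebra_simps)
  ultimately have "s ^ 3 *\<^sub>R f x
    = (\<integral>y. indicator Q y *\<^sub>R f y \<partial>lborel) + (\<integral>y. indicator Q y *\<^sub>R (f x - f y) \<partial>lborel)"
    by simp
  then have "norm (s ^ 3 *\<^sub>R f x) \<le> N + norm (\<integral>y. indicator Q y *\<^sub>R (f x - f y) \<partial>lborel)"
    unfolding N_def by (simp only: norm_triangle_ineq)
  moreover have "norm (\<integral>y. indicator Q y *\<^sub>R (f x - f y) \<partial>lborel) \<le> M"
    unfolding M_def by (rule integral_norm_bound)
  ultimately have "norm (s ^ 3 *\<^sub>R f x) \<le> N + M"
    by linarith
  then have "s ^ 3 * norm (f x) \<le> N + M"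
    using s by simp
  then have "(s ^ 3 * norm (f x))\<^sup>2 \<le> (N + M)\<^sup>2"
    using s by (intro power_mono) auto
  also have "\<dots> \<le> 2 * N\<^sup>2 + 2 * M\<^sup>2"
    using zero_le_power2[of "N - M"] by (simp add: power2_sum power2_diff)
  finally have "s ^ 6 * (norm (f x))\<^sup>2 \<le> 2 * N\<^sup>2 + 2 * M\<^sup>2"
    by (simp add: power_mult_distrib flip: power_mult)
  then have A: "(norm (f x))\<^sup>2 \<le> 2 / s ^ 6 * N\<^sup>2 + 2 / s ^ 6 * M\<^sup>2"
    using s by (simp add: field_simps)
  have "ennreal M = (\<integral>\<^sup>+y. ennreal (norm (indicator Q y *\<^sub>R (f x - f y))) \<partial>lborel)"
    unfolding M_def by (intro nn_integral_eq_integral[symmetric] integrable_norm i2) auto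
  also have "\<dots> = (\<integral>\<^sup>+y. indicator Q y * (indicator Q y * ennreal (norm (f x - f y))) \<partial>lborel)"
    by (intro nn_integral_cong) (auto simp: indicator_def)
  finally have "ennreal (M\<^sup>2) = (\<integral>\<^sup>+y. indicator Q y * (indicator Q y * ennreal (norm (f x - f y))) \<partial>lborel)\<^sup>2"
    using M0 by (simp add: ennreal_power[symmetric])
  also have "\<dots> \<le> (\<integral>\<^sup>+y. (indicator Q y)\<^sup>2 \<partial>lborel) * (\<integral>\<^sup>+y. (indicator Q y * ennreal (norm (f x - f y)))\<^sup>2 \<partial>lborel)"
    by (rule Cauchy_Schwarz_nn_integral) measurable
  also have "(\<integral>\<^sup>+y. (indicator Q y)\<^sup>2 \<partial>lborel) = ennreal (s ^ 3)"
  proof -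
    have "(\<lambda>y. (indicator Q y)\<^sup>2 :: ennreal) = indicator Q"
      by (auto simp: indicator_def)
    then show ?thesis using eQ by simp
  qed
  also have "(\<integral>\<^sup>+y. (indicator Q y * ennreal (norm (f x - f y)))\<^sup>2 \<partial>lborel)
    = (\<integral>\<^sup>+y. indicator Q y * ennreal ((norm (f x - f y))\<^sup>2) \<partial>lborel)"
    by (intro nn_integral_cong) (auto simp: indicator_def ennreal_power)
  finally have B: "ennreal (M\<^sup>2) \<le> ennreal (s ^ 3) * (\<integral>\<^sup>+y. indicator Q y * ennreal ((norm (f x - f y))\<^sup>2) \<partial>lborel)" .
  have "ennreal ((norm (f x))\<^sup>2) \<le> ennreal (2 / s ^ 6 * N\<^sup>2) + ennreal (2 / s ^ 6) * ennreal (M\<^sup>2)"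
    using ennreal_leI[OF A] s by (subst ennreal_mult[symmetric]) (auto simp: ennreal_plus)
  also have "ennreal (2 / s ^ 6) * ennreal (M\<^sup>2)
    \<le> ennreal (2 / s ^ 6) * (ennreal (s ^ 3) * (\<integral>\<^sup>+y. indicator Q y * ennreal ((norm (f x - f y))\<^sup>2) \<partial>lborel))"
    by (rule mult_left_mono[OF B]) simp
  also have "\<dots> = ennreal (2 / s ^ 3) * (\<integral>\<^sup>+y. indicator Q y * ennreal ((norm (f x - f y))\<^sup>2) \<partial>lborel)"
    unfolding mult.assoc[symmetric] using s
    by (subst ennreal_mult[symmetric]) (simp_all only: cube_volume_cancel, simp_all)
  finally show ?thesis
    by (simp add: N_def add_left_mono)
qed

text \<open>Two points of one cube differ by a vector of the box \<open>C\<close>. The mean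
  oscillation over all cubes is therefore bounded by translation differences on the whole space,
  averaged over \<open>C\<close>, and no derivative estimate on a single cube has to be
  localized.\<close>

lemma grid_poincare:
  fixes f :: "real^3 \<Rightarrow> complex"
  assumes s: "0 < s" and K: "finite K"
    and f: "has_partial f f1 1" "has_partial f f2 2" "has_partial f f3 3"
    and c: "continuous_on UNIV f" "continuous_on UNIV f1" "continuous_on UNIV f2" "continuous_on UNIV f3"
    and R: "supported_in R f"
  shows "(\<integral>\<^sup>+x. indicator {x. cell s x \<in> K} x * ennreal ((norm (f x))\<^sup>2) \<partial>lborel)
    \<le> ennreal (48 * s\<^sup>2) * grad2 f1 f2 f3
      + ennreal (2 / s ^ 3 * (\<Sum>k\<in>K. (norm (\<integral>y. indicator {y. cell s y = k} y *\<^sub>R f y \<partial>lborel))\<^sup>2))"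
proof -
  have [measurable]: "f \<in> borel_measurable borel"
    using c(1) by (rule borel_measurable_continuous_onI)
  \<comment> \<open>The box of all possible displacements within a cube of side \<open>s\<close>.
    Its volume is \<open>8 * s ^ 3\<close>, and 48 = 2 * 8 * 3, with 2 from the pointwise bound and
    3 from the translation estimate.\<close>
  define C where "C = cbox (- (\<chi> i. s)) (\<chi> i. s :: real^3)"
  have C[measurable]: "C \<in> sets borel" by (simp add: C_def)
  have memC: "h \<in> C \<longleftrightarrow> (\<forall>i. \<bar>h $ i\<bar> \<le> s)" for h
    by (auto simp: C_def mem_box_cart abs_le_iff) (metis minus_le_iff)+
  have eC: "emeasure lborel C = ennreal (8 * s ^ 3)"
  proof -
    have "(\<Prod>i\<in>(UNIV::3 set). (\<chi> i. s) $ i - (- (\<chi> i. s)) $ i) = (2 * s) ^ 3"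
      by simp
    moreover have "cbox (- (\<chi> i. s)) (\<chi> i. s :: real^3) \<noteq> {}"
      using s by (auto simp: interval_eq_empty_cart not_less)
    ultimately have "measure lborel C = 8 * s ^ 3"
      unfolding C_def by (subst content_cbox_cart) (auto simp: power_mult_distrib)
    then show ?thesis
      unfolding C_def by (subst emeasure_eq_ennreal_measure) (simp_all add: emeasure_lborel_cbox_eq)
  qed
  define I where "I k = (norm (\<integral>y. indicator {y. cell s y = k} y *\<^sub>R f y \<partial>lborel))\<^sup>2" for k
  have [measurable]: "{x. cell s x = k} \<in> sets borel" for k
    using s by (rule sets_cell)
  have pointwise: "indicator {x. cell s x \<in> K} x * ennreal ((norm (f x))\<^sup>2)
    \<le> (\<Sum>k\<in>K. ennreal (2 / s ^ 6 * I k) * indicator {x. cell s x = k} x)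
      + ennreal (2 / s ^ 3) * (\<integral>\<^sup>+h. indicator C h * ennreal ((norm (f x - f (x + h)))\<^sup>2) \<partial>lborel)" for x
  proof (cases "cell s x \<in> K")
    case True
    have e1: "ennreal ((norm (f x))\<^sup>2) \<le> ennreal (2 / s ^ 6 * I (cell s x))
      + ennreal (2 / s ^ 3) * (\<integral>\<^sup>+y. indicator {y. cell s y = cell s x} y * ennreal ((norm (f x - f y))\<^sup>2) \<partial>lborel)"
      unfolding I_def using s c(1) R by (rule cell_pointwise_bound)
    have e2: "(\<Sum>k\<in>K. ennreal (2 / s ^ 6 * I k) * indicator {x. cell s x = k} x) = ennreal (2 / s ^ 6 * I (cell s x))"
    proof -
      have "(\<Sum>k\<in>K. ennreal (2 / s ^ 6 * I k) * indicator {x. cell s x = k} x)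
        = (\<Sum>k\<in>K. if k = cell s x then ennreal (2 / s ^ 6 * I k) else 0)"
        by (intro sum.cong refl) (auto simp: indicator_def)
      then show ?thesis using K True by (simp add: sum.delta)
    qed
    have e3: "(\<integral>\<^sup>+y. indicator {y. cell s y = cell s x} y * ennreal ((norm (f x - f y))\<^sup>2) \<partial>lborel)
      \<le> (\<integral>\<^sup>+h. indicator C h * ennreal ((norm (f x - f (x + h)))\<^sup>2) \<partial>lborel)"
    proof -
      have "(\<integral>\<^sup>+y. indicator {y. cell s y = cell s x} y * ennreal ((norm (f x - f y))\<^sup>2) \<partial>lborel)
        \<le> (\<integral>\<^sup>+y. indicator C (y - x) * ennreal ((norm (f x - f y))\<^sup>2) \<partial>lborel)"
      proof (rule nn_integral_mono)
        fix y
        have "y - x \<in> C" if "cell s y = cell s x"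
        proof -
          have "\<bar>y $ i - x $ i\<bar> \<le> s" for i
          proof -
            have "s * cell s x i \<le> x $ i" "x $ i < s * cell s x i + s"
              using cell_eq_iff[OF s, of x "cell s x"] by (auto simp: distrib_left)
            moreover have "s * cell s x i \<le> y $ i" "y $ i < s * cell s x i + s"
              using cell_eq_iff[OF s, of y "cell s x"] that by (auto simp: distrib_left)
            ultimately show ?thesis by linarith
          qed
          then show ?thesis by (simp add: memC)
        qed
        then show "indicator {y. cell s y = cell s x} y * ennreal ((norm (f x - f y))\<^sup>2)
          \<le> indicator C (y - x) * ennreal ((norm (f x - f y))\<^sup>2)"
          by (auto simp: indicator_def)
      qed
      also have "\<dots> = (\<integral>\<^sup>+h. indicator C (h + x - x) * ennreal ((norm (f x - f (h + x)))\<^sup>2) \<partial>lborel)"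
        by (rule nn_integral_lborel_shift[of "\<lambda>y. indicator C (y - x) * ennreal ((norm (f x - f y))\<^sup>2)" x, symmetric]) measurable
      finally show ?thesis by (simp add: add.commute)
    qed
    have "ennreal ((norm (f x))\<^sup>2) \<le> ennreal (2 / s ^ 6 * I (cell s x))
      + ennreal (2 / s ^ 3) * (\<integral>\<^sup>+h. indicator C h * ennreal ((norm (f x - f (x + h)))\<^sup>2) \<partial>lborel)"
      by (rule order_trans[OF e1 add_left_mono[OF mult_left_mono[OF e3]]]) simp
    then show ?thesis
      unfolding e2 using True by simp
  qed simp
  have "(\<integral>\<^sup>+x. indicator {x. cell s x \<in> K} x * ennreal ((norm (f x))\<^sup>2) \<partial>lborel)
    \<le> (\<integral>\<^sup>+x. (\<Sum>k\<in>K. ennreal (2 / s ^ 6 * I k) * indicator {x. cell s x = k} x)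
      + ennreal (2 / s ^ 3) * (\<integral>\<^sup>+h. indicator C h * ennreal ((norm (f x - f (x + h)))\<^sup>2) \<partial>lborel) \<partial>lborel)"
    by (intro nn_integral_mono pointwise)
  also have "\<dots> = (\<Sum>k\<in>K. ennreal (2 / s ^ 6 * I k) * ennreal (s ^ 3))
      + ennreal (2 / s ^ 3) * (\<integral>\<^sup>+x. (\<integral>\<^sup>+h. indicator C h * ennreal ((norm (f x - f (x + h)))\<^sup>2) \<partial>lborel) \<partial>lborel)"
    using s by (subst nn_integral_add) (simp_all add: nn_integral_sum nn_integral_cmult emeasure_cell)
  also have "(\<integral>\<^sup>+x. (\<integral>\<^sup>+h. indicator C h * ennreal ((norm (f x - f (x + h)))\<^sup>2) \<partial>lborel) \<partial>lborel)
    = (\<integral>\<^sup>+h. (\<integral>\<^sup>+x. indicator C h * ennreal ((norm (f x - f (x + h)))\<^sup>2) \<partial>lborel) \<partial>lborel)"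
    by (rule lborel_pair.Fubini'[symmetric]) measurable
  also have "\<dots> \<le> (\<integral>\<^sup>+h. indicator C h * (ennreal (3 * s\<^sup>2) * grad2 f1 f2 f3) \<partial>lborel)"
  proof (rule nn_integral_mono)
    fix h
    show "(\<integral>\<^sup>+x. indicator C h * ennreal ((norm (f x - f (x + h)))\<^sup>2) \<partial>lborel)
      \<le> indicator C h * (ennreal (3 * s\<^sup>2) * grad2 f1 f2 f3)"
    proof (cases "h \<in> C")
      case True
      then show ?thesis
        using nn_integral_translate_diff_le[OF f c, of h s] by (simp add: memC)
    qed simp
  qed
  also have "\<dots> = ennreal (8 * s ^ 3) * (ennreal (3 * s\<^sup>2) * grad2 f1 f2 f3)"
    by (simp add: nn_integral_multc eC)
  also have "(\<Sum>k\<in>K. ennreal (2 / s ^ 6 * I k) * ennreal (s ^ 3)) = ennreal (2 / s ^ 3 * (\<Sum>k\<in>K. I k))"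
  proof -
    have "ennreal (2 / s ^ 6 * I k) * ennreal (s ^ 3) = ennreal (2 / s ^ 3 * I k)" for k
    proof -
      have "ennreal (2 / s ^ 6 * I k) * ennreal (s ^ 3) = ennreal ((2 / s ^ 6 * s ^ 3) * I k)"
        using s by (subst ennreal_mult[symmetric]) (simp_all add: I_def)
      then show ?thesis using s by (simp only: cube_volume_cancel)
    qed
    then show ?thesis
      using s by (simp add: sum_distrib_left I_def)
  qed
  finally have "(\<integral>\<^sup>+x. indicator {x. cell s x \<in> K} x * ennreal ((norm (f x))\<^sup>2) \<partial>lborel)
    \<le> ennreal (2 / s ^ 3 * (\<Sum>k\<in>K. I k)) + ennreal (2 / s ^ 3) * (ennreal (8 * s ^ 3) * (ennreal (3 * s\<^sup>2) * grad2 f1 f2 f3))"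
    by (simp add: add_left_mono mult_left_mono)
  also have "ennreal (2 / s ^ 3) * (ennreal (8 * s ^ 3) * (ennreal (3 * s\<^sup>2) * grad2 f1 f2 f3)) = ennreal (48 * s\<^sup>2) * grad2 f1 f2 f3"
    using s by (simp add: mult.assoc[symmetric] ennreal_mult[symmetric])
  finally show ?thesis
    by (simp add: I_def add.commute)
qed

section \<open>The potential is form-small on a finite-codimensional subspace\<close>

text \<open>The part of \<open>v\<close> below \<eta> is the constant; the part above is integrable
  because p is at least 1, and dominated convergence makes what remains of it outside a large box in
  height and position small in L1.\<close>

lemma Lp_majorant:
  assumes v: "in_Lp p v" "\<And>z. 0 \<le> v z" and p: "1 \<le> p" and \<eta>: "0 < \<eta>"
  obtains v1 :: "real \<Rightarrow> ennreal" and n :: nat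
  where "v1 \<in> borel_measurable borel" "(\<integral>\<^sup>+z. v1 z \<partial>lborel) \<le> ennreal \<eta>" "1 \<le> n"
    and "\<And>z. ennreal (v z) \<le> v1 z + ennreal \<eta> + ennreal n * indicator {- real n..real n} z"
proof -
  have "v \<in> borel_measurable lebesgue"
    using v(1) by (simp add: in_Lp_def)
  from completion_ex_borel_measurable_real[OF this]
  obtain g where g[measurable]: "g \<in> borel_measurable lborel" and ae: "AE z in lborel. v z = g z"
    by blast
  from AE_E3[OF ae] obtain N where N: "\<And>z. z \<in> space lborel - N \<Longrightarrow> v z = g z" "N \<in> null_sets lborel"
    by blast
  have [measurable]: "N \<in> sets borel" using N(2) by (auto simp: null_sets_def)
  \<comment> \<open>The part of the Borel version \<open>g\<close> above the threshold
    \<eta>.\<close>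
  define h where "h z = (if \<bar>g z\<bar> > \<eta> then \<bar>g z\<bar> else 0)" for z
  have [measurable]: "h \<in> borel_measurable borel"
    using g unfolding h_def[abs_def] by measurable
  have gp: "integrable lborel (\<lambda>z. \<bar>g z\<bar> powr p)"
  proof -
    have [measurable]: "v \<in> borel_measurable lebesgue" using v(1) by (simp add: in_Lp_def)
    have [measurable]: "g \<in> borel_measurable lebesgue" using g by (rule measurable_completion)
    have "integrable lebesgue (\<lambda>z. \<bar>g z\<bar> powr p) \<longleftrightarrow> integrable lebesgue (\<lambda>z. \<bar>v z\<bar> powr p)"
    proof (rule integrable_cong_AE)
      show "AE z in lebesgue. \<bar>g z\<bar> powr p = \<bar>v z\<bar> powr p"
        using AE_completion[OF ae] by eventually_elim simp
    qed measurable
    then have "integrable lebesgue (\<lambda>z. \<bar>g z\<bar> powr p)"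
      using v(1) by (simp add: in_Lp_def)
    moreover have "(\<lambda>z. \<bar>g z\<bar> powr p) \<in> borel_measurable lborel" by measurable
    ultimately show ?thesis by (simp add: integrable_completion)
  qed
  have hi: "integrable lborel h"
  proof (rule Bochner_Integration.integrable_bound)
    show "integrable lborel (\<lambda>z. \<eta> powr (1 - p) * \<bar>g z\<bar> powr p)"
      using gp by simp
    \<comment> \<open>Above \<eta> the quotient of the modulus by \<eta> exceeds 1, so its power
      with exponent p - 1 is at least 1.\<close>
    have "\<bar>g z\<bar> \<le> \<eta> powr (1 - p) * \<bar>g z\<bar> powr p" if "\<eta> < \<bar>g z\<bar>" for z
    proof -
      have "1 = \<eta> powr (1 - p) * \<eta> powr (p - 1)"
        using \<eta> by (simp flip: powr_add)
      also have "\<dots> \<le> \<eta> powr (1 - p) * \<bar>g z\<bar> powr (p - 1)"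
        using that \<eta> p by (intro mult_left_mono powr_mono2) auto
      finally have "\<bar>g z\<bar> * 1 \<le> \<bar>g z\<bar> * (\<eta> powr (1 - p) * \<bar>g z\<bar> powr (p - 1))"
        by (intro mult_left_mono) auto
      also have "\<dots> = \<eta> powr (1 - p) * (\<bar>g z\<bar> powr 1 * \<bar>g z\<bar> powr (p - 1))"
        using that \<eta> by simp
      also have "\<bar>g z\<bar> powr 1 * \<bar>g z\<bar> powr (p - 1) = \<bar>g z\<bar> powr p"
        by (simp only: powr_add[symmetric]) simp
      finally show ?thesis by simp
    qed
    then show "AE z in lborel. norm (h z) \<le> norm (\<eta> powr (1 - p) * \<bar>g z\<bar> powr p)"
      by (auto simp: h_def)
  qed measurable
  \<comment> \<open>What \<open>h\<close> retains where its value or the position exceeds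
    \<open>n\<close>; at each point this is eventually 0.\<close>
  define w where "w n z = (if h z \<le> real n \<and> \<bar>z\<bar> \<le> real n then 0 else h z)" for n :: nat and z
  have [measurable]: "w n \<in> borel_measurable borel" for n
    unfolding w_def[abs_def] by measurable
  have h0: "0 \<le> h z" for z by (simp add: h_def)
  have w_le: "0 \<le> w n z" "w n z \<le> h z" for n z using h0 by (auto simp: w_def)
  have wi: "integrable lborel (w n)" for n
    using hi by (rule Bochner_Integration.integrable_bound) (use w_le h0 in auto)
  have "(\<lambda>n. \<integral>z. w n z \<partial>lborel) \<longlonglongrightarrow> (\<integral>z. (0::real) \<partial>(lborel :: real measure))"
  proof (rule integral_dominated_convergence[OF _ _ hi])
    show "AE z in lborel. (\<lambda>n. w n z) \<longlonglongrightarrow> 0"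
    proof (rule AE_I2)
      fix z
      have "\<forall>\<^sub>F n in sequentially. w n z = 0"
      proof (rule eventually_sequentiallyI)
        fix n assume "nat \<lceil>max (h z) \<bar>z\<bar>\<rceil> \<le> n"
        then have "max (h z) \<bar>z\<bar> \<le> real n" by linarith
        then show "w n z = 0" by (simp add: w_def)
      qed
      then show "(\<lambda>n. w n z) \<longlonglongrightarrow> 0"
        by (rule tendsto_eventually)
    qed
  qed (use w_le in auto)
  then have "\<forall>\<^sub>F n in sequentially. (\<integral>z. w n z \<partial>lborel) < \<eta>"
    using \<eta> by (intro order_tendstoD) auto
  then have "\<forall>\<^sub>F n in sequentially. (\<integral>z. w n z \<partial>lborel) < \<eta> \<and> 1 \<le> n"
    using eventually_ge_at_top[of "1::nat"] by eventually_elim auto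
  then obtain n where n: "(\<integral>z. w n z \<partial>lborel) < \<eta>" "1 \<le> n"
    using eventually_happens' sequentially_bot by blast
  \<comment> \<open>The value infinity on the null set \<open>N\<close>, where \<open>v\<close> may
    differ from its Borel version, makes the final inequality hold at every point without changing
    the integral.\<close>
  define v1 where "v1 z = ennreal (w n z) + \<infinity> * indicator N z" for z
  show ?thesis
  proof (rule that[of v1 n])
    show "v1 \<in> borel_measurable borel"
      unfolding v1_def[abs_def] by measurable
    have "(\<integral>\<^sup>+z. v1 z \<partial>lborel) = (\<integral>\<^sup>+z. ennreal (w n z) \<partial>lborel) + (\<integral>\<^sup>+z. \<infinity> * indicator N z \<partial>lborel)"
      unfolding v1_def by (rule nn_integral_add) measurable
    also have "(\<integral>\<^sup>+z. \<infinity> * indicator N z \<partial>lborel) = 0"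
      using N(2) by (subst nn_integral_cmult_indicator) (auto simp: null_sets_def)
    also have "(\<integral>\<^sup>+z. ennreal (w n z) \<partial>lborel) = ennreal (\<integral>z. w n z \<partial>lborel)"
      using wi w_le by (intro nn_integral_eq_integral) auto
    finally show "(\<integral>\<^sup>+z. v1 z \<partial>lborel) \<le> ennreal \<eta>"
      using n(1) by (simp add: ennreal_leI)
    show "1 \<le> n" by (rule n)
    show "ennreal (v z) \<le> v1 z + ennreal \<eta> + ennreal n * indicator {- real n..real n} z" for z
    proof (cases "z \<in> N")
      case False
      then have vg: "v z = g z" using N(1) by simp
      have "v z \<le> w n z + \<eta> + real n * indicator {- real n..real n} z"
      proof -
        have "v z \<le> \<eta> + h z" using vg \<eta> by (auto simp: h_def)
        moreover have "h z \<le> w n z + real n * indicator {- real n..real n} z"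
          by (auto simp: w_def indicator_def)
        ultimately show ?thesis by linarith
      qed
      then have "ennreal (v z) \<le> ennreal (w n z + \<eta> + real n * indicator {- real n..real n} z)"
        by (rule ennreal_leI)
      also have "\<dots> = ennreal (w n z) + ennreal \<eta> + ennreal n * indicator {- real n..real n} z"
        using w_le \<eta> by (auto simp: indicator_def ennreal_plus)
      finally show ?thesis using False by (simp add: v1_def)
    qed (simp add: v1_def)
  qed
qed

text \<open>A smooth function of r that vanishes quadratically on the axis, which tames log r there,
  and decays like 1/r^2, which tames it at infinity. It is positive off the axis, so it can be
  divided out where r is bounded above and below.\<close>

definition cutoff :: "real^3 \<Rightarrow> real" where
  "cutoff x = rad2 x / (1 + rad2 x)\<^sup>2"

definition cutoff_deriv :: "real \<Rightarrow> real" where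
  "cutoff_deriv s = (1 - s) / (1 + s) ^ 3"

text \<open>Squared moduli of finitely many linear functionals of \<open>u\<close>, each an integral
  against a bounded function supported in one cube and hence an inner product with an L2
  function.\<close>

abbreviation cell_moments :: "real \<Rightarrow> (3 \<Rightarrow> int) set \<Rightarrow> (real^3 \<Rightarrow> complex) \<Rightarrow> real" where
  "cell_moments s K u \<equiv>
    (\<Sum>k\<in>K. (norm (\<integral>y. indicator {y. cell s y = k} y *\<^sub>R (cutoff y *\<^sub>R u y) \<partial>lborel))\<^sup>2)"

lemma cutoff_has_partial:
  assumes "j \<noteq> 3"
  shows "has_partial cutoff (\<lambda>x. 2 * x $ j * cutoff_deriv (rad2 x)) j"
  unfolding cutoff_def[abs_def]
proof (rule has_partial_radial[OF assms])
  fix s :: real assume "0 \<le> s"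
  then have "1 + s \<noteq> 0" by linarith
  then show "((\<lambda>s. s / (1 + s)\<^sup>2) has_real_derivative cutoff_deriv s) (at s)"
    unfolding cutoff_deriv_def
    by (auto intro!: derivative_eq_intros simp: power2_eq_square power3_eq_cube divide_simps) algebra
qed

lemma continuous_on_cutoff: "continuous_on S cutoff"
  unfolding cutoff_def[abs_def]
  by (intro continuous_intros) (auto simp: add_nonneg_eq_0_iff)

lemma continuous_on_cutoff_deriv: "continuous_on S (\<lambda>x. cutoff_deriv (rad2 x))"
  unfolding cutoff_deriv_def
  by (intro continuous_intros) (auto simp: add_nonneg_eq_0_iff)

lemma cutoff_le_1: "0 \<le> cutoff x" "cutoff x \<le> 1"
proof -
  have "rad2 x \<le> (1 + rad2 x)\<^sup>2"
    using rad2_nonneg[of x] by (simp add: power2_sum)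
  then show "0 \<le> cutoff x" "cutoff x \<le> 1"
    by (simp_all add: cutoff_def divide_le_eq_1 add_nonneg_eq_0_iff)
qed

lemma bracket_le: "bracket x \<le> 1 + rad2 x"
proof -
  have "1 + rad2 x \<le> (1 + rad2 x)\<^sup>2"
    using rad2_nonneg[of x] by (simp add: power2_eq_square algebra_simps)
  then show ?thesis
    unfolding bracket_def by (intro real_le_lsqrt) auto
qed

lemma cutoff_gradient_le:
  assumes "j \<noteq> 3"
  shows "(2 * x $ j * cutoff_deriv (rad2 x))\<^sup>2 \<le> 4 / bracket x"
proof -
  define s where "s = rad2 x"
  have s: "0 \<le> s" by (simp add: s_def)
  have xj: "(x $ j)\<^sup>2 \<le> s"
    using assms exhaust_3[of j] by (auto simp: s_def rad2_def)
  have d: "(cutoff_deriv s)\<^sup>2 \<le> 1 / (1 + s)\<^sup>2"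
  proof -
    have "\<bar>1 - s\<bar> \<le> 1 + s" using s by auto
    then have "(1 - s)\<^sup>2 \<le> (1 + s)\<^sup>2" using s by (intro power2_le_iff_abs_le[THEN iffD2]) auto
    then have "(cutoff_deriv s)\<^sup>2 \<le> (1 + s)\<^sup>2 / ((1 + s) ^ 3)\<^sup>2"
      by (simp add: cutoff_deriv_def power_divide divide_right_mono)
    also have "\<dots> = 1 / ((1 + s)\<^sup>2 * (1 + s)\<^sup>2)"
    proof -
      have cancel: "c / (c * (c * c)) = 1 / (c * c)" if "c \<noteq> 0" for c :: real
        using that by simp
      have eq: "((1 + s) ^ 3)\<^sup>2 = (1 + s)\<^sup>2 * ((1 + s)\<^sup>2 * (1 + s)\<^sup>2)"
        by (simp flip: power_mult power_add)
      show ?thesis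
        unfolding eq by (rule cancel) (use s in simp)
    qed
    also have "\<dots> \<le> 1 / (1 + s)\<^sup>2"
    proof -
      have "1 / (c * c) \<le> 1 / c" if "1 \<le> c" for c :: real
        using that by (simp add: divide_simps)
      then show ?thesis using s by (simp only: one_le_power add_increasing2 order_refl)
    qed
    finally show ?thesis .
  qed
  have "(2 * x $ j * cutoff_deriv s)\<^sup>2 = 4 * ((x $ j)\<^sup>2 * (cutoff_deriv s)\<^sup>2)"
    by (simp add: power_mult_distrib)
  also have "\<dots> \<le> 4 * (s * (1 / (1 + s)\<^sup>2))"
    using xj d s by (intro mult_left_mono mult_mono) auto
  also have "\<dots> \<le> 4 * (1 / (1 + s))"
    using s by (intro mult_left_mono) (auto simp: power2_eq_square divide_simps)
  also have "\<dots> \<le> 4 * (1 / bracket x)"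
    using bracket_le[of x] bracket_ge_1[of x] unfolding s_def by (intro mult_left_mono divide_left_mono) auto
  finally show ?thesis by (simp add: s_def)
qed

text \<open>The modulus of ln r is at most r + 1/r = (1 + r^2)/r, so multiplication by the cutoff
  leaves r/(1 + r^2). The bound 1/<r> for the square is what the Hardy inequality can
  absorb.\<close>

lemma cutoff_ln_rad_le: "(cutoff x * ln_rad x)\<^sup>2 \<le> 1 / bracket x"
proof (cases "rad2 x = 0")
  case True
  then show ?thesis using bracket_ge_1[of x] by (simp add: cutoff_def)
next
  case False
  define r where "r = sqrt (rad2 x)"
  have r: "0 < r" "rad2 x = r\<^sup>2" using False rad2_nonneg[of x] by (auto simp: r_def less_le)
  have "\<bar>ln r\<bar> \<le> r + 1 / r"
  proof -
    have "ln r \<le> r - 1" using r by (rule_tac ln_le_minus_one) auto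
    moreover have "ln (1 / r) \<le> 1 / r - 1" using r by (intro ln_le_minus_one) auto
    moreover have "ln (1 / r) = - ln r" using r by (simp add: ln_div)
    ultimately show ?thesis using r by (simp add: abs_le_iff) (smt (verit) divide_pos_pos)
  qed
  then have "cutoff x * \<bar>ln r\<bar> \<le> cutoff x * (r + 1 / r)"
    using cutoff_le_1 by (intro mult_left_mono) auto
  also have "\<dots> = r / (1 + r\<^sup>2)"
  proof -
    have "r + 1 / r = (1 + r\<^sup>2) / r" using r by (simp add: field_simps power2_eq_square)
    moreover have "1 + r\<^sup>2 \<noteq> 0" by (simp add: add_nonneg_eq_0_iff)
    ultimately show ?thesis using r by (simp add: cutoff_def power2_eq_square)
  qed
  finally have "\<bar>cutoff x * ln_rad x\<bar> \<le> r / (1 + r\<^sup>2)"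
    using cutoff_le_1[of x] by (simp add: abs_mult ln_rad_def r_def)
  then have "(cutoff x * ln_rad x)\<^sup>2 \<le> (r / (1 + r\<^sup>2))\<^sup>2"
    using power_mono[of "\<bar>cutoff x * ln_rad x\<bar>" "r / (1 + r\<^sup>2)" 2] by simp
  also have "\<dots> \<le> 1 / (1 + r\<^sup>2)"
    by (simp add: power_divide power2_eq_square[of "1 + r\<^sup>2"] divide_simps add_nonneg_eq_0_iff)
  also have "\<dots> \<le> 1 / bracket x"
    using bracket_le[of x] bracket_ge_1[of x] r by (intro divide_left_mono) auto
  finally show ?thesis .
qed

lemma norm_add_power2_le: "(norm (a + b))\<^sup>2 \<le> 2 * (norm a)\<^sup>2 + 2 * (norm b)\<^sup>2"
  for a b :: "'a::real_normed_vector"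
proof -
  have "(norm (a + b))\<^sup>2 \<le> (norm a + norm b)\<^sup>2"
    by (intro power_mono norm_triangle_ineq) auto
  also have "\<dots> \<le> 2 * (norm a)\<^sup>2 + 2 * (norm b)\<^sup>2"
    using zero_le_power2[of "norm a - norm b"] by (simp add: power2_sum power2_diff)
  finally show ?thesis .
qed

text \<open>The plain third derivative of the cut-off function is the cutoff times the magnetic one
  plus i times \<open>cutoff x * ln_rad x\<close> times \<open>u\<close>. That error and the
  derivatives of the cutoff carry the weight 1/<r>, so the plain gradient is controlled by the
  energy.\<close>

lemma cutoff_grid_poincare:
  assumes u: "test_function u" and s: "0 < s" and K: "finite K"
  shows "(\<integral>\<^sup>+x. indicator {x. cell s x \<in> K} x * ennreal ((norm (cutoff x *\<^sub>R u x))\<^sup>2) \<partial>lborel)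
    \<le> ennreal (48 * s\<^sup>2 * 110 * total_energy u)
      + ennreal (2 / s ^ 3 * cell_moments s K u)"
proof -
  define u1 u2 u3 where "u1 = partial_deriv 1 u" and "u2 = partial_deriv 2 u" and "u3 = partial_deriv 3 u"
  have t: "test_function u1" "test_function u2" "test_function u3"
    unfolding u1_def u2_def u3_def by (intro test_function_partial_deriv u)+
  note pu = test_function_has_partial[OF u, of 1, folded u1_def]
    test_function_has_partial[OF u, of 2, folded u2_def]
    test_function_has_partial[OF u, of 3, folded u3_def]
  note cont = u[THEN test_function_continuous] t[THEN test_function_continuous]
    continuous_on_cutoff continuous_on_cutoff_deriv
  obtain R where R: "supported_in R u" using test_function_supported[OF u] by metis
  define g where "g j x = 2 * x $ j * cutoff_deriv (rad2 x)" for j :: 3 and x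
  define f where "f x = cutoff x *\<^sub>R u x" for x
  define f1 where "f1 x = cutoff x *\<^sub>R u1 x + g 1 x *\<^sub>R u x" for x
  define f2 where "f2 x = cutoff x *\<^sub>R u2 x + g 2 x *\<^sub>R u x" for x
  define f3 where "f3 x = cutoff x *\<^sub>R u3 x + 0 *\<^sub>R u x" for x
  have pf: "has_partial f f1 1" "has_partial f f2 2" "has_partial f f3 3"
    unfolding f_def[abs_def] f1_def[abs_def] f2_def[abs_def] f3_def[abs_def] g_def
    by (intro has_partial_scaleR pu cutoff_has_partial has_partial_invariant; simp add: cutoff_def rad2_invariant)+
  have cf: "continuous_on UNIV f" "continuous_on UNIV f1" "continuous_on UNIV f2" "continuous_on UNIV f3"
    unfolding f_def[abs_def] f1_def[abs_def] f2_def[abs_def] f3_def[abs_def] g_def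
    by (intro continuous_intros cont)+
  have Rf: "supported_in R f"
    using R by (simp add: supported_in_def f_def)
  have [measurable]: "f1 \<in> borel_measurable borel" "f2 \<in> borel_measurable borel" "f3 \<in> borel_measurable borel"
    by (intro borel_measurable_continuous_onI cf)+
  define q where "q x = (norm (u x))\<^sup>2 / bracket x" for x
  have "grad2 f1 f2 f3 = (\<integral>\<^sup>+x. ennreal ((norm (f1 x))\<^sup>2 + (norm (f2 x))\<^sup>2 + (norm (f3 x))\<^sup>2) \<partial>lborel)"
    by (simp add: grad2_def nn_integral_add[symmetric] ennreal_plus)
  \<comment> \<open>18 = 8 + 8 + 2: each of the two derivatives of the cutoff contributes 2 * 4, the
    logarithm 2 * 1.\<close>
  also have "\<dots> \<le> (\<integral>\<^sup>+x. ennreal (2 * energy u x + 18 * q x) \<partial>lborel)"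
  proof (intro nn_integral_mono ennreal_leI)
    fix x
    have ch: "(cutoff x)\<^sup>2 \<le> 1" using cutoff_le_1[of x] by (simp add: power_le_one)
    have chu: "(norm (cutoff x *\<^sub>R w))\<^sup>2 \<le> (norm w)\<^sup>2" for w :: complex
      using mult_right_mono[OF ch, of "(norm w)\<^sup>2"] by (simp add: power_mult_distrib)
    have gq: "(norm (g j x *\<^sub>R u x))\<^sup>2 \<le> 4 * q x" if "j \<noteq> 3" for j
      using mult_right_mono[OF cutoff_gradient_le[OF that, of x], of "(norm (u x))\<^sup>2"]
      by (simp add: power_mult_distrib g_def q_def)
    have ne: "(1::3) \<noteq> 3" "(2::3) \<noteq> 3" by simp_all
    have 1: "(norm (f1 x))\<^sup>2 \<le> 2 * (norm (u1 x))\<^sup>2 + 8 * q x"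
      using norm_add_power2_le[of "cutoff x *\<^sub>R u1 x" "g 1 x *\<^sub>R u x"] chu[of "u1 x"] gq[OF ne(1)]
      unfolding f1_def by linarith
    have 2: "(norm (f2 x))\<^sup>2 \<le> 2 * (norm (u2 x))\<^sup>2 + 8 * q x"
      using norm_add_power2_le[of "cutoff x *\<^sub>R u2 x" "g 2 x *\<^sub>R u x"] chu[of "u2 x"] gq[OF ne(2)]
      unfolding f2_def by linarith
    define b where "b = u3 x - \<i> * (ln_rad x *\<^sub>R u x)"
    have f3_eq: "f3 x = cutoff x *\<^sub>R b + (cutoff x * ln_rad x) *\<^sub>R (\<i> * u x)"
      by (simp add: f3_def b_def algebra_simps)
    have "(norm ((cutoff x * ln_rad x) *\<^sub>R (\<i> * u x)))\<^sup>2 \<le> q x"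
      using mult_right_mono[OF cutoff_ln_rad_le[of x], of "(norm (u x))\<^sup>2"]
      by (simp add: power_mult_distrib norm_mult q_def)
    then have 3: "(norm (f3 x))\<^sup>2 \<le> 2 * (norm b)\<^sup>2 + 2 * q x"
      using norm_add_power2_le[of "cutoff x *\<^sub>R b" "(cutoff x * ln_rad x) *\<^sub>R (\<i> * u x)"] chu[of b]
      unfolding f3_eq by linarith
    have "energy u x = (norm (u1 x))\<^sup>2 + (norm (u2 x))\<^sup>2 + (norm b)\<^sup>2"
      by (simp add: energy_def u1_def u2_def u3_def b_def)
    then show "(norm (f1 x))\<^sup>2 + (norm (f2 x))\<^sup>2 + (norm (f3 x))\<^sup>2 \<le> 2 * energy u x + 18 * q x"
      using 1 2 3 by linarith
  qed
  also have "\<dots> = ennreal (\<integral>x. 2 * energy u x + 18 * q x \<partial>lborel)"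
  proof (rule nn_integral_eq_integral)
    show "integrable lborel (\<lambda>x. 2 * energy u x + 18 * q x)"
      unfolding q_def
      by (intro Bochner_Integration.integrable_add integrable_mult_right integrable_energy integrable_inverse_bracket u)
    have "0 \<le> q x" for x using bracket_ge_1[of x] by (simp add: q_def)
    then show "AE x in lborel. 0 \<le> 2 * energy u x + 18 * q x"
      using energy_nonneg[of u] by (auto intro: add_nonneg_nonneg)
  qed
  also have "(\<integral>x. 2 * energy u x + 18 * q x \<partial>lborel) = 2 * total_energy u + 18 * (\<integral>x. q x \<partial>lborel)"
    unfolding q_def
    by (simp only: Bochner_Integration.integral_add[OF integrable_mult_right[OF integrable_energy[OF u]]
      integrable_mult_right[OF integrable_inverse_bracket[OF u]]] integral_mult_right_zero)
  \<comment> \<open>110 = 2 + 18 * 6 by the Hardy inequality.\<close>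
  also have "ennreal \<dots> \<le> ennreal (110 * total_energy u)"
    using hardy_inequality[OF u] unfolding q_def by (intro ennreal_leI) simp
  finally have G: "grad2 f1 f2 f3 \<le> ennreal (110 * total_energy u)" .
  have "(\<integral>\<^sup>+x. indicator {x. cell s x \<in> K} x * ennreal ((norm (f x))\<^sup>2) \<partial>lborel)
    \<le> ennreal (48 * s\<^sup>2) * grad2 f1 f2 f3
      + ennreal (2 / s ^ 3 * (\<Sum>k\<in>K. (norm (\<integral>y. indicator {y. cell s y = k} y *\<^sub>R f y \<partial>lborel))\<^sup>2))"
    by (rule grid_poincare[OF s K pf cf Rf])
  also have "ennreal (48 * s\<^sup>2) * grad2 f1 f2 f3 \<le> ennreal (48 * s\<^sup>2) * ennreal (110 * total_energy u)"
    by (intro mult_left_mono G) simp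
  also have "\<dots> = ennreal (48 * s\<^sup>2 * 110 * total_energy u)"
    by (simp add: ennreal_mult[symmetric] energy_nonneg mult.assoc)
  finally show ?thesis
    unfolding f_def by (simp add: add_right_mono)
qed

section \<open>Form bounds for the separate pieces of the potential\<close>

lemma nn_integral_inverse_bracket_le:
  assumes "test_function u"
  shows "(\<integral>\<^sup>+x. ennreal ((norm (u x))\<^sup>2 / bracket x) \<partial>lborel) \<le> ennreal (6 * total_energy u)"
proof -
  have "0 \<le> bracket x" for x using bracket_ge_1[of x] by linarith
  then show ?thesis
    using hardy_inequality[OF assms] by (subst nn_integral_eq_integral[OF integrable_inverse_bracket[OF assms]]) (auto intro: ennreal_leI)
qed

text \<open>The trace inequality is applied to the squared modulus of \<open>u\<close>, whose third
  derivative sees only the magnetic derivative. The weight is shared with \<open>u\<close> in a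
  product of two squares, which turns it into the Hardy weight: 7 = 6 + 1.\<close>

lemma magnetic_trace_inequality:
  assumes u: "test_function u" and \<alpha>: "1 \<le> \<alpha>" and [measurable]: "v \<in> borel_measurable borel"
  shows "(\<integral>\<^sup>+x. v (x $ 3) * ennreal (bracket x powr (- \<alpha>)) * ennreal ((norm (u x))\<^sup>2) \<partial>lborel)
    \<le> (\<integral>\<^sup>+z. v z \<partial>lborel) * ennreal (7 * total_energy u)"
proof -
  define u3 where "u3 = partial_deriv 3 u"
  have t: "test_function u3" unfolding u3_def by (intro test_function_partial_deriv u)
  have pu: "has_partial u u3 3" unfolding u3_def by (intro test_function_has_partial u)
  obtain R where R: "supported_in R u" using test_function_supported[OF u] by metis
  define m where "m x = ennreal (bracket x powr (- \<alpha>))" for x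
  have [measurable]: "m \<in> borel_measurable borel" unfolding m_def[abs_def] by measurable
  define f' where "f' x = u x \<bullet> u3 x + u3 x \<bullet> u x" for x
  have "(\<integral>\<^sup>+x. v (x $ 3) * m x * ennreal (u x \<bullet> u x) \<partial>lborel)
    \<le> (\<integral>\<^sup>+z. v z \<partial>lborel) * (\<integral>\<^sup>+x. m x * ennreal \<bar>f' x\<bar> \<partial>lborel)"
  proof (rule trace_inequality)
    show "has_partial (\<lambda>x. u x \<bullet> u x) f' 3"
      unfolding f'_def[abs_def] by (intro has_partial_inner pu)
    show "continuous_on UNIV f'"
      unfolding f'_def[abs_def] by (intro continuous_intros test_function_continuous u t)
    show "supported_in R (\<lambda>x. u x \<bullet> u x)" using R by (simp add: supported_in_def)
    show "m (x + t *\<^sub>R axis 3 1) = m x" for x t by (simp add: m_def bracket_def rad2_invariant)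
  qed measurable
  also have "(\<integral>\<^sup>+x. m x * ennreal \<bar>f' x\<bar> \<partial>lborel) \<le> (\<integral>\<^sup>+x. ennreal ((norm (u x))\<^sup>2 / bracket x + energy u x) \<partial>lborel)"
  proof (rule nn_integral_mono)
    fix x
    define b where "b = u3 x - \<i> * (ln_rad x *\<^sub>R u x)"
    define M where "M = bracket x powr (- \<alpha>)"
    have M: "0 \<le> M" "M\<^sup>2 \<le> 1 / bracket x"
    proof -
      have "M\<^sup>2 = bracket x powr (- (2 * \<alpha>))"
        using bracket_ge_1[of x] by (simp add: M_def powr_power)
      also have "\<dots> \<le> bracket x powr (- 1)"
        using bracket_ge_1[of x] \<alpha> by (intro powr_mono) auto
      also have "\<dots> = 1 / bracket x"
        using bracket_ge_1[of x] by (simp add: powr_minus_divide)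
      finally show "M\<^sup>2 \<le> 1 / bracket x" .
    qed (simp add: M_def)
    \<comment> \<open>The term with log r drops out because \<open>u\<close> and
      \<open>\<i> * u\<close> are orthogonal for the real inner product.\<close>
    have "f' x = 2 * (u x \<bullet> b)"
      by (simp add: f'_def b_def inner_commute inner_complex_def algebra_simps)
    then have "M * \<bar>f' x\<bar> \<le> 2 * (M * norm (u x) * norm b)"
      using mult_left_mono[OF Cauchy_Schwarz_ineq2[of "u x" b] M(1)] by (simp add: abs_mult mult_ac)
    also have "\<dots> \<le> (M * norm (u x))\<^sup>2 + (norm b)\<^sup>2"
      using zero_le_power2[of "M * norm (u x) - norm b"] by (simp add: power2_diff)
    also have "(M * norm (u x))\<^sup>2 \<le> (norm (u x))\<^sup>2 / bracket x"
      using mult_right_mono[OF M(2), of "(norm (u x))\<^sup>2"] by (simp add: power_mult_distrib)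
    also have "(norm b)\<^sup>2 \<le> energy u x"
      by (simp add: energy_def b_def u3_def)
    finally show "m x * ennreal \<bar>f' x\<bar> \<le> ennreal ((norm (u x))\<^sup>2 / bracket x + energy u x)"
      unfolding m_def M_def[symmetric] using M by (subst ennreal_mult[symmetric]) (auto intro: ennreal_leI)
  qed
  also have "\<dots> \<le> ennreal (7 * total_energy u)"
  proof -
    have pos: "0 < bracket x" for x using bracket_ge_1[of x] by linarith
    have "(\<integral>\<^sup>+x. ennreal ((norm (u x))\<^sup>2 / bracket x + energy u x) \<partial>lborel)
      = ennreal (\<integral>x. (norm (u x))\<^sup>2 / bracket x + energy u x \<partial>lborel)"
    proof (intro nn_integral_eq_integral Bochner_Integration.integrable_add integrable_energy integrable_inverse_bracket u AE_I2)
      show "0 \<le> (norm (u x))\<^sup>2 / bracket x + energy u x" for x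
        using pos[of x] by (intro add_nonneg_nonneg energy_nonneg divide_nonneg_nonneg) auto
    qed
    also have "\<dots> \<le> ennreal (7 * total_energy u)"
      using hardy_inequality[OF u] integrable_energy[OF u] integrable_inverse_bracket[OF u] by (intro ennreal_leI) simp
    finally show ?thesis .
  qed
  finally show ?thesis
    by (simp add: m_def dot_square_norm mult_left_mono)
qed

lemma ennreal_mult_add:
  "0 \<le> a \<Longrightarrow> 0 \<le> b \<Longrightarrow> 0 \<le> c \<Longrightarrow> ennreal a * (ennreal b + ennreal c) = ennreal (a * (b + c))"
  by (simp add: ennreal_mult ennreal_plus)

text \<open>Three regions: for <r> at least \<rho> the weight is at most \<rho>^(1 - \<alpha>)/<r>,
  which Hardy bounds; for r at most \<delta> the thin cylinder applies; elsewhere the cutoff is at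
  least \<open>c\<close> and the grid inequality applies, with 5280 = 48 * 110.\<close>

lemma core_bound:
  assumes u: "test_function u" and \<rho>: "1 \<le> \<rho>" and \<alpha>: "1 < \<alpha>" and \<delta>: "0 < \<delta>" "\<delta> \<le> 1"
    and s: "0 < s" and K: "finite K" "\<And>x. bracket x < \<rho> \<Longrightarrow> \<bar>x $ 3\<bar> \<le> real n \<Longrightarrow> cell s x \<in> K"
  defines "E \<equiv> total_energy u" and "c \<equiv> \<delta>\<^sup>2 / (1 + \<rho>\<^sup>2)\<^sup>2"
  shows "(\<integral>\<^sup>+x. indicator {- real n..real n} (x $ 3) * ennreal (bracket x powr (- \<alpha>)) * ennreal ((norm (u x))\<^sup>2) \<partial>lborel)
    \<le> ennreal ((6 * \<rho> powr (1 - \<alpha>) + 49 * \<delta> + 5280 * s\<^sup>2 / c\<^sup>2) * E)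
      + ennreal (2 / s ^ 3 / c\<^sup>2 * cell_moments s K u)"
proof -
  have c: "0 < c" using \<delta> by (simp add: c_def add_nonneg_eq_0_iff)
  have E: "0 \<le> E" by (simp add: E_def energy_nonneg)
  have [measurable]: "u \<in> borel_measurable borel" "cutoff \<in> borel_measurable borel"
    by (intro borel_measurable_continuous_onI test_function_continuous u continuous_on_cutoff)+
  have [measurable]: "{x. cell s x \<in> K} \<in> sets borel"
  proof -
    have "{x. cell s x \<in> K} = (\<Union>k\<in>K. {x. cell s x = k})" by auto
    then show ?thesis using K(1) s sets_cell by auto
  qed
  define N where "N x = (norm (u x))\<^sup>2" for x
  have [measurable]: "N \<in> borel_measurable borel" unfolding N_def[abs_def] by measurable
  have "(\<integral>\<^sup>+x. indicator {- real n..real n} (x $ 3) * ennreal (bracket x powr (- \<alpha>)) * ennreal (N x) \<partial>lborel)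
    \<le> (\<integral>\<^sup>+x. ennreal (\<rho> powr (1 - \<alpha>)) * ennreal (N x / bracket x) + ennreal (indicator {x. rad2 x \<le> \<delta>\<^sup>2} x * N x)
        + ennreal (1 / c\<^sup>2) * (indicator {x. cell s x \<in> K} x * ennreal ((norm (cutoff x *\<^sub>R u x))\<^sup>2)) \<partial>lborel)"
  proof (rule nn_integral_mono)
    fix x
    have N0: "0 \<le> N x" by (simp add: N_def)
    have br: "1 \<le> bracket x" by (rule bracket_ge_1)
    define A where "A = ennreal (\<rho> powr (1 - \<alpha>)) * ennreal (N x / bracket x)"
    define B where "B = ennreal (indicator {x. rad2 x \<le> \<delta>\<^sup>2} x * N x)"
    define D where "D = ennreal (1 / c\<^sup>2) * (indicator {x. cell s x \<in> K} x * ennreal ((norm (cutoff x *\<^sub>R u x))\<^sup>2))"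
    define L where "L = ennreal (bracket x powr (- \<alpha>)) * ennreal (N x)"
    have le1: "bracket x powr (- \<alpha>) \<le> 1"
      using br \<alpha> powr_mono[of "- \<alpha>" 0 "bracket x"] by simp
    have L1: "L \<le> ennreal (N x)"
      unfolding L_def using le1 N0 by (subst ennreal_mult[symmetric]) (auto intro!: ennreal_leI mult_left_le_one_le)
    have "L \<le> A + B + D" if n: "\<bar>x $ 3\<bar> \<le> real n"
    proof -
      consider "\<rho> \<le> bracket x" | "rad2 x \<le> \<delta>\<^sup>2" | "bracket x < \<rho>" "\<delta>\<^sup>2 < rad2 x" by linarith
      then show ?thesis
      proof cases
        case 1
        have "bracket x powr (- \<alpha>) = bracket x powr (1 - \<alpha>) * bracket x powr (- 1)"
          by (simp only: powr_add[symmetric]) simp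
        also have "\<dots> = bracket x powr (1 - \<alpha>) / bracket x"
          using br by (simp add: powr_minus_divide)
        also have "\<dots> \<le> \<rho> powr (1 - \<alpha>) / bracket x"
          using 1 br \<rho> \<alpha> by (intro divide_right_mono powr_mono2') auto
        finally have "bracket x powr (- \<alpha>) * N x \<le> \<rho> powr (1 - \<alpha>) / bracket x * N x"
          using N0 by (rule mult_right_mono)
        then have "L \<le> A"
          unfolding L_def A_def using N0 br
          by (subst (1 2) ennreal_mult[symmetric]) (auto intro!: ennreal_leI)
        then show ?thesis by (simp add: add_increasing2)
      next
        case 2
        then have "L \<le> B" using L1 by (simp add: B_def)
        then show ?thesis by (simp add: add_increasing2 add_increasing)
      next
        case 3
        have cK: "cell s x \<in> K" using K(2) 3 n by blast
        \<comment> \<open>In this region the numerator of the cutoff exceeds the square of \<delta>,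
          and its denominator is bounded through \<open>\<rho>\<close>.\<close>
        have "c \<le> cutoff x"
        proof -
          have "1 + rad2 x = (bracket x)\<^sup>2" by (simp add: bracket_def)
          also have "\<dots> \<le> \<rho>\<^sup>2" using 3 br by (intro power_mono) auto
          finally have "1 + rad2 x \<le> 1 + \<rho>\<^sup>2" by simp
          then have "(1 + rad2 x)\<^sup>2 \<le> (1 + \<rho>\<^sup>2)\<^sup>2" by (intro power_mono) auto
          then show ?thesis
            unfolding c_def cutoff_def using 3 \<delta>
            by (intro frac_le) (auto simp: add_nonneg_eq_0_iff zero_less_power2)
        qed
        then have "c\<^sup>2 \<le> (cutoff x)\<^sup>2" using c by (intro power_mono) auto
        then have "1 \<le> 1 / c\<^sup>2 * (cutoff x)\<^sup>2" using c by (simp add: field_simps)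
        then have "1 * N x \<le> 1 / c\<^sup>2 * (cutoff x)\<^sup>2 * N x" using N0 by (rule mult_right_mono)
        also have "\<dots> = 1 / c\<^sup>2 * (norm (cutoff x *\<^sub>R u x))\<^sup>2"
          by (simp add: N_def power_mult_distrib)
        finally have "ennreal (N x) \<le> D"
          unfolding D_def using cK by (simp add: ennreal_mult[symmetric] ennreal_leI)
        then have "L \<le> D" using L1 by (rule order_trans[rotated])
        then show ?thesis by (simp add: add_increasing)
      qed
    qed
    then show "indicator {- real n..real n} (x $ 3) * ennreal (bracket x powr (- \<alpha>)) * ennreal (N x) \<le> A + B + D"
      by (auto simp: L_def indicator_def)
  qed
  also have "\<dots> = ennreal (\<rho> powr (1 - \<alpha>)) * (\<integral>\<^sup>+x. ennreal (N x / bracket x) \<partial>lborel)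
      + (\<integral>\<^sup>+x. ennreal (indicator {x. rad2 x \<le> \<delta>\<^sup>2} x * N x) \<partial>lborel)
      + ennreal (1 / c\<^sup>2) * (\<integral>\<^sup>+x. indicator {x. cell s x \<in> K} x * ennreal ((norm (cutoff x *\<^sub>R u x))\<^sup>2) \<partial>lborel)"
    by (simp add: nn_integral_add nn_integral_cmult)
  also have "\<dots> \<le> ennreal (\<rho> powr (1 - \<alpha>)) * ennreal (6 * E) + ennreal (49 * \<delta> * E)
      + ennreal (1 / c\<^sup>2) * (ennreal (48 * s\<^sup>2 * 110 * E)
      + ennreal (2 / s ^ 3 * cell_moments s K u))"
  proof (intro add_mono mult_left_mono)
    show "(\<integral>\<^sup>+x. ennreal (N x / bracket x) \<partial>lborel) \<le> ennreal (6 * E)"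
      unfolding N_def E_def by (rule nn_integral_inverse_bracket_le[OF u])
    have "integrable lborel (\<lambda>x. indicator {x. rad2 x \<le> \<delta>\<^sup>2} x *\<^sub>R N x)"
      unfolding N_def by (intro integrable_mult_indicator integrable_partial_norm2 u) measurable
    then have "(\<integral>\<^sup>+x. ennreal (indicator {x. rad2 x \<le> \<delta>\<^sup>2} x * N x) \<partial>lborel)
      = ennreal (\<integral>x. indicator {x. rad2 x \<le> \<delta>\<^sup>2} x * N x \<partial>lborel)"
      by (intro nn_integral_eq_integral) (auto simp: N_def)
    also have "\<dots> \<le> ennreal (49 * \<delta> * E)"
      unfolding N_def E_def by (intro ennreal_leI thin_cylinder_bound u \<delta>)
    finally show "(\<integral>\<^sup>+x. ennreal (indicator {x. rad2 x \<le> \<delta>\<^sup>2} x * N x) \<partial>lborel) \<le> ennreal (49 * \<delta> * E)" .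
    show "(\<integral>\<^sup>+x. indicator {x. cell s x \<in> K} x * ennreal ((norm (cutoff x *\<^sub>R u x))\<^sup>2) \<partial>lborel)
      \<le> ennreal (48 * s\<^sup>2 * 110 * E)
      + ennreal (2 / s ^ 3 * cell_moments s K u)"
      unfolding E_def by (rule cutoff_grid_poincare[OF u s K(1)])
  qed auto
  also have "\<dots> = ennreal ((6 * \<rho> powr (1 - \<alpha>) + 49 * \<delta> + 5280 * s\<^sup>2 / c\<^sup>2) * E)
      + ennreal (2 / s ^ 3 / c\<^sup>2 * cell_moments s K u)"
  proof -
    define S where "S = cell_moments s K u"
    have S: "0 \<le> S" by (simp add: S_def sum_nonneg)
    have 1: "ennreal (\<rho> powr (1 - \<alpha>)) * ennreal (6 * E) = ennreal (\<rho> powr (1 - \<alpha>) * (6 * E))"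
      using E by (intro ennreal_mult[symmetric]) auto
    have 2: "ennreal (1 / c\<^sup>2) * (ennreal (48 * s\<^sup>2 * 110 * E) + ennreal (2 / s ^ 3 * S))
      = ennreal (1 / c\<^sup>2 * (48 * s\<^sup>2 * 110 * E + 2 / s ^ 3 * S))"
      by (rule ennreal_mult_add) (use E S s in auto)
    have 3: "1 / c\<^sup>2 * (48 * s\<^sup>2 * 110 * E + 2 / s ^ 3 * S) = 5280 * s\<^sup>2 / c\<^sup>2 * E + 2 / s ^ 3 / c\<^sup>2 * S"
      by (simp add: distrib_left add_divide_distrib mult_ac)
    have gather: "ennreal p + ennreal q + ennreal (r + t) = ennreal (p + q + r) + ennreal t"
      if "0 \<le> p" "0 \<le> q" "0 \<le> r" "0 \<le> t" for p q r t
      using that by (simp add: ennreal_plus add_ac)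
    have nn: "0 \<le> \<rho> powr (1 - \<alpha>) * (6 * E)" "0 \<le> 49 * \<delta> * E" "0 \<le> 5280 * s\<^sup>2 / c\<^sup>2 * E" "0 \<le> 2 / s ^ 3 / c\<^sup>2 * S"
      using E S s \<delta> by auto
    show ?thesis
      unfolding S_def[symmetric] 1 2 3 gather[OF nn]
      by (intro arg_cong2[where f = "(+)"] arg_cong[where f = ennreal] refl) (simp add: algebra_simps)
  qed
  finally show ?thesis by (simp add: N_def)
qed

text \<open>All parameters are chosen here, in an order that avoids circularity: \<eta> first, which
  determines \<open>n\<close>; then \<rho> and \<delta> in terms of \<open>n\<close>; then the lower
  bound \<open>c\<close> of the cutoff; and last the side \<open>s\<close> of the cubes.
  \<open>C\<close> may be large, since it only multiplies the moments.\<close>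

lemma form_bound_test_functions:
  assumes v: "in_Lp p v" "\<And>z. 0 \<le> v z" and p: "1 \<le> p" and \<alpha>: "1 < \<alpha>"
  obtains W :: "real^3 \<Rightarrow> ennreal" and K :: "(3 \<Rightarrow> int) set" and s C :: real
  where "W \<in> borel_measurable borel" "\<And>x. ennreal (bracket x powr (- \<alpha>) * v (x $ 3)) \<le> W x"
    and "finite K" "0 < s" "0 \<le> C"
    and "\<And>u. test_function u \<Longrightarrow> (\<integral>\<^sup>+x. W x * ennreal ((norm (u x))\<^sup>2) \<partial>lborel)
      \<le> ennreal (total_energy u / 2
        + C * cell_moments s K u)"
proof -
  \<comment> \<open>The small L1 part costs 7 \<eta> and the small constant 6 \<eta>, together
    13/104 = 1/8 of the energy.\<close>
  define \<eta> :: real where "\<eta> = 1 / 104"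
  obtain v1 and n :: nat where v1[measurable]: "v1 \<in> borel_measurable borel"
    and v1i: "(\<integral>\<^sup>+z. v1 z \<partial>lborel) \<le> ennreal \<eta>" and n: "1 \<le> n"
    and v_le: "\<And>z. ennreal (v z) \<le> v1 z + ennreal \<eta> + ennreal n * indicator {- real n..real n} z"
    using Lp_majorant[OF v p, of \<eta>] by (auto simp: \<eta>_def)
  \<comment> \<open>Solves n * 6 * \<rho>^(1 - \<alpha>) = 1/8, which is possible because \<alpha> >
    1 makes the power of \<rho> decay.\<close>
  define \<rho> where "\<rho> = (48 * real n) powr (1 / (\<alpha> - 1))"
  have \<rho>: "1 \<le> \<rho>" using n \<alpha> by (auto simp: \<rho>_def intro!: ge_one_powr_ge_zero)
  have \<rho>n: "real n * (6 * \<rho> powr (1 - \<alpha>)) = 1 / 8"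
  proof -
    have "\<rho> powr (1 - \<alpha>) = (48 * real n) powr (- 1)"
    proof -
      have "1 / (\<alpha> - 1) * (1 - \<alpha>) = - 1" using \<alpha> by (simp add: divide_simps)
      then show ?thesis by (simp only: \<rho>_def powr_powr)
    qed
    then show ?thesis using n by (simp add: powr_minus_divide)
  qed
  \<comment> \<open>392 = 8 * 49 gives the thin cylinder its share of 1/8.\<close>
  define \<delta> where "\<delta> = 1 / (392 * real n)"
  have \<delta>: "0 < \<delta>" "\<delta> \<le> 1" "real n * (49 * \<delta>) = 1 / 8" using n by (auto simp: \<delta>_def field_simps)
  define c where "c = \<delta>\<^sup>2 / (1 + \<rho>\<^sup>2)\<^sup>2"
  have c: "0 < c" using \<delta> by (simp add: c_def add_nonneg_eq_0_iff)
  \<comment> \<open>42240 = 8 * 5280 gives the gradient term of the grid its share of 1/8.\<close>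
  define s where "s = c / sqrt (42240 * real n)"
  have s: "0 < s" "real n * (5280 * s\<^sup>2 / c\<^sup>2) = 1 / 8"
    using c n by (auto simp: s_def power_divide field_simps)
  \<comment> \<open>A bound for the labels of all cubes that meet the bounded region; the extra 1
    leaves room for rounding down.\<close>
  define M where "M = \<lceil>(\<rho> + real n) / s\<rceil> + 1"
  define K where "K = {k :: 3 \<Rightarrow> int. \<forall>i. k i \<in> {-M..M}}"
  have K: "finite K"
  proof -
    have "K = PiE UNIV (\<lambda>_. {-M..M})" by (auto simp: K_def PiE_UNIV_domain)
    then show ?thesis by (simp add: finite_PiE)
  qed
  have cellK: "cell s x \<in> K" if "bracket x < \<rho>" "\<bar>x $ 3\<bar> \<le> real n" for x
  proof -
    have "\<bar>x $ i\<bar> \<le> \<rho> + real n" for i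
    proof (cases "i = 3")
      case False
      then have "(x $ i)\<^sup>2 \<le> 1 + rad2 x" using exhaust_3[of i] by (auto simp: rad2_def)
      then have "\<bar>x $ i\<bar> \<le> bracket x" unfolding bracket_def by (intro real_le_rsqrt) simp
      then show ?thesis using that by simp
    qed (use that \<rho> in auto)
    then have "\<bar>x $ i / s\<bar> \<le> (\<rho> + real n) / s" for i using s by (simp add: divide_right_mono)
    then have A: "\<bar>x $ i / s\<bar> \<le> real_of_int \<lceil>(\<rho> + real n) / s\<rceil>" for i
      using le_of_int_ceiling order_trans by blast
    have "- M \<le> \<lfloor>x $ i / s\<rfloor>" "\<lfloor>x $ i / s\<rfloor> \<le> M" for i
    proof -
      have "real_of_int \<lfloor>x $ i / s\<rfloor> \<le> x $ i / s" "x $ i / s < real_of_int \<lfloor>x $ i / s\<rfloor> + 1"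
        by linarith+
      moreover have "x $ i / s \<le> real_of_int \<lceil>(\<rho> + real n) / s\<rceil>" "- (x $ i / s) \<le> real_of_int \<lceil>(\<rho> + real n) / s\<rceil>"
        using A[of i] unfolding abs_le_iff by blast+
      ultimately have "real_of_int (- M) \<le> real_of_int \<lfloor>x $ i / s\<rfloor>"
        "real_of_int \<lfloor>x $ i / s\<rfloor> \<le> real_of_int M"
        unfolding M_def of_int_minus of_int_add of_int_1 by linarith+
      then show "- M \<le> \<lfloor>x $ i / s\<rfloor>" "\<lfloor>x $ i / s\<rfloor> \<le> M"
        by (simp_all only: of_int_le_iff)
    qed
    then show ?thesis by (simp add: K_def cell_def)
  qed
  define m where "m x = ennreal (bracket x powr (- \<alpha>))" for x
  define W where "W x = m x * (v1 (x $ 3) + ennreal \<eta> + ennreal n * indicator {- real n..real n} (x $ 3))" for x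
  define C where "C = real n * (2 / s ^ 3 / c\<^sup>2)"
  have [measurable]: "m \<in> borel_measurable borel" unfolding m_def[abs_def] by measurable
  have [measurable]: "(\<lambda>x::real^3. x $ 3) \<in> borel_measurable borel"
    by (intro borel_measurable_continuous_onI continuous_intros)
  show ?thesis
  proof (rule that[of W K s C])
    show "W \<in> borel_measurable borel" unfolding W_def[abs_def] by measurable
    show "ennreal (bracket x powr (- \<alpha>) * v (x $ 3)) \<le> W x" for x
      unfolding W_def m_def using v(2) v_le by (subst ennreal_mult) (auto intro: mult_left_mono)
    show "finite K" by (rule K)
    show "0 < s" by (rule s)
    show "0 \<le> C" using s c by (simp add: C_def)
    fix u :: "real^3 \<Rightarrow> complex" assume u: "test_function u"
    define E where "E = total_energy u"
    have E: "0 \<le> E" by (simp add: E_def energy_nonneg)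
    define S where "S = cell_moments s K u"
    have S: "0 \<le> S" by (simp add: S_def sum_nonneg)
    have [measurable]: "u \<in> borel_measurable borel"
      by (intro borel_measurable_continuous_onI test_function_continuous u)
    define N where "N x = ennreal ((norm (u x))\<^sup>2)" for x
    have [measurable]: "N \<in> borel_measurable borel" unfolding N_def[abs_def] by measurable
    have "(\<integral>\<^sup>+x. W x * N x \<partial>lborel) = (\<integral>\<^sup>+x. v1 (x $ 3) * m x * N x + ennreal \<eta> * (m x * N x)
        + ennreal n * (indicator {- real n..real n} (x $ 3) * m x * N x) \<partial>lborel)"
      unfolding W_def by (intro nn_integral_cong) (simp add: distrib_left distrib_right mult_ac)
    also have "\<dots> = (\<integral>\<^sup>+x. v1 (x $ 3) * m x * N x \<partial>lborel) + ennreal \<eta> * (\<integral>\<^sup>+x. m x * N x \<partial>lborel)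
        + ennreal n * (\<integral>\<^sup>+x. indicator {- real n..real n} (x $ 3) * m x * N x \<partial>lborel)"
      by (simp add: nn_integral_add nn_integral_cmult)
    also have "\<dots> \<le> ennreal \<eta> * ennreal (7 * E) + ennreal \<eta> * ennreal (6 * E)
        + ennreal n * (ennreal ((6 * \<rho> powr (1 - \<alpha>) + 49 * \<delta> + 5280 * s\<^sup>2 / c\<^sup>2) * E) + ennreal (2 / s ^ 3 / c\<^sup>2 * S))"
    proof (intro add_mono mult_left_mono)
      have "(\<integral>\<^sup>+x. v1 (x $ 3) * m x * N x \<partial>lborel) \<le> (\<integral>\<^sup>+z. v1 z \<partial>lborel) * ennreal (7 * E)"
        unfolding m_def N_def E_def using \<alpha> by (intro magnetic_trace_inequality u) auto
      also have "\<dots> \<le> ennreal \<eta> * ennreal (7 * E)" by (intro mult_right_mono v1i) simp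
      finally show "(\<integral>\<^sup>+x. v1 (x $ 3) * m x * N x \<partial>lborel) \<le> ennreal \<eta> * ennreal (7 * E)" .
      have "(\<integral>\<^sup>+x. m x * N x \<partial>lborel) \<le> (\<integral>\<^sup>+x. ennreal ((norm (u x))\<^sup>2 / bracket x) \<partial>lborel)"
      proof (rule nn_integral_mono)
        fix x
        have "bracket x powr (- \<alpha>) \<le> bracket x powr (- 1)"
          using bracket_ge_1[of x] \<alpha> by (intro powr_mono) auto
        then have "bracket x powr (- \<alpha>) \<le> 1 / bracket x"
          using bracket_ge_1[of x] by (simp add: powr_minus_divide)
        then have "bracket x powr (- \<alpha>) * (norm (u x))\<^sup>2 \<le> 1 / bracket x * (norm (u x))\<^sup>2"
          by (rule mult_right_mono) simp
        then show "m x * N x \<le> ennreal ((norm (u x))\<^sup>2 / bracket x)"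
          unfolding m_def N_def by (subst ennreal_mult[symmetric]) (auto intro: ennreal_leI)
      qed
      also have "\<dots> \<le> ennreal (6 * E)" unfolding E_def by (rule nn_integral_inverse_bracket_le[OF u])
      finally show "(\<integral>\<^sup>+x. m x * N x \<partial>lborel) \<le> ennreal (6 * E)" .
      show "(\<integral>\<^sup>+x. indicator {- real n..real n} (x $ 3) * m x * N x \<partial>lborel)
        \<le> ennreal ((6 * \<rho> powr (1 - \<alpha>) + 49 * \<delta> + 5280 * s\<^sup>2 / c\<^sup>2) * E) + ennreal (2 / s ^ 3 / c\<^sup>2 * S)"
        unfolding m_def N_def E_def S_def c_def
        by (rule core_bound[OF u \<rho> \<alpha> \<delta>(1,2) s(1) K cellK])
    qed auto
    also have "\<dots> = ennreal (E / 2 + C * S)"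
    proof -
      define q where "q = 6 * \<rho> powr (1 - \<alpha>) + 49 * \<delta> + 5280 * s\<^sup>2 / c\<^sup>2"
      have nq: "real n * q = 3 / 8"
        unfolding q_def distrib_left \<rho>n \<delta>(3) s(2) by simp
      have q: "0 \<le> q" using \<delta> by (simp add: q_def)
      have 1: "ennreal \<eta> * ennreal (7 * E) = ennreal (\<eta> * (7 * E))" "ennreal \<eta> * ennreal (6 * E) = ennreal (\<eta> * (6 * E))"
        by (rule ennreal_mult[symmetric]; use E in \<open>simp add: \<eta>_def\<close>)+
      have t: "0 \<le> 2 / s ^ 3 / c\<^sup>2 * S" using S s by auto
      have 2: "ennreal n * (ennreal (q * E) + ennreal (2 / s ^ 3 / c\<^sup>2 * S)) = ennreal (real n * (q * E + 2 / s ^ 3 / c\<^sup>2 * S))"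
        by (rule ennreal_mult_add) (use E q t in auto)
      have 3: "real n * (q * E + 2 / s ^ 3 / c\<^sup>2 * S) = 3 / 8 * E + C * S"
        unfolding distrib_left mult.assoc[symmetric] nq by (simp add: C_def)
      have "0 \<le> C * S" using S s c by (simp add: C_def)
      then show ?thesis
        unfolding q_def[symmetric] 1 2 3 using E
        by (simp add: ennreal_plus[symmetric] \<eta>_def del: ennreal_plus)
    qed
    finally show "(\<integral>\<^sup>+x. W x * ennreal ((norm (u x))\<^sup>2) \<partial>lborel)
      \<le> ennreal (total_energy u / 2
        + C * cell_moments s K u)"
      by (simp add: N_def E_def S_def)
  qed
qed

section \<open>Representatives\<close>

lemma square_integrable_rep_l2 [simp]: "square_integrable (rep_l2 u)"
  using Quotient_rep_reflp[OF Quotient_l2] by blast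

lemma abs_rep_l2 [simp]: "abs_l2 (rep_l2 u) = u"
  using Quotient3_abs_rep[OF Quotient3_l2] by blast

lemma represents_abs_l2: "square_integrable f \<Longrightarrow> represents f (abs_l2 f)"
  using Quotient3_rep_abs[OF Quotient3_l2, of f] unfolding represents_def by (auto elim: eventually_mono)

lemma inner_l2_eq: "u \<bullet> v = (\<integral>x. rep_l2 u x \<bullet> rep_l2 v x \<partial>lebesgue)"
  using inner_l2.abs_eq[of "rep_l2 u" "rep_l2 v"] by simp

lemma rep_l2_measurable [measurable]: "rep_l2 u \<in> borel_measurable lebesgue"
  using square_integrable_rep_l2[of u] unfolding square_integrable_def by blast

text \<open>Connects the Hilbert space, built over complete Lebesgue measure, with the calculus
  above, done with Borel functions.\<close>

lemma inner_represents:
  assumes "represents f u" "represents g v" "f \<in> borel_measurable borel" "g \<in> borel_measurable borel"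
  shows "u \<bullet> v = (\<integral>x. f x \<bullet> g x \<partial>lborel)"
proof -
  have [measurable]: "f \<in> borel_measurable lebesgue" "g \<in> borel_measurable lebesgue"
    using assms(3,4) by (simp_all add: measurable_completion)
  have "u \<bullet> v = (\<integral>x. f x \<bullet> g x \<partial>lebesgue)"
    unfolding inner_l2_eq
  proof (rule integral_cong_AE)
    show "AE x in lebesgue. rep_l2 u x \<bullet> rep_l2 v x = f x \<bullet> g x"
      using assms(1,2) unfolding represents_def by eventually_elim simp
  qed measurable
  also have "\<dots> = (\<integral>x. f x \<bullet> g x \<partial>lborel)"
    by (rule integral_completion, intro borel_measurable_inner) (simp_all add: assms)
  finally show ?thesis .
qed

lemma represents_zero: "represents (\<lambda>x. 0) 0"
  using represents_abs_l2[OF square_integrable_zero] by (simp add: zero_l2.abs_eq)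

lemma represents_add:
  assumes "represents f u" "represents g v"
  shows "represents (\<lambda>x. f x + g x) (u + v)"
proof -
  have "abs_l2 (\<lambda>x. rep_l2 u x + rep_l2 v x) = u + v"
    using plus_l2.abs_eq[of "rep_l2 u" "rep_l2 v"] by simp
  then have "represents (\<lambda>x. rep_l2 u x + rep_l2 v x) (u + v)"
    using represents_abs_l2[OF square_integrable_add[OF square_integrable_rep_l2 square_integrable_rep_l2], of u v]
    by simp
  then show ?thesis
    using assms unfolding represents_def by eventually_elim simp
qed

lemma represents_scaleR:
  assumes "represents f u"
  shows "represents (\<lambda>x. c *\<^sub>R f x) (c *\<^sub>R u)"
proof -
  have "abs_l2 (\<lambda>x. complex_of_real c * rep_l2 u x) = c *\<^sub>R u"
    using scaleR_l2.abs_eq[of "rep_l2 u" c] by simp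
  then have "represents (\<lambda>x. complex_of_real c * rep_l2 u x) (c *\<^sub>R u)"
    using represents_abs_l2[OF square_integrable_mult[OF square_integrable_rep_l2], of "complex_of_real c" u]
    by simp
  then show ?thesis
    using assms unfolding represents_def by eventually_elim (simp add: scaleR_conv_of_real)
qed

lemma represents_rep_l2: "represents (rep_l2 u) u"
  by (simp add: represents_def)

lemma subspace_closure:
  fixes S :: "'a::real_normed_vector set"
  assumes "subspace S"
  shows "subspace (closure S)"
proof (rule subspaceI)
  show "0 \<in> closure S"
    using subspace_0[OF assms] closure_subset by blast
next
  fix x y assume "x \<in> closure S" "y \<in> closure S"
  then obtain f g where f: "\<And>n. f n \<in> S" "f \<longlonglongrightarrow> x" and g: "\<And>n. g n \<in> S" "g \<longlonglongrightarrow> y"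
    unfolding closure_sequential by blast
  have "(\<lambda>n. f n + g n) \<longlonglongrightarrow> x + y" using f g by (intro tendsto_add)
  moreover have "f n + g n \<in> S" for n using f g assms by (simp add: subspace_add)
  ultimately show "x + y \<in> closure S"
    unfolding closure_sequential by (intro exI[of _ "\<lambda>n. f n + g n"]) simp
next
  fix c x assume "x \<in> closure S"
  then obtain f where f: "\<And>n. f n \<in> S" "f \<longlonglongrightarrow> x"
    unfolding closure_sequential by blast
  have "(\<lambda>n. c *\<^sub>R f n) \<longlonglongrightarrow> c *\<^sub>R x" using f by (intro tendsto_intros)
  moreover have "c *\<^sub>R f n \<in> S" for n using f assms by (simp add: subspace_scale)
  ultimately show "c *\<^sub>R x \<in> closure S"
    unfolding closure_sequential by (intro exI[of _ "\<lambda>n. c *\<^sub>R f n"]) simp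
qed

section \<open>The operator on test functions and its closure\<close>

lemma C_k_Suc_has_partial: "C_k (Suc k) f \<Longrightarrow> has_partial f (partial_deriv j f) j"
  by (simp add: has_partial_def partial_deriv_def vector_derivative_works[symmetric])

lemma C_k_SucI:
  assumes "continuous_on UNIV f" "\<And>j. has_partial f (f' j) j" "\<And>j. C_k k (f' j)"
  shows "C_k (Suc k) f"
proof -
  have "C_k k (partial_deriv j f)" for j
    using has_partial_imp_partial_deriv[OF assms(2)] assms(3) by simp
  then show ?thesis
    using assms(1,2) by (auto simp: has_partial_def intro: differentiableI_vector)
qed

lemma C_k_add: "C_k k f \<Longrightarrow> C_k k g \<Longrightarrow> C_k k (\<lambda>x. f x + g x)"
proof (induction k arbitrary: f g)
  case (Suc k)
  show ?case
  proof (rule C_k_SucI)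
    show "has_partial (\<lambda>x. f x + g x) (\<lambda>x. partial_deriv j f x + partial_deriv j g x) j" for j
      using Suc.prems by (intro has_partial_add C_k_Suc_has_partial)
    show "C_k k (\<lambda>x. partial_deriv j f x + partial_deriv j g x)" for j
      using Suc by simp
  qed (use Suc.prems in \<open>auto intro: continuous_intros\<close>)
qed (auto intro: continuous_intros)

lemma C_k_scaleR: "C_k k f \<Longrightarrow> C_k k (\<lambda>x. c *\<^sub>R f x)"
proof (induction k arbitrary: f)
  case (Suc k)
  show ?case
  proof (rule C_k_SucI)
    show "has_partial (\<lambda>x. c *\<^sub>R f x) (\<lambda>x. c *\<^sub>R partial_deriv j f x) j" for j
      using Suc.prems by (intro has_partial_linear[OF bounded_linear_scaleR_right] C_k_Suc_has_partial)
    show "C_k k (\<lambda>x. c *\<^sub>R partial_deriv j f x)" for j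
      using Suc by simp
  qed (use Suc.prems in \<open>auto intro: continuous_intros\<close>)
qed (auto intro: continuous_intros)

lemma test_function_add:
  assumes "test_function f" "test_function g"
  shows "test_function (\<lambda>x. f x + g x)"
proof -
  have "compact (closure {x. f x + g x \<noteq> 0})"
  proof (rule compact_closure[THEN iffD2], rule bounded_subset)
    show "bounded (closure {x. f x \<noteq> 0} \<union> closure {x. g x \<noteq> 0})"
      using assms by (simp add: test_function_def compact_imp_bounded)
    show "{x. f x + g x \<noteq> 0} \<subseteq> closure {x. f x \<noteq> 0} \<union> closure {x. g x \<noteq> 0}"
    proof -
      have "{x. f x + g x \<noteq> 0} \<subseteq> {x. f x \<noteq> 0} \<union> {x. g x \<noteq> 0}" by auto
      also have "\<dots> \<subseteq> closure {x. f x \<noteq> 0} \<union> closure {x. g x \<noteq> 0}"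
        by (intro Un_mono closure_subset)
      finally show ?thesis .
    qed
  qed
  then show ?thesis using assms by (simp add: test_function_def C_k_add)
qed

lemma test_function_scaleR:
  assumes "test_function f"
  shows "test_function (\<lambda>x. c *\<^sub>R f x)"
proof -
  have "compact (closure {x. c *\<^sub>R f x \<noteq> 0})"
  proof (rule compact_closure[THEN iffD2], rule bounded_subset)
    show "bounded (closure {x. f x \<noteq> 0})"
      using assms by (simp add: test_function_def compact_imp_bounded)
    show "{x. c *\<^sub>R f x \<noteq> 0} \<subseteq> closure {x. f x \<noteq> 0}"
      using closure_subset[of "{x. f x \<noteq> 0}"] by auto
  qed
  then show ?thesis using assms C_k_scaleR[of _ f c] by (auto simp: test_function_def)
qed

text \<open>The expanded form, from which linearity in \<phi> and Borel measurability can be read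
  off.\<close>

lemma magnetic_laplacian_eq:
  assumes "test_function \<phi>"
  shows "magnetic_laplacian A_log \<phi> x = - (\<Sum>j\<in>UNIV. partial_deriv j (partial_deriv j \<phi>) x)
    + (2 * ln_rad x) *\<^sub>R (\<i> * partial_deriv 3 \<phi> x) + (ln_rad x)\<^sup>2 *\<^sub>R \<phi> x"
proof -
  define a where "a j x = (if j = 3 then ln_rad x else 0)" for j :: 3 and x :: "real^3"
  have a: "A_log x $ j = a j x" "a j (x + t *\<^sub>R axis j 1) = a j x" for j x t
    by (simp_all add: a_def A_log_nth ln_rad_invariant)
  show ?thesis
    unfolding magnetic_laplacian_def magnetic_deriv_twice[OF assms a] sum_3
    by (simp add: a_def)
qed

lemma magnetic_laplacian_measurable:
  assumes "test_function \<phi>"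
  shows "magnetic_laplacian A_log \<phi> \<in> borel_measurable borel"
proof -
  have [measurable]: "partial_deriv j (partial_deriv j \<phi>) \<in> borel_measurable borel"
    "partial_deriv j \<phi> \<in> borel_measurable borel" "\<phi> \<in> borel_measurable borel" for j
    by (intro borel_measurable_continuous_onI test_function_continuous test_function_partial_deriv assms)+
  show ?thesis
    by (subst measurable_cong[OF magnetic_laplacian_eq[OF assms]]) measurable
qed

lemma partial_deriv_add:
  "test_function f \<Longrightarrow> test_function g \<Longrightarrow>
    partial_deriv j (\<lambda>x. f x + g x) = (\<lambda>x. partial_deriv j f x + partial_deriv j g x)"
  by (intro has_partial_imp_partial_deriv has_partial_add test_function_has_partial)

lemma partial_deriv_scaleR:
  "test_function f \<Longrightarrow> partial_deriv j (\<lambda>x. c *\<^sub>R f x) = (\<lambda>x. c *\<^sub>R partial_deriv j f x)"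
  by (intro has_partial_imp_partial_deriv has_partial_linear[OF bounded_linear_scaleR_right] test_function_has_partial)

definition H_core :: "(real^3) operator" where
  "H_core = {(u, w). \<exists>\<phi>. test_function \<phi> \<and> represents \<phi> u \<and> represents (magnetic_laplacian A_log \<phi>) w}"

lemma H_A_eq: "H_A = closure H_core"
  by (simp add: H_A_def H_core_def)

lemma test_function_zero: "test_function (\<lambda>x::real^'n::finite. 0)"
proof -
  have "C_k k (\<lambda>x::real^'n. 0)" for k
  proof (induction k)
    case (Suc k)
    then show ?case by (intro C_k_SucI[where f' = "\<lambda>j x. 0"] has_partial_const) auto
  qed simp
  then show ?thesis by (simp add: test_function_def)
qed

lemma subspace_H_core: "subspace H_core"
proof (rule subspaceI)
  have "magnetic_laplacian A_log (\<lambda>x. 0) = (\<lambda>x. 0)"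
    by (simp add: fun_eq_iff magnetic_laplacian_eq[OF test_function_zero]
      has_partial_imp_partial_deriv[OF has_partial_const])
  then show "0 \<in> H_core"
    unfolding H_core_def zero_prod_def
    by (auto intro!: exI[of _ "\<lambda>x. 0"] test_function_zero represents_zero)
next
  fix p q assume "p \<in> H_core" "q \<in> H_core"
  then obtain f g where f: "test_function f" "represents f (fst p)" "represents (magnetic_laplacian A_log f) (snd p)"
    and g: "test_function g" "represents g (fst q)" "represents (magnetic_laplacian A_log g) (snd q)"
    by (auto simp: H_core_def)
  have "magnetic_laplacian A_log (\<lambda>x. f x + g x) = (\<lambda>x. magnetic_laplacian A_log f x + magnetic_laplacian A_log g x)"
    by (simp add: fun_eq_iff magnetic_laplacian_eq test_function_add partial_deriv_add test_function_partial_deriv f g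
      sum.distrib algebra_simps)
  then show "p + q \<in> H_core"
    unfolding H_core_def plus_prod_def using f g
    by (auto intro!: exI[of _ "\<lambda>x. f x + g x"] test_function_add represents_add)
next
  fix c p assume "p \<in> H_core"
  then obtain f where f: "test_function f" "represents f (fst p)" "represents (magnetic_laplacian A_log f) (snd p)"
    by (auto simp: H_core_def)
  have "magnetic_laplacian A_log (\<lambda>x. c *\<^sub>R f x) = (\<lambda>x. c *\<^sub>R magnetic_laplacian A_log f x)"
    by (simp add: fun_eq_iff magnetic_laplacian_eq test_function_scaleR partial_deriv_scaleR test_function_partial_deriv f
      scaleR_sum_right scaleR_add_right scaleR_diff_right mult_ac)
  then show "c *\<^sub>R p \<in> H_core"
    unfolding H_core_def scaleR_prod_def using f
    by (auto intro!: exI[of _ "\<lambda>x. c *\<^sub>R f x"] test_function_scaleR represents_scaleR)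
qed

lemma subspace_H_A: "subspace H_A"
  unfolding H_A_eq by (rule subspace_closure[OF subspace_H_core])

section \<open>Symmetry and positivity, and their passage to the closure\<close>

lemma borel_measurable_test_function: "test_function \<phi> \<Longrightarrow> \<phi> \<in> borel_measurable borel"
  by (intro borel_measurable_continuous_onI test_function_continuous)

lemma H_core_symmetric:
  assumes "(u, w) \<in> H_core" "(u', w') \<in> H_core"
  shows "w \<bullet> u' = u \<bullet> w'"
proof -
  obtain f where f: "test_function f" "represents f u" "represents (magnetic_laplacian A_log f) w"
    using assms(1) by (auto simp: H_core_def)
  obtain g where g: "test_function g" "represents g u'" "represents (magnetic_laplacian A_log g) w'"
    using assms(2) by (auto simp: H_core_def)
  have "w \<bullet> u' = (\<integral>x. magnetic_laplacian A_log f x \<bullet> g x \<partial>lborel)"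
    using f g by (intro inner_represents borel_measurable_test_function magnetic_laplacian_measurable)
  also have "\<dots> = (\<integral>x. magnetic_laplacian A_log g x \<bullet> f x \<partial>lborel)"
    unfolding magnetic_laplacian_form(2)[OF f(1) g(1)] magnetic_laplacian_form(2)[OF g(1) f(1)]
    by (simp add: inner_commute)
  also have "\<dots> = w' \<bullet> u"
    using f g by (intro inner_represents[symmetric] borel_measurable_test_function magnetic_laplacian_measurable)
  finally show ?thesis by (simp add: inner_commute)
qed

lemma H_A_approx:
  assumes "(u, w) \<in> H_A"
  obtains U Z where "\<And>n. (U n, Z n) \<in> H_core" "U \<longlonglongrightarrow> u" "Z \<longlonglongrightarrow> w"
proof -
  obtain f where f: "\<And>n. f n \<in> H_core" "f \<longlonglongrightarrow> (u, w)"
    using assms unfolding H_A_eq closure_sequential by blast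
  show ?thesis
    by (rule that[of "\<lambda>n. fst (f n)" "\<lambda>n. snd (f n)"])
      (use f tendsto_fst[OF f(2)] tendsto_snd[OF f(2)] in simp_all)
qed

text \<open>A point of the closed graph is a limit of points of \<open>H_core\<close> in both
  components at once, and the inner product is continuous.\<close>

lemma H_A_symmetric:
  assumes "(u, w) \<in> H_A" "(u', w') \<in> H_A"
  shows "w \<bullet> u' = u \<bullet> w'"
proof -
  obtain U Z where U: "\<And>n. (U n, Z n) \<in> H_core" "U \<longlonglongrightarrow> u" "Z \<longlonglongrightarrow> w"
    using H_A_approx[OF assms(1)] by metis
  obtain U' Z' where U': "\<And>n. (U' n, Z' n) \<in> H_core" "U' \<longlonglongrightarrow> u'" "Z' \<longlonglongrightarrow> w'"
    using H_A_approx[OF assms(2)] by metis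
  have "(\<lambda>n. Z n \<bullet> U' n) \<longlonglongrightarrow> w \<bullet> u'" "(\<lambda>n. U n \<bullet> Z' n) \<longlonglongrightarrow> u \<bullet> w'"
    using U U' by (intro tendsto_inner; simp)+
  moreover have "(\<lambda>n. Z n \<bullet> U' n) = (\<lambda>n. U n \<bullet> Z' n)"
    using H_core_symmetric[OF U(1) U'(1)] by simp
  ultimately show ?thesis
    using LIMSEQ_unique by metis
qed

lemma H_core_energy:
  assumes "test_function \<phi>" "represents \<phi> u" "represents (magnetic_laplacian A_log \<phi>) w"
  shows "w \<bullet> u = total_energy \<phi>"
  unfolding integral_magnetic_laplacian[OF assms(1), symmetric]
  using assms by (intro inner_represents borel_measurable_test_function magnetic_laplacian_measurable)

lemma H_A_nonneg:
  assumes "(u, w) \<in> H_A"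
  shows "0 \<le> w \<bullet> u"
proof -
  obtain U Z where U: "\<And>n. (U n, Z n) \<in> H_core" "U \<longlonglongrightarrow> u" "Z \<longlonglongrightarrow> w"
    using H_A_approx[OF assms] by metis
  have "0 \<le> Z n \<bullet> U n" for n
    using U(1)[of n] H_core_energy by (auto simp: H_core_def energy_nonneg)
  then show ?thesis
    using tendsto_inner[OF U(3,2)] by (rule_tac LIMSEQ_le_const) auto
qed

text \<open>The factor may be infinite, where multiplication is not continuous; the inequality
  survives because the product is 0 when the limit is 0, and otherwise the factors are eventually
  positive.\<close>

lemma ennreal_mult_le_liminf:
  fixes c x :: ennreal
  assumes "f \<longlonglongrightarrow> x"
  shows "c * x \<le> liminf (\<lambda>n. c * f n)"
proof (cases "c < top")
  case True
  then have "(\<lambda>n. c * f n) \<longlonglongrightarrow> c * x"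
    using assms by (rule ennreal_tendsto_cmult)
  then show ?thesis
    by (simp add: lim_imp_Liminf)
next
  case False
  then have c: "c = top" by (simp add: less_top[symmetric])
  show ?thesis
  proof (cases "x = 0")
    case False
    then have "\<forall>\<^sub>F n in sequentially. 0 < f n"
      using assms by (intro order_tendstoD) (auto simp: zero_less_iff_neq_zero)
    then have "\<forall>\<^sub>F n in sequentially. c * x \<le> c * f n"
      by eventually_elim (simp add: c ennreal_top_mult)
    then show ?thesis by (rule Liminf_bounded)
  qed simp
qed

text \<open>The squared moduli of the differences tend to 0 in L1, so a subsequence tends to 0
  almost everywhere.\<close>

lemma l2_convergent_subsequence:
  assumes "U \<longlonglongrightarrow> u"
  obtains r :: "nat \<Rightarrow> nat" where "strict_mono r" "AE x in lebesgue. (\<lambda>n. rep_l2 (U (r n)) x) \<longlonglongrightarrow> rep_l2 u x"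
proof -
  define g where "g n x = (norm (rep_l2 (U n - u) x))\<^sup>2" for n x
  have eq: "(\<integral>x. norm (g n x) \<partial>lebesgue) = (norm (U n - u))\<^sup>2" for n
    by (simp add: g_def power2_norm_eq_inner inner_l2_eq)
  have "(\<lambda>n. (norm (U n - u))\<^sup>2) \<longlonglongrightarrow> 0\<^sup>2"
    using assms by (intro tendsto_power) (simp add: tendsto_norm_zero_iff LIM_zero_iff)
  then have "(\<lambda>n. \<integral>x. norm (g n x) \<partial>lebesgue) \<longlonglongrightarrow> 0"
    by (simp only: eq) simp
  moreover have "integrable lebesgue (g n)" for n
    using square_integrable_rep_l2[of "U n - u"] unfolding square_integrable_def g_def by blast
  ultimately obtain r :: "nat \<Rightarrow> nat" where r: "strict_mono r" "AE x in lebesgue. (\<lambda>n. g (r n) x) \<longlonglongrightarrow> 0"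
    using tendsto_L1_AE_subseq by blast
  \<comment> \<open>Chosen representatives respect subtraction only almost everywhere; the countably
    many exceptional null sets are collected into one.\<close>
  have "AE x in lebesgue. \<forall>n. rep_l2 (U n - u) x = rep_l2 (U n) x - rep_l2 u x"
  proof (subst AE_all_countable, rule allI)
    fix n
    have "represents (\<lambda>x. rep_l2 (U n) x + (-1) *\<^sub>R rep_l2 u x) (U n + (-1) *\<^sub>R u)"
      by (intro represents_add represents_scaleR represents_rep_l2)
    then show "AE x in lebesgue. rep_l2 (U n - u) x = rep_l2 (U n) x - rep_l2 u x"
      unfolding represents_def by (auto elim: eventually_mono)
  qed
  then have "AE x in lebesgue. (\<lambda>n. rep_l2 (U (r n)) x) \<longlonglongrightarrow> rep_l2 u x"
    using r(2)
  proof eventually_elim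
    fix x assume x: "\<forall>n. rep_l2 (U n - u) x = rep_l2 (U n) x - rep_l2 u x" "(\<lambda>n. g (r n) x) \<longlonglongrightarrow> 0"
    have "(\<lambda>n. sqrt (g (r n) x)) \<longlonglongrightarrow> sqrt 0"
      by (intro tendsto_real_sqrt x)
    then have "(\<lambda>n. norm (rep_l2 (U (r n)) x - rep_l2 u x)) \<longlonglongrightarrow> 0"
      by (simp add: g_def x(1))
    then show "(\<lambda>n. rep_l2 (U (r n)) x) \<longlonglongrightarrow> rep_l2 u x"
      by (simp add: tendsto_norm_zero_iff LIM_zero_iff)
  qed
  with r(1) show ?thesis using that by blast
qed

text \<open>Fatou's lemma along an almost everywhere convergent subsequence. The weight may be
  unbounded, even infinite, so lower semicontinuity replaces continuity.\<close>

lemma weighted_norm_lsc: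
  assumes [measurable]: "W \<in> borel_measurable lebesgue" and U: "U \<longlonglongrightarrow> u" and c: "c \<longlonglongrightarrow> c0"
    and le: "\<And>n. (\<integral>\<^sup>+x. W x * ennreal ((norm (rep_l2 (U n) x))\<^sup>2) \<partial>lebesgue) \<le> ennreal (c n)"
  shows "(\<integral>\<^sup>+x. W x * ennreal ((norm (rep_l2 u x))\<^sup>2) \<partial>lebesgue) \<le> ennreal c0"
proof -
  obtain r :: "nat \<Rightarrow> nat" where r: "strict_mono r" "AE x in lebesgue. (\<lambda>n. rep_l2 (U (r n)) x) \<longlonglongrightarrow> rep_l2 u x"
    using l2_convergent_subsequence[OF U] .
  have "(\<integral>\<^sup>+x. W x * ennreal ((norm (rep_l2 u x))\<^sup>2) \<partial>lebesgue)
    \<le> (\<integral>\<^sup>+x. liminf (\<lambda>n. W x * ennreal ((norm (rep_l2 (U (r n)) x))\<^sup>2)) \<partial>lebesgue)"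
  proof (rule nn_integral_mono_AE)
    show "AE x in lebesgue. W x * ennreal ((norm (rep_l2 u x))\<^sup>2)
      \<le> liminf (\<lambda>n. W x * ennreal ((norm (rep_l2 (U (r n)) x))\<^sup>2))"
      using r(2)
    proof eventually_elim
      fix x assume "(\<lambda>n. rep_l2 (U (r n)) x) \<longlonglongrightarrow> rep_l2 u x"
      then show "W x * ennreal ((norm (rep_l2 u x))\<^sup>2)
        \<le> liminf (\<lambda>n. W x * ennreal ((norm (rep_l2 (U (r n)) x))\<^sup>2))"
        by (intro ennreal_mult_le_liminf tendsto_ennrealI tendsto_intros)
    qed
  qed
  also have "\<dots> \<le> liminf (\<lambda>n. \<integral>\<^sup>+x. W x * ennreal ((norm (rep_l2 (U (r n)) x))\<^sup>2) \<partial>lebesgue)"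
    by (intro nn_integral_liminf) measurable
  also have "\<dots> \<le> liminf (\<lambda>n. ennreal (c (r n)))"
    by (intro Liminf_mono always_eventually allI le)
  also have "\<dots> = ennreal c0"
  proof (rule lim_imp_Liminf)
    have "(\<lambda>n. c (r n)) \<longlonglongrightarrow> c0"
      using LIMSEQ_subseq_LIMSEQ[OF c r(1)] by (simp add: o_def)
    then show "(\<lambda>n. ennreal (c (r n))) \<longlonglongrightarrow> ennreal c0"
      by (rule tendsto_ennrealI)
  qed simp
  finally show ?thesis .
qed

lemma square_integrable_cell_cutoff:
  assumes "0 < s" "norm z \<le> 1"
  shows "square_integrable (\<lambda>x. (indicator {y. cell s y = k} x * cutoff x) *\<^sub>R z)"
proof -
  have [measurable]: "cutoff \<in> borel_measurable borel" "{y. cell s y = k} \<in> sets borel"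
    using assms sets_cell by (auto intro: borel_measurable_continuous_onI continuous_on_cutoff)
  let ?f = "\<lambda>x. (indicator {y. cell s y = k} x * cutoff x) *\<^sub>R z"
  have m: "?f \<in> borel_measurable lborel" by measurable
  have "integrable lborel (\<lambda>x. (norm (?f x))\<^sup>2)"
  proof (rule Bochner_Integration.integrable_bound)
    show "integrable lborel (indicat_real {y. cell s y = k})"
      using emeasure_cell[OF assms(1), of k] by (intro integrable_real_indicator) auto
    have "(norm (cutoff x *\<^sub>R z))\<^sup>2 \<le> 1" for x
    proof -
      have "norm (cutoff x *\<^sub>R z) \<le> 1"
        using cutoff_le_1[of x] assms(2) by (simp add: mult_le_one)
      then show ?thesis by (simp add: power_le_one)
    qed
    then show "AE x in lborel. norm ((norm (?f x))\<^sup>2) \<le> norm (indicat_real {y. cell s y = k} x)"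
      by (intro AE_I2) (auto simp: indicator_def)
  qed measurable
  then have "integrable lebesgue (\<lambda>x. (norm (?f x))\<^sup>2)"
    by (subst integrable_completion) measurable
  then show ?thesis
    unfolding square_integrable_def using measurable_completion[OF m] by blast
qed

text \<open>The cell moments are rewritten as squared inner products with fixed L2 vectors. In that
  form they converge along sequences in the graph, so the bound for test functions extends to the
  closure, and they vanish on the orthogonal complement of these vectors.\<close>

lemma form_bound_H_A:
  assumes v: "in_Lp p v" "\<And>z. 0 \<le> v z" and p: "1 \<le> p" and \<alpha>: "1 < \<alpha>"
  obtains W :: "real^3 \<Rightarrow> ennreal" and B :: "(real^3) l2 set"
  where "W \<in> borel_measurable borel" "\<And>x. ennreal (bracket x powr (- \<alpha>) * v (x $ 3)) \<le> W x" "finite B"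
    and "\<And>u w. (u, w) \<in> H_A \<Longrightarrow> \<forall>b\<in>B. u \<bullet> b = 0 \<Longrightarrow>
      (\<integral>\<^sup>+x. W x * ennreal ((norm (rep_l2 u x))\<^sup>2) \<partial>lebesgue) \<le> ennreal (w \<bullet> u / 2)"
proof -
  obtain W :: "real^3 \<Rightarrow> ennreal" and K :: "(3 \<Rightarrow> int) set" and s C :: real
    where W[measurable]: "W \<in> borel_measurable borel" and WV: "\<And>x. ennreal (bracket x powr (- \<alpha>) * v (x $ 3)) \<le> W x"
    and K: "finite K" and s: "0 < s" and C: "0 \<le> C"
    and bound: "\<And>u. test_function u \<Longrightarrow> (\<integral>\<^sup>+x. W x * ennreal ((norm (u x))\<^sup>2) \<partial>lborel)
      \<le> ennreal (total_energy u / 2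
        + C * cell_moments s K u)"
    by (rule form_bound_test_functions[OF v p \<alpha>]) (rule that)
  \<comment> \<open>The Riesz vectors of the moments: pairing with \<open>g k z\<close> gives the
    component of the \<open>k\<close>-th moment in the direction \<open>z\<close>.\<close>
  define g where "g k z x = (indicator {y. cell s y = k} x * cutoff x) *\<^sub>R z" for k and z :: complex and x
  define e where "e k z = abs_l2 (g k z)" for k z
  have ge: "represents (g k z) (e k z)" if "norm z \<le> 1" for k z
    unfolding e_def g_def using s that by (intro represents_abs_l2 square_integrable_cell_cutoff)
  have [measurable]: "cutoff \<in> borel_measurable borel" "{y. cell s y = k} \<in> sets borel" for k
    using s sets_cell by (auto intro: borel_measurable_continuous_onI continuous_on_cutoff)
  have [measurable]: "g k z \<in> borel_measurable borel" for k z
    unfolding g_def[abs_def] by measurable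
  \<comment> \<open>The directions 1 and i recover the real and imaginary part, since the inner
    product is real-valued.\<close>
  define Q where "Q u = (\<Sum>k\<in>K. (u \<bullet> e k 1)\<^sup>2 + (u \<bullet> e k \<i>)\<^sup>2)" for u
  have core: "(\<integral>\<^sup>+x. W x * ennreal ((norm (rep_l2 u x))\<^sup>2) \<partial>lebesgue) \<le> ennreal (w \<bullet> u / 2 + C * Q u)"
    if uw: "(u, w) \<in> H_core" for u w
  proof -
    obtain f where f: "test_function f" "represents f u" "represents (magnetic_laplacian A_log f) w"
      using uw by (auto simp: H_core_def)
    have fm[measurable]: "f \<in> borel_measurable borel" using f(1) by (rule borel_measurable_test_function)
    obtain R where R: "supported_in R f" using test_function_supported[OF f(1)] by metis
    have int: "integrable lborel (\<lambda>y. indicator {y. cell s y = k} y *\<^sub>R (cutoff y *\<^sub>R f y))" for k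
    proof (rule Bochner_Integration.integrable_bound)
      show "integrable lborel (\<lambda>y. norm (f y))"
        using test_function_continuous[OF f(1)] R
        by (intro integrable_cs[where R = R] continuous_intros) (auto simp: supported_in_def)
      have "norm (cutoff y *\<^sub>R f y) \<le> norm (f y)" for y
        using cutoff_le_1[of y] by (simp add: mult_left_le_one_le)
      then show "AE y in lborel. norm (indicator {y. cell s y = k} y *\<^sub>R (cutoff y *\<^sub>R f y)) \<le> norm (norm (f y))"
        by (intro AE_I2) (auto simp: indicator_def)
    qed measurable
    have "(norm (\<integral>y. indicator {y. cell s y = k} y *\<^sub>R (cutoff y *\<^sub>R f y) \<partial>lborel))\<^sup>2 = (u \<bullet> e k 1)\<^sup>2 + (u \<bullet> e k \<i>)\<^sup>2" for k
    proof -
      define I where "I = (\<integral>y. indicator {y. cell s y = k} y *\<^sub>R (cutoff y *\<^sub>R f y) \<partial>lborel)"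
      have "u \<bullet> e k z = I \<bullet> z" if "norm z \<le> 1" for z
      proof -
        have "u \<bullet> e k z = (\<integral>y. f y \<bullet> g k z y \<partial>lborel)"
          using f(2) ge[OF that] by (intro inner_represents) measurable
        also have "\<dots> = (\<integral>y. (indicator {y. cell s y = k} y *\<^sub>R (cutoff y *\<^sub>R f y)) \<bullet> z \<partial>lborel)"
          by (intro Bochner_Integration.integral_cong refl) (simp add: g_def mult.assoc)
        also have "\<dots> = I \<bullet> z"
          unfolding I_def using int by (rule integral_inner_left)
        finally show ?thesis .
      qed
      then have "u \<bullet> e k 1 = Re I" "u \<bullet> e k \<i> = Im I"
        by (simp_all add: inner_complex_def)
      then show ?thesis unfolding I_def[symmetric] by (simp add: cmod_power2)
    qed
    then have S: "cell_moments s K f = Q u"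
      by (simp add: Q_def)
    have "(\<integral>\<^sup>+x. W x * ennreal ((norm (rep_l2 u x))\<^sup>2) \<partial>lebesgue) = (\<integral>\<^sup>+x. W x * ennreal ((norm (f x))\<^sup>2) \<partial>lebesgue)"
    proof (rule nn_integral_cong_AE)
      show "AE x in lebesgue. W x * ennreal ((norm (rep_l2 u x))\<^sup>2) = W x * ennreal ((norm (f x))\<^sup>2)"
        using f(2) unfolding represents_def by eventually_elim simp
    qed
    also have "\<dots> = (\<integral>\<^sup>+x. W x * ennreal ((norm (f x))\<^sup>2) \<partial>lborel)"
      by (rule nn_integral_completion)
    also have "\<dots> \<le> ennreal (total_energy f / 2 + C * Q u)"
      using bound[OF f(1)] unfolding S .
    finally show ?thesis
      using H_core_energy[OF f] by simp
  qed
  define B where "B = (\<lambda>k. e k 1) ` K \<union> (\<lambda>k. e k \<i>) ` K"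
  show ?thesis
  proof (rule that[of W B])
    show "finite B" using K by (simp add: B_def)
    fix u w assume uw: "(u, w) \<in> H_A" and orth: "\<forall>b\<in>B. u \<bullet> b = 0"
    obtain U Z where U: "\<And>n. (U n, Z n) \<in> H_core" "U \<longlonglongrightarrow> u" "Z \<longlonglongrightarrow> w"
      using H_A_approx[OF uw] by metis
    have "(\<integral>\<^sup>+x. W x * ennreal ((norm (rep_l2 u x))\<^sup>2) \<partial>lebesgue) \<le> ennreal (w \<bullet> u / 2 + C * Q u)"
    proof (rule weighted_norm_lsc[OF _ U(2)])
      show "W \<in> borel_measurable lebesgue" using W by (simp add: measurable_completion)
      show "(\<integral>\<^sup>+x. W x * ennreal ((norm (rep_l2 (U n) x))\<^sup>2) \<partial>lebesgue) \<le> ennreal (Z n \<bullet> U n / 2 + C * Q (U n))" for n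
        by (rule core[OF U(1)])
      show "(\<lambda>n. Z n \<bullet> U n / 2 + C * Q (U n)) \<longlonglongrightarrow> w \<bullet> u / 2 + C * Q u"
        unfolding Q_def by (intro tendsto_intros U) auto
    qed
    moreover have "Q u = 0" using orth by (simp add: Q_def B_def)
    ultimately show "(\<integral>\<^sup>+x. W x * ennreal ((norm (rep_l2 u x))\<^sup>2) \<partial>lebesgue) \<le> ennreal (w \<bullet> u / 2)"
      by simp
  qed (use W WV in auto)
qed

section \<open>Finiteness of the negative spectrum\<close>

lemma subspace_mult_op: "subspace (mult_op V)"
proof (rule subspaceI)
  have z: "represents (\<lambda>x. complex_of_real (V x) * rep_l2 0 x) 0"
    using represents_zero[where 'a = 'a] unfolding represents_def by eventually_elim (metis mult_zero_right)
  then show "0 \<in> mult_op V" by (simp add: mult_op_def zero_prod_def)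
next
  fix p q assume p: "p \<in> mult_op V" and q: "q \<in> mult_op V"
  have "represents (\<lambda>x. complex_of_real (V x) * rep_l2 (fst p) x + complex_of_real (V x) * rep_l2 (fst q) x) (snd p + snd q)"
    using p q by (intro represents_add) (auto simp: mult_op_def)
  moreover have "represents (\<lambda>x. rep_l2 (fst p) x + rep_l2 (fst q) x) (fst p + fst q)"
    by (intro represents_add represents_rep_l2)
  ultimately have "represents (\<lambda>x. complex_of_real (V x) * rep_l2 (fst p + fst q) x) (snd p + snd q)"
    unfolding represents_def by eventually_elim (metis distrib_left)
  then show "p + q \<in> mult_op V" by (simp add: mult_op_def plus_prod_def)
next
  fix c p assume p: "p \<in> mult_op V"
  have "represents (\<lambda>x. c *\<^sub>R (complex_of_real (V x) * rep_l2 (fst p) x)) (c *\<^sub>R snd p)"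
    using p by (intro represents_scaleR) (auto simp: mult_op_def)
  moreover have "represents (\<lambda>x. c *\<^sub>R rep_l2 (fst p) x) (c *\<^sub>R fst p)"
    by (intro represents_scaleR represents_rep_l2)
  ultimately have "represents (\<lambda>x. complex_of_real (V x) * rep_l2 (c *\<^sub>R fst p) x) (c *\<^sub>R snd p)"
    unfolding represents_def by eventually_elim (metis mult_scaleR_right)
  then show "c *\<^sub>R p \<in> mult_op V" by (simp add: mult_op_def scaleR_prod_def)
qed

text \<open>Integrability holds because \<open>w\<close>, which equals \<open>V\<close> times
  \<open>u\<close> almost everywhere, is itself square integrable.\<close>

lemma inner_mult_op:
  assumes "V \<in> borel_measurable lebesgue" "(u, w) \<in> mult_op V"
  shows "w \<bullet> u' = (\<integral>x. V x * (rep_l2 u x \<bullet> rep_l2 u' x) \<partial>lebesgue)"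
    and "integrable lebesgue (\<lambda>x. V x * (rep_l2 u x \<bullet> rep_l2 u' x))"
proof -
  note [measurable] = assms(1)
  have ae: "AE x in lebesgue. rep_l2 w x \<bullet> rep_l2 u' x = V x * (rep_l2 u x \<bullet> rep_l2 u' x)"
    using assms(2) unfolding mult_op_def represents_def mem_Collect_eq case_prod_conv
    by eventually_elim (metis inner_scaleR_left scaleR_conv_of_real)
  show "w \<bullet> u' = (\<integral>x. V x * (rep_l2 u x \<bullet> rep_l2 u' x) \<partial>lebesgue)"
    unfolding inner_l2_eq by (rule integral_cong_AE[OF _ _ ae]) measurable
  have "integrable lebesgue (\<lambda>x. rep_l2 w x \<bullet> rep_l2 u' x)"
    by (intro square_integrable_inner square_integrable_rep_l2)
  then show "integrable lebesgue (\<lambda>x. V x * (rep_l2 u x \<bullet> rep_l2 u' x))"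
    by (subst (asm) integrable_cong_AE[OF _ _ ae]) measurable
qed

lemma mult_op_symmetric:
  assumes "V \<in> borel_measurable lebesgue" "(u, w) \<in> mult_op V" "(u', w') \<in> mult_op V"
  shows "w \<bullet> u' = u \<bullet> w'"
  using inner_mult_op(1)[OF assms(1,2), of u'] inner_mult_op(1)[OF assms(1,3), of u]
  by (simp add: inner_commute)

lemma subspace_op_minus:
  assumes "subspace S" "subspace T"
  shows "subspace (op_minus S T)"
proof (rule subspaceI)
  show "0 \<in> op_minus S T"
    using subspace_0[OF assms(1)] subspace_0[OF assms(2)]
    unfolding op_minus_def zero_prod_def by force
next
  fix p q assume "p \<in> op_minus S T" "q \<in> op_minus S T"
  then obtain u a b v c d where "p = (u, a - b)" "(u, a) \<in> S" "(u, b) \<in> T" "q = (v, c - d)" "(v, c) \<in> S" "(v, d) \<in> T"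
    by (auto simp: op_minus_def)
  then have "p + q = (u + v, (a + c) - (b + d))" "(u + v, a + c) \<in> S" "(u + v, b + d) \<in> T"
    using subspace_add[OF assms(1), of "(u, a)" "(v, c)"] subspace_add[OF assms(2), of "(u, b)" "(v, d)"] by auto
  then show "p + q \<in> op_minus S T" unfolding op_minus_def by blast
next
  fix r p assume "p \<in> op_minus S T"
  then obtain u a b where "p = (u, a - b)" "(u, a) \<in> S" "(u, b) \<in> T"
    by (auto simp: op_minus_def)
  then have "r *\<^sub>R p = (r *\<^sub>R u, r *\<^sub>R a - r *\<^sub>R b)" "(r *\<^sub>R u, r *\<^sub>R a) \<in> S" "(r *\<^sub>R u, r *\<^sub>R b) \<in> T"
    using subspace_scale[OF assms(1), of "(u, a)" r] subspace_scale[OF assms(2), of "(u, b)" r]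
    by (auto simp: scaleR_diff_right)
  then show "r *\<^sub>R p \<in> op_minus S T" unfolding op_minus_def by blast
qed

lemma japanese_bracket_eq: "japanese_bracket (x $ 1, x $ 2) = bracket x"
  by (simp add: japanese_bracket_def bracket_def rad2_def norm_prod_def)

theorem theorem1p3:
  fixes V :: "real^3 \<Rightarrow> real" and v_perp :: "real \<Rightarrow> real" and \<alpha> p :: real
  assumes "V \<in> borel_measurable lebesgue"
    and "compact_op ((op_plus H_A Id)\<inverse> O mult_op V)"
    and "\<forall>x. V x \<le> japanese_bracket (x $ 1, x $ 2) powr (- \<alpha>) * v_perp (x $ 3)"
    and "\<alpha> > 1"
    and "1 \<le> p" and "p \<le> 2"
    and "in_Lp p v_perp" and "\<forall>z. v_perp z \<ge> 0"
  shows "finite {\<mu>::real. \<mu> < 0 \<and> eigenvalue (op_minus H_A (mult_op V)) (complex_of_real \<mu>)} \<and>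
    (\<forall>\<mu><0. finite_multiplicity (op_minus H_A (mult_op V)) (complex_of_real \<mu>))"
proof -
  have v0: "\<And>z. 0 \<le> v_perp z" using assms(8) by simp
  obtain W :: "real^3 \<Rightarrow> ennreal" and B :: "(real^3) l2 set"
    where "W \<in> borel_measurable borel"
    and WV: "\<And>x. ennreal (bracket x powr (- \<alpha>) * v_perp (x $ 3)) \<le> W x" and B: "finite B"
    and bound: "\<And>u w. (u, w) \<in> H_A \<Longrightarrow> \<forall>b\<in>B. u \<bullet> b = 0 \<Longrightarrow>
      (\<integral>\<^sup>+x. W x * ennreal ((norm (rep_l2 u x))\<^sup>2) \<partial>lebesgue) \<le> ennreal (w \<bullet> u / 2)"
    by (rule form_bound_H_A[OF assms(7) v0 assms(5,4)]) (rule that)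
  show ?thesis
  proof (rule finite_negative_spectrum[OF _ _ B])
    show "subspace (op_minus H_A (mult_op V))"
      by (intro subspace_op_minus subspace_H_A subspace_mult_op)
  next
    fix u w u' w' assume "(u, w) \<in> op_minus H_A (mult_op V)" "(u', w') \<in> op_minus H_A (mult_op V)"
    then obtain a b a' b' where ab: "w = a - b" "(u, a) \<in> H_A" "(u, b) \<in> mult_op V"
      "w' = a' - b'" "(u', a') \<in> H_A" "(u', b') \<in> mult_op V"
      by (auto simp: op_minus_def)
    then show "w \<bullet> u' = u \<bullet> w'"
      using H_A_symmetric[OF ab(2,5)] mult_op_symmetric[OF assms(1) ab(3,6)]
      by (simp add: inner_diff_left inner_diff_right)
  next
    fix u w assume "(u, w) \<in> op_minus H_A (mult_op V)" and orth: "\<forall>b\<in>B. u \<bullet> b = 0"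
    then obtain a b where ab: "w = a - b" "(u, a) \<in> H_A" "(u, b) \<in> mult_op V"
      by (auto simp: op_minus_def)
    \<comment> \<open>\<open>ennreal\<close> sends negative values to 0, so the right-hand side
      keeps only the positive part of \<open>V\<close>; this is the part that the upper bound on
      \<open>V\<close> controls.\<close>
    have "ennreal (b \<bullet> u) \<le> (\<integral>\<^sup>+x. ennreal (V x * (norm (rep_l2 u x))\<^sup>2) \<partial>lebesgue)"
    proof -
      have i: "integrable lebesgue (\<lambda>x. V x * (norm (rep_l2 u x))\<^sup>2)"
        using inner_mult_op(2)[OF assms(1) ab(3), of u] by (simp add: dot_square_norm)
      have "b \<bullet> u = (\<integral>x. V x * (norm (rep_l2 u x))\<^sup>2 \<partial>lebesgue)"
        using inner_mult_op(1)[OF assms(1) ab(3), of u] by (simp add: dot_square_norm)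
      also have "\<dots> \<le> (\<integral>x. max 0 (V x * (norm (rep_l2 u x))\<^sup>2) \<partial>lebesgue)"
        using i by (intro integral_mono integrable_max) auto
      finally have "ennreal (b \<bullet> u) \<le> ennreal (\<integral>x. max 0 (V x * (norm (rep_l2 u x))\<^sup>2) \<partial>lebesgue)"
        by (rule ennreal_leI)
      also have "\<dots> = (\<integral>\<^sup>+x. ennreal (max 0 (V x * (norm (rep_l2 u x))\<^sup>2)) \<partial>lebesgue)"
        using i by (intro nn_integral_eq_integral[symmetric] integrable_max) auto
      also have "\<dots> = (\<integral>\<^sup>+x. ennreal (V x * (norm (rep_l2 u x))\<^sup>2) \<partial>lebesgue)"
        by (intro nn_integral_cong) (simp add: max_def ennreal_neg)
      finally show ?thesis .
    qed
    also have "\<dots> \<le> (\<integral>\<^sup>+x. W x * ennreal ((norm (rep_l2 u x))\<^sup>2) \<partial>lebesgue)"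
    proof (rule nn_integral_mono)
      fix x
      have "V x * (norm (rep_l2 u x))\<^sup>2 \<le> (bracket x powr (- \<alpha>) * v_perp (x $ 3)) * (norm (rep_l2 u x))\<^sup>2"
        using assms(3) by (intro mult_right_mono) (auto simp: japanese_bracket_eq)
      then have "ennreal (V x * (norm (rep_l2 u x))\<^sup>2)
        \<le> ennreal (bracket x powr (- \<alpha>) * v_perp (x $ 3)) * ennreal ((norm (rep_l2 u x))\<^sup>2)"
        using v0 by (subst ennreal_mult[symmetric]) (auto intro: ennreal_leI)
      also have "\<dots> \<le> W x * ennreal ((norm (rep_l2 u x))\<^sup>2)"
        by (rule mult_right_mono[OF WV]) simp
      finally show "ennreal (V x * (norm (rep_l2 u x))\<^sup>2) \<le> W x * ennreal ((norm (rep_l2 u x))\<^sup>2)" .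
    qed
    also have "\<dots> \<le> ennreal (a \<bullet> u / 2)"
      using ab(2) orth by (rule bound)
    \<comment> \<open>The return to real numbers relies on \<open>a \<bullet> u\<close> being
      nonnegative, for otherwise \<open>ennreal\<close> would truncate it. The form of the
      difference operator is then at least half of \<open>a \<bullet> u\<close>.\<close>
    finally have "b \<bullet> u \<le> a \<bullet> u / 2"
      using H_A_nonneg[OF ab(2)] by (simp add: ennreal_le_iff)
    then show "0 \<le> w \<bullet> u"
      using H_A_nonneg[OF ab(2)] by (simp add: ab(1) inner_diff_left)
  qed
qed

end
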